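(* Consider the zero-sum differential game with data $T>0$, $n,k,l\ge 1$, nonempty compact sets $\mathcal U\subset\mathbb R^k$, $\mathcal V\subset\mathbb R^l$, and functions $f,f^0,\sigma$ as in the context (including the regularity assumptions on $f,f^0,\sigma$ stated there). Suppose Isaacs's condition holds: for all $t\in[0,T]$ and $x,s\in\mathbb R^n$, $$\min_{u\in\mathcal U}\max_{v\in\mathcal V}\big(\langle f(t,x,u,v),s\rangle+f^0(t,x,u,v)\big)=\max_{v\in\mathcal V}\min_{u\in\mathcal U}\big(\langle f(t,x,u,v),s\rangle+f^0(t,x,u,v)\big),$$ and suppose that the value function $V$ of the game (defined in the context) is continuously differentiable at every $(\tau,w)\in[0,T]\times\mathbb R^n$. Then: (a) For every compact set $D\subset\mathbb R^n$ and every $\varepsilon>0$ there exists $\delta>0$ such that for every $\tau\in[0,T)$ and every partition $\Delta=\{t_i:\ \tau=t_0<t_1<\dots<t_{m+1}=T\}$ with $d(\Delta)\le\delta$ there exists a continuous function $Q^\Delta:\Delta\times\mathbb R^n\times\mathcal U\times\mathcal V\to\mathbb R$, with $Q^\Delta(t_{m+1},x,u,v)=\sigma(x)$ for all $x,u,v$, such that $$\Big|Q^\Delta(t_i,x,u,v)-r-\min_{u'\in\mathcal U}\max_{v'\in\mathcal V}Q^\Delta(t_{i+1},x',u',v')\Big|\le\Delta t_i\,\varepsilon,$$ $$\Big|Q^\Delta(t_i,x,u,v)-r-\max_{v'\in\mathcal V}\min_{u'\in\mathcal U}Q^\Delta(t_{i+1},x',u',v')\Big|\le\Delta t_i\,\varepsilon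 \qquad ( * )$$ for all $i\in\{0,\dots,m\}$, $x\in D$, $u\in\mathcal U$, $v\in\mathcal V$, where $r=\Delta t_i f^0(t_i,x,u,v)$ and $x'=x+\Delta t_i f(t_i,x,u,v)$. Moreover, if $f$ and $f^0$ have the form $f(t,x,u,v)=f_1(t,x,u)+f_2(t,x,v)$ and $f^0(t,x,u,v)=f^0_1(t,x,u)+f^0_2(t,x,v)$, then this function $Q^\Delta$ can be taken so that there exist functions $Q_1^\Delta(t_i,x,u)$ and $Q_2^\Delta(t_i,x,v)$ with $$Q^\Delta(t_i,x,u,v)=Q_1^\Delta(t_i,x,u)+Q_2^\Delta(t_i,x,v)\quad\text{for all }(t_i,x,u,v)\in\Delta\times\mathbb R^n\times\mathcal U\times\mathcal V.$$ (b) For every $(\tau,w)\in[0,T)\times\mathbb R^n$ and every $\varepsilon>0$ there exist a compact set $D\subset\mathbb R^n$ and $\delta>0$ such that for every partition $\Delta=\{t_i:\ \tau=t_0<t_1<\dots<t_{m+1}=T\}$ with $d(\Delta)<\delta$ there exists a continuous function $Q^\Delta:\Delta\times\mathbb R^n\times\mathcal U\times\mathcal V\to\mathbb R$ with $Q^\Delta(t_{m+1},x,u,v)=\sigma(x)$, satisfying both inequalities $( * )$ for all $i\in\{0,\dots,m\}$, $x\in D$, $u\in\mathcal U$, $v\in\mathcal V$, and such that any policies $\pi_u^\Delta:\Delta\times\mathbb R^n\to\mathcal U$, $\pi_v^\Delta:\Delta\times\mathbb R^n\to\mathcal V$ with $$\pi_u^\Delta(t_i,x)\in\operatorname*{Argmin}_{u\in\mathcal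 U}\max_{v\in\mathcal V}Q^\Delta(t_i,x,u,v),\qquad \pi_v^\Delta(t_i,x)\in\operatorname*{Argmax}_{v\in\mathcal V}\min_{u\in\mathcal U}Q^\Delta(t_i,x,u,v)$$ for all $(t_i,x)\in\Delta\times\mathbb R^n$ satisfy $$V_u^{\pi_u^\Delta}(\tau,w)\le V(\tau,w)+\varepsilon T,\qquad V_v^{\pi_v^\Delta}(\tau,w)\ge V(\tau,w)-\varepsilon T,$$ where $V_u^{\pi_u^\Delta}$ and $V_v^{\pi_v^\Delta}$ are the guaranteed results in the discrete-time game defined in the context.
   Context: Differential game. For $(\tau,w)\in[0,T]\times\mathbb R^n$, consider the system $\frac{d}{dt}x(t)=f(t,x(t),u(t),v(t))$, $t\in[\tau,T]$, $x(\tau)=w$, with quality index $$J=\sigma(x(T))+\int_\tau^T f^0(t,x(t),u(t),v(t))\,dt,$$ where $x(t)\in\mathbb R^n$, $u(t)\in\mathcal U$ is the control of the first agent (who minimizes $J$), $v(t)\in\mathcal V$ is the control of the second agent (who maximizes $J$), $u(\cdot),v(\cdot)$ are Lebesgue measurable, and the motion $x(\cdot)$ is a Lipschitz continuous function satisfying the equation almost everywhere. For $\tau=T$, $J=\sigma(w)$. Standing assumptions: $\sigma:\mathbb R^n\to\mathbb R$ is continuous; $f:[0,T]\times\mathbb R^n\times\mathcal U\times\mathcal V\to\mathbb R^n$ and $f^0:[0,T]\times\mathbb R^n\times\mathcal U\times\mathcal V\to\mathbb R$ are continuous; there is $c_f>0$ with $\|f(t,x,u,v)\|+|f^0(t,x,u,v)|\le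 c_f(1+\|x\|)$ for all $(t,x,u,v)$; for every $\alpha>0$ there is $\lambda_f>0$ with $\|f(t,x,u,v)-f(t,y,u,v)\|+|f^0(t,x,u,v)-f^0(t,y,u,v)|\le\lambda_f\|x-y\|$ for all $t\in[0,T]$, $u\in\mathcal U$, $v\in\mathcal V$ and $x,y$ with $\max\{\|x\|,\|y\|\}\le\alpha$. These ensure existence and uniqueness of the motion for every pair of measurable controls. Partitions. A partition is $\Delta=\{t_i:\tau=t_0<t_1<\dots<t_{m+1}=T\}$; $\Delta t_i=t_{i+1}-t_i$ and $d(\Delta)=\max_{0\le i\le m}\Delta t_i$. Value function. A policy of the first agent is an arbitrary function $\pi_u:[0,T]\times\mathbb R^n\to\mathcal U$. With a partition $\Delta$ it generates $u(t)=\pi_u(t_i,x(t_i))$ for $t\in[t_i,t_{i+1})$, $i=0,\dots,m$; together with a measurable $v(\cdot)$ this determines $J$. Set $$V_u^{\pi_u}(\tau,w)=\lim_{\delta\to0+}\ \sup_{\Delta:\,d(\Delta)\le\delta}\ \sup_{v(\cdot)}J,\qquad V_u(\tau,w)=\inf_{\pi_u}V_u^{\pi_u}(\tau,w).$$ Symmetrically, for policies $\pi_v:[0,T]\times\mathbb R^n\to\mathcal V$ generating $v(t)=\pi_v(t_i,x(t_i))$ on $[t_i,t_{i+1})$, $$V_v^{\pi_v}(\tau,w)=\lim_{\delta\to0+}\ \inf_{\Delta:\,d(\Delta)\le\delta}\ \inf_{u(\cdot)}J,\qquad V_v(\tau,w)=\sup_{\pi_v}V_v^{\pi_v}(\tau,w).$$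 It is a known fact (Subbotin, 1995, Theorem 12.3) that under Isaacs's condition $V_u=V_v$ on $[0,T]\times\mathbb R^n$; the value function is $V:=V_u=V_v$, with $V(T,w)=\sigma(w)$. Discrete-time game for a fixed partition $\Delta$. For $(t_i,x)\in\Delta\times\mathbb R^n$, $i\ne m+1$: $$x_i=x,\quad x_{j+1}=x_j+\Delta t_jf(t_j,x_j,u_j,v_j),\ j=i,\dots,m,\qquad J^\Delta=\sigma(x_{m+1})+\sum_{j=i}^m\Delta t_jf^0(t_j,x_j,u_j,v_j),$$ with $u_j\in\mathcal U$, $v_j\in\mathcal V$. For policies $\pi_u^\Delta:\Delta\times\mathbb R^n\to\mathcal U$ and $\pi_v^\Delta:\Delta\times\mathbb R^n\to\mathcal V$ the guaranteed results are $$V_u^{\pi_u^\Delta}(t_i,x)=\sup_{v_i,\dots,v_m\in\mathcal V}J^\Delta\ \text{ with }u_j=\pi_u^\Delta(t_j,x_j),\qquad V_v^{\pi_v^\Delta}(t_i,x)=\inf_{u_i,\dots,u_m\in\mathcal U}J^\Delta\ \text{ with }v_j=\pi_v^\Delta(t_j,x_j).$$ *)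

theory Defs
  imports "HOL-Analysis.Analysis"
begin

text \<open>
  Throughout, \<open>T\<close> is the horizon, \<open>\<U>\<close> and \<open>\<V>\<close> are the control sets of the minimizing and of
  the maximizing agent, \<open>f\<close> is the dynamics, \<open>f0\<close> the running cost and \<open>\<sigma>\<close> the terminal cost.
  The functions \<open>f\<close> and \<open>f0\<close> only matter on \<open>{0..T} \<times> UNIV \<times> \<U> \<times> \<V>\<close>.

  Minima and maxima over \<open>\<U>\<close> and \<open>\<V>\<close> are written as \<open>INF\<close> and \<open>SUP\<close> in \<open>real\<close>. They are only applied
  to continuous functions on nonempty compact sets, where they are attained.
\<close>

section \<open>Partitions\<close>

text \<open>A partition \<open>\<tau> = t 0 < \<dots> < t (Suc m) = T\<close>; the values of \<open>t\<close> beyond \<open>Suc m\<close> are irrelevant.\<close>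

definition time_partition :: "real \<Rightarrow> real \<Rightarrow> nat \<Rightarrow> (nat \<Rightarrow> real) \<Rightarrow> bool" where
  "time_partition \<tau> T m t \<longleftrightarrow> t 0 = \<tau> \<and> t (Suc m) = T \<and> (\<forall>i\<le>m. t i < t (Suc i))"

definition step :: "(nat \<Rightarrow> real) \<Rightarrow> nat \<Rightarrow> real" where
  "step t i = t (Suc i) - t i"

definition mesh :: "nat \<Rightarrow> (nat \<Rightarrow> real) \<Rightarrow> real" where
  "mesh m t = Max (step t ` {..m})"

definition points :: "nat \<Rightarrow> (nat \<Rightarrow> real) \<Rightarrow> real set" where
  "points m t = t ` {..Suc m}"

section \<open>The continuous-time game\<close>

definition control :: "'c::topological_space set \<Rightarrow> real \<Rightarrow> real \<Rightarrow> (real \<Rightarrow> 'c) \<Rightarrow> bool" where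
  "control C \<tau> T c \<longleftrightarrow> c \<in> borel_measurable (lebesgue_on {\<tau>..T}) \<and> (\<forall>s\<in>{\<tau>..T}. c s \<in> C)"

definition motion ::
  "(real \<Rightarrow> real^'n \<Rightarrow> real^'k \<Rightarrow> real^'l \<Rightarrow> real^'n) \<Rightarrow> real \<Rightarrow> real \<Rightarrow> real^'n \<Rightarrow>
   (real \<Rightarrow> real^'k) \<Rightarrow> (real \<Rightarrow> real^'l) \<Rightarrow> (real \<Rightarrow> real^'n) \<Rightarrow> bool" where
  "motion f \<tau> T w u v x \<longleftrightarrow>
     x \<tau> = w \<and> (\<exists>L. L-lipschitz_on {\<tau>..T} x) \<and>
     (AE s in lebesgue_on {\<tau>..T}.
        (x has_vector_derivative f s (x s) (u s) (v s)) (at s within {\<tau>..T}))"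

definition cost ::
  "(real \<Rightarrow> real^'n \<Rightarrow> real^'k \<Rightarrow> real^'l \<Rightarrow> real) \<Rightarrow> (real^'n \<Rightarrow> real) \<Rightarrow> real \<Rightarrow> real \<Rightarrow>
   (real \<Rightarrow> real^'k) \<Rightarrow> (real \<Rightarrow> real^'l) \<Rightarrow> (real \<Rightarrow> real^'n) \<Rightarrow> real" where
  "cost f0 \<sigma> \<tau> T u v x =
     \<sigma> (x T) + (LINT s|lebesgue_on {\<tau>..T}. f0 s (x s) (u s) (v s))"

definition policies :: "real \<Rightarrow> 'c set \<Rightarrow> (real \<Rightarrow> real^'n \<Rightarrow> 'c) set" where
  "policies T C = {\<pi>. \<forall>t\<in>{0..T}. \<forall>x. \<pi> t x \<in> C}"

text \<open>
  All values of the quality index that can occur from \<open>(\<tau>, w)\<close> when the first agent uses the policy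
  \<open>\<pi>\<close> with some partition of mesh at most \<open>\<delta>\<close>, against all controls of the second agent. The
  supremum of this set is the iterated supremum over the partitions and over \<open>v\<close>.
\<close>

definition policy_costs where
  "policy_costs T \<V> f f0 \<sigma> \<pi> \<tau> w \<delta> =
     {cost f0 \<sigma> \<tau> T u v x | m t u v x.
        time_partition \<tau> T m t \<and> mesh m t \<le> \<delta> \<and> control \<V> \<tau> T v \<and> motion f \<tau> T w u v x \<and>
        (\<forall>i\<le>m. \<forall>s\<in>{t i..<t (Suc i)}. u s = \<pi> (t i) (x (t i)))}"

text \<open>
  Under the linear growth bound on \<open>f\<close> and \<open>f0\<close> the costs from a given position are bounded
  uniformly in the policy, the partition and the controls, so that the real \<open>Sup\<close>, \<open>Lim\<close> and \<open>INF\<close>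
  below have their intended meaning.
\<close>

definition policy_value ::
  "real \<Rightarrow> (real^'l) set \<Rightarrow> (real \<Rightarrow> real^'n \<Rightarrow> real^'k \<Rightarrow> real^'l \<Rightarrow> real^'n) \<Rightarrow>
   (real \<Rightarrow> real^'n \<Rightarrow> real^'k \<Rightarrow> real^'l \<Rightarrow> real) \<Rightarrow> (real^'n \<Rightarrow> real) \<Rightarrow>
   (real \<Rightarrow> real^'n \<Rightarrow> real^'k) \<Rightarrow> real \<Rightarrow> real^'n \<Rightarrow> real" where
  "policy_value T \<V> f f0 \<sigma> \<pi> \<tau> w =
     (if \<tau> = T then \<sigma> w
      else Lim (at_right 0) (\<lambda>\<delta>. Sup (policy_costs T \<V> f f0 \<sigma> \<pi> \<tau> w \<delta>)))"

text \<open>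
  The value \<open>V = V\<^sub>u\<close>, the optimal guaranteed result of the first agent. Under Isaacs's condition it
  coincides with the optimal guaranteed result \<open>V\<^sub>v\<close> of the second agent (Subbotin 1995, Theorem 12.3).
\<close>

definition game_value ::
  "real \<Rightarrow> (real^'k) set \<Rightarrow> (real^'l) set \<Rightarrow> (real \<Rightarrow> real^'n \<Rightarrow> real^'k \<Rightarrow> real^'l \<Rightarrow> real^'n) \<Rightarrow>
   (real \<Rightarrow> real^'n \<Rightarrow> real^'k \<Rightarrow> real^'l \<Rightarrow> real) \<Rightarrow> (real^'n \<Rightarrow> real) \<Rightarrow>
   real \<Rightarrow> real^'n \<Rightarrow> real" where
  "game_value T \<U> \<V> f f0 \<sigma> \<tau> w = (INF \<pi>\<in>policies T \<U>. policy_value T \<V> f f0 \<sigma> \<pi> \<tau> w)"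

text \<open>On \<open>{0..T} \<times> UNIV\<close> this means one-sided time derivatives at \<open>0\<close> and \<open>T\<close>.\<close>

definition continuously_differentiable_on ::
  "('a::real_normed_vector \<Rightarrow> 'b::real_normed_vector) \<Rightarrow> 'a set \<Rightarrow> bool" where
  "continuously_differentiable_on g S \<longleftrightarrow>
     (\<exists>g' :: 'a \<Rightarrow> 'a \<Rightarrow>\<^sub>L 'b.
        continuous_on S g' \<and> (\<forall>p\<in>S. (g has_derivative blinfun_apply (g' p)) (at p within S)))"

section \<open>The discrete-time game for a fixed partition\<close>

definition discrete_motion ::
  "(real \<Rightarrow> real^'n \<Rightarrow> real^'k \<Rightarrow> real^'l \<Rightarrow> real^'n) \<Rightarrow> nat \<Rightarrow> (nat \<Rightarrow> real) \<Rightarrow> nat \<Rightarrow> real^'n \<Rightarrow>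
   (nat \<Rightarrow> real^'k) \<Rightarrow> (nat \<Rightarrow> real^'l) \<Rightarrow> (nat \<Rightarrow> real^'n) \<Rightarrow> bool" where
  "discrete_motion f m t i x u v xs \<longleftrightarrow>
     xs i = x \<and> (\<forall>j\<in>{i..m}. xs (Suc j) = xs j + step t j *\<^sub>R f (t j) (xs j) (u j) (v j))"

definition discrete_cost ::
  "(real \<Rightarrow> real^'n \<Rightarrow> real^'k \<Rightarrow> real^'l \<Rightarrow> real) \<Rightarrow> (real^'n \<Rightarrow> real) \<Rightarrow> nat \<Rightarrow> (nat \<Rightarrow> real) \<Rightarrow> nat \<Rightarrow>
   (nat \<Rightarrow> real^'k) \<Rightarrow> (nat \<Rightarrow> real^'l) \<Rightarrow> (nat \<Rightarrow> real^'n) \<Rightarrow> real" where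
  "discrete_cost f0 \<sigma> m t i u v xs =
     \<sigma> (xs (Suc m)) + (\<Sum>j=i..m. step t j * f0 (t j) (xs j) (u j) (v j))"

definition discrete_policies :: "nat \<Rightarrow> (nat \<Rightarrow> real) \<Rightarrow> 'c set \<Rightarrow> (real \<Rightarrow> real^'n \<Rightarrow> 'c) set" where
  "discrete_policies m t C = {\<pi>. \<forall>s\<in>points m t. \<forall>x. \<pi> s x \<in> C}"

text \<open>Guaranteed results from \<open>(t i, x)\<close>; the sets of costs are again nonempty and bounded.\<close>

definition discrete_result_u where
  "discrete_result_u \<V> f f0 \<sigma> m t \<pi> i x =
     Sup {discrete_cost f0 \<sigma> m t i u v xs | u v xs.
            (\<forall>j\<in>{i..m}. v j \<in> \<V> \<and> u j = \<pi> (t j) (xs j)) \<and> discrete_motion f m t i x u v xs}"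

definition discrete_result_v where
  "discrete_result_v \<U> f f0 \<sigma> m t \<pi> i x =
     Inf {discrete_cost f0 \<sigma> m t i u v xs | u v xs.
            (\<forall>j\<in>{i..m}. u j \<in> \<U> \<and> v j = \<pi> (t j) (xs j)) \<and> discrete_motion f m t i x u v xs}"

section \<open>Approximate Isaacs--Bellman equations\<close>

definition admissible_Q ::
  "(real^'k) set \<Rightarrow> (real^'l) set \<Rightarrow> (real^'n \<Rightarrow> real) \<Rightarrow> nat \<Rightarrow> (nat \<Rightarrow> real) \<Rightarrow>
   (real \<Rightarrow> real^'n \<Rightarrow> real^'k \<Rightarrow> real^'l \<Rightarrow> real) \<Rightarrow> bool" where
  "admissible_Q \<U> \<V> \<sigma> m t Q \<longleftrightarrow>
     continuous_on (points m t \<times> UNIV \<times> \<U> \<times> \<V>) (\<lambda>(s, x, u, v). Q s x u v) \<and>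
     (\<forall>x. \<forall>u\<in>\<U>. \<forall>v\<in>\<V>. Q (t (Suc m)) x u v = \<sigma> x)"

definition approx_Isaacs_Bellman ::
  "(real^'k) set \<Rightarrow> (real^'l) set \<Rightarrow> (real \<Rightarrow> real^'n \<Rightarrow> real^'k \<Rightarrow> real^'l \<Rightarrow> real^'n) \<Rightarrow>
   (real \<Rightarrow> real^'n \<Rightarrow> real^'k \<Rightarrow> real^'l \<Rightarrow> real) \<Rightarrow> nat \<Rightarrow> (nat \<Rightarrow> real) \<Rightarrow> (real^'n) set \<Rightarrow> real \<Rightarrow>
   (real \<Rightarrow> real^'n \<Rightarrow> real^'k \<Rightarrow> real^'l \<Rightarrow> real) \<Rightarrow> bool" where
  "approx_Isaacs_Bellman \<U> \<V> f f0 m t D \<epsilon> Q \<longleftrightarrow>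
     (\<forall>i\<le>m. \<forall>x\<in>D. \<forall>u\<in>\<U>. \<forall>v\<in>\<V>.
        let r = step t i * f0 (t i) x u v;
            x' = x + step t i *\<^sub>R f (t i) x u v
        in \<bar>Q (t i) x u v - r - (INF u'\<in>\<U>. SUP v'\<in>\<V>. Q (t (Suc i)) x' u' v')\<bar> \<le> step t i * \<epsilon> \<and>
           \<bar>Q (t i) x u v - r - (SUP v'\<in>\<V>. INF u'\<in>\<U>. Q (t (Suc i)) x' u' v')\<bar> \<le> step t i * \<epsilon>)"

end

theory Submission
  imports Defs
begin

text \<open>
  A continuously differentiable value function \<open>V\<close> satisfies the Hamilton--Jacobi--Isaacs equation
  \<open>min max G = 0\<close>, where \<open>G\<close> is the total derivative of \<open>V\<close> along the dynamics plus the running cost.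
  If the (max min) rate were positive at some position, the second agent could gain by a constant control
  for a short time, whatever the policy, contradicting \<open>V = inf\<close>. Hence the rate is nonpositive everywhere,
  so a policy that nearly minimizes \<open>max G\<close> keeps the cost below \<open>V\<close> up to a small error; a strictly negative
  rate at one position would then push it strictly below \<open>V\<close>. Given the equation,
  \<open>Q(t\<^sub>i, x, u, v) = V(t\<^sub>i, x) + \<Delta>t\<^sub>i G(t\<^sub>i, x, u, v)\<close> has minimax \<open>V(t\<^sub>i, x)\<close> and agrees with the running cost plus
  \<open>V(t\<^sub>i\<^sub>+\<^sub>1, x')\<close> up to \<open>o(\<Delta>t\<^sub>i)\<close>, uniformly on compact sets; summing along a discrete motion gives the bounds
  on the guaranteed results.
\<close>

section \<open>Lipschitz functions differentiable almost everywhere\<close>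

text \<open>The value is an infimum over single policies, so near-optimal policies for different
  positions cannot simply be pasted together; this fixes the order of the two inequalities for the
  rate. Once the rate is known to be nonpositive at all positions, a pointwise choice of controls
  already is a globally good policy, and the reverse inequality needs no pasting. A constant control
  of the second agent controls only the max-min rate; Isaacs's condition, applied with the spatial
  gradient of the value as the vector \<open>s\<close>, turns it into the min-max rate that a policy
  of the first agent can exploit. Motions are merely Lipschitz with a derivative almost everywhere,
  so all comparisons integrate a rate along a motion, which is what the theorem below is for.
  Estimates must be uniform in the policy, the partition and the opposing control; this rests on
  bounds for positions and speeds that depend only on the starting point. As suprema and infima are
  taken in the reals, the sets of costs must also be shown bounded and nonempty, and nonemptiness
  means existence of motions under a policy.\<close>

text \<open>
  The exceptional null set \<open>N\<close> is covered by an open set \<open>W\<close> of small measure, and the tags in \<open>N\<close> are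
  charged to the increments of \<open>\<lambda>t. measure lebesgue (W \<inter> {a..t})\<close>.
\<close>

theorem fundamental_theorem_of_calculus_lipschitz:
  fixes \<phi> :: "real \<Rightarrow> 'a::banach"
  assumes "a \<le> b" and lip: "L-lipschitz_on {a..b} \<phi>" and N: "negligible N"
    and der: "\<And>s. s \<in> {a..b} - N \<Longrightarrow> (\<phi> has_vector_derivative \<rho> s) (at s within {a..b})"
  shows "(\<rho> has_integral (\<phi> b - \<phi> a)) {a..b}"
proof (cases "a = b")
  case True
  then show ?thesis by auto
next
  case False
  with \<open>a \<le> b\<close> have ab: "a < b" by simp
  have L0: "0 \<le> L" using lip lipschitz_on_nonneg by blast
  \<comment> \<open>The values of \<rho> on N are arbitrary. With 0 there, a tag in N contributes
    nothing to the Riemann sum, and only the increment of \<phi> over its interval has to be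
    bounded.\<close>
  define \<rho>0 where "\<rho>0 s = (if s \<in> N then 0 else \<rho> s)" for s
  have "(\<rho>0 has_integral (\<phi> b - \<phi> a)) {a..b}"
    unfolding has_integral_factor_content_real
  proof (intro allI impI)
    fix e :: real assume e: "e > 0"
    \<comment> \<open>This bound on the measure of W, multiplied by L, uses at most half of the
      tolerance \<open>e * (b - a)\<close>. The denominator has L + 1 to cover L = 0.\<close>
    have "e * (b - a) / (2 * (L + 1)) > 0" using e ab L0 by simp
    moreover have "N \<in> sets lebesgue" "measure lebesgue N = 0"
      using N by (auto simp: negligible_iff_null_sets negligible_imp_measure0)
    ultimately obtain W where W: "open W" "N \<subseteq> W" "W - N \<in> lmeasurable"
      "emeasure lebesgue (W - N) < ennreal (e * (b - a) / (2 * (L + 1)))"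
      using sets_lebesgue_outer_open[of N "e * (b - a) / (2 * (L + 1))"] by metis
    have Wm: "W \<in> lmeasurable" and Wlt: "measure lebesgue W < e * (b - a) / (2 * (L + 1))"
    proof -
      have "W = (W - N) \<union> N" using W by auto
      moreover have "N \<in> lmeasurable" using N negligible_imp_measurable by blast
      ultimately show "W \<in> lmeasurable" using W(3) fmeasurable.Un by metis
      have "measure lebesgue W = measure lebesgue (W - N)"
        using N W(3) \<open>W \<in> lmeasurable\<close>
        by (metis fmeasurableD measure_Diff_null_set negligible_iff_null_sets)
      also have "\<dots> < e * (b - a) / (2 * (L + 1))"
        using W(4) e ab L0 by (simp add: emeasure_eq_measure2 W(3) ennreal_less_iff)
      finally show "measure lebesgue W < e * (b - a) / (2 * (L + 1))" .
    qed
    define \<psi> where "\<psi> t = measure lebesgue (W \<inter> {a..t})" for t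
    have Wt: "W \<inter> {a..t} \<in> lmeasurable" for t
      using Wm by (simp add: fmeasurable.Int)
    have \<psi>_mono: "\<psi> u \<le> \<psi> v" if "u \<le> v" for u v
      unfolding \<psi>_def by (rule measure_mono_fmeasurable) (use that Wt in auto)
    have \<psi>_inc: "\<psi> v - \<psi> u = v - u" if "a \<le> u" "u \<le> v" "{u..v} \<subseteq> W" for u v
    proof -
      have "W \<inter> {a..v} = (W \<inter> {a..u}) \<union> {u<..v}" using that by force
      moreover have "measure lebesgue ((W \<inter> {a..u}) \<union> {u<..v})
          = measure lebesgue (W \<inter> {a..u}) + measure lebesgue {u<..v}"
      proof -
        have "{u<..v} \<in> lmeasurable" by (rule bounded_set_imp_lmeasurable) auto
        moreover have "W \<inter> {a..u} \<inter> {u<..v} = {}" by auto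
        ultimately show ?thesis by (simp add: measure_Un3[OF Wt])
      qed
      ultimately show ?thesis using that by (simp add: \<psi>_def)
    qed
    \<comment> \<open>One gauge serves both kinds of tags: intervals tagged in N must lie inside W,
      and at the other tags the linearization error is at most e/2 times the distance to the
      tag.\<close>
    have "\<forall>x. \<exists>d>0. (x \<in> N \<longrightarrow> ball x d \<subseteq> W) \<and> (x \<in> {a..b} - N \<longrightarrow>
         (\<forall>y\<in>{a..b}. norm (y-x) < d \<longrightarrow> norm (\<phi> y - \<phi> x - (y-x) *\<^sub>R \<rho> x) \<le> e / 2 * norm (y-x)))"
    proof
      fix x
      show "\<exists>d>0. (x \<in> N \<longrightarrow> ball x d \<subseteq> W) \<and> (x \<in> {a..b} - N \<longrightarrow>
         (\<forall>y\<in>{a..b}. norm (y-x) < d \<longrightarrow> norm (\<phi> y - \<phi> x - (y-x) *\<^sub>R \<rho> x) \<le> e / 2 * norm (y-x)))"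
      proof (cases "x \<in> N")
        case True
        then show ?thesis using W(1,2) by (metis DiffD2 openE subsetD)
      next
        case False
        show ?thesis
        proof (cases "x \<in> {a..b}")
          case True
          with False der[of x] e show ?thesis
            unfolding has_vector_derivative_def has_derivative_within_alt
            by (metis DiffI half_gt_zero)
        qed (use False in \<open>auto intro: exI[of _ 1]\<close>)
      qed
    qed
    then obtain d where d: "\<And>x. 0 < d x" "\<And>x. x \<in> N \<Longrightarrow> ball x (d x) \<subseteq> W"
       "\<And>x y. \<lbrakk>x \<in> {a..b} - N; y \<in> {a..b}; norm (y-x) < d x\<rbrakk>
          \<Longrightarrow> norm (\<phi> y - \<phi> x - (y-x) *\<^sub>R \<rho> x) \<le> e / 2 * norm (y-x)"
      by metis
    show "\<exists>d. gauge d \<and> (\<forall>p. p tagged_division_of {a..b} \<and> d fine p \<longrightarrow>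
            norm ((\<Sum>(x, k)\<in>p. measure lborel k *\<^sub>R \<rho>0 x) - (\<phi> b - \<phi> a)) \<le> e * measure lborel {a..b})"
    proof (rule exI, safe)
      show "gauge (\<lambda>x. ball x (d x))"
        using d(1) gauge_ball_dependent by blast
    next
      fix p
      assume ptag: "p tagged_division_of {a..b}" and finep: "(\<lambda>x. ball x (d x)) fine p"
      note add1 = additive_tagged_division_1[OF \<open>a \<le> b\<close> ptag]
      have sums: "(\<Sum>(x,K)\<in>p. Sup K - Inf K) = b - a"
         "(\<Sum>(x,K)\<in>p. \<phi> (Sup K) - \<phi> (Inf K)) = \<phi> b - \<phi> a"
         "(\<Sum>(x,K)\<in>p. \<psi> (Sup K) - \<psi> (Inf K)) = \<psi> b - \<psi> a"
        using add1[of "\<lambda>x. x"] add1[of \<phi>] add1[of \<psi>] by auto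
      have "norm (\<Sum>(x, K) \<in> p. (measure lborel K *\<^sub>R \<rho>0 x) - (\<phi> (Sup K) - \<phi> (Inf K)))
          \<le> (\<Sum>(x,K)\<in>p. e / 2 * (Sup K - Inf K) + L * (\<psi> (Sup K) - \<psi> (Inf K)))"
      proof (rule sum_norm_le, clarify)
        fix x K
        assume xK: "(x, K) \<in> p"
        then obtain u v where k: "K = {u..v}" and "x \<in> K" and kab: "K \<subseteq> {a..b}"
          using ptag tagged_division_ofD(2,3,4)[OF ptag xK] by (metis box_real(2))
        have uv: "u \<le> v" using \<open>x \<in> K\<close> unfolding k by auto
        have ball: "K \<subseteq> ball x (d x)" using finep xK by blast
        have uvK: "u \<in> K" "v \<in> K" "u \<in> {a..b}" "v \<in> {a..b}" "x \<in> {a..b}"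
          using uv k kab \<open>x \<in> K\<close> by auto
        have SI: "Sup K = v" "Inf K = u" "measure lborel K = v - u" using uv by (auto simp: k)
        show "norm (measure lborel K *\<^sub>R \<rho>0 x - (\<phi> (Sup K) - \<phi> (Inf K)))
            \<le> e / 2 * (Sup K - Inf K) + L * (\<psi> (Sup K) - \<psi> (Inf K))"
        proof (cases "x \<in> N")
          case True
          have "norm (\<phi> v - \<phi> u) \<le> L * (v - u)"
            using lipschitz_onD[OF lip uvK(4,3)] uv by (simp add: dist_norm)
          moreover have "\<psi> v - \<psi> u = v - u"
            using \<psi>_inc[of u v] uv uvK d(2)[OF True] ball k by auto
          ultimately show ?thesis using True e uv by (simp add: SI \<rho>0_def add_increasing norm_minus_commute)
        next
          case False
          have "norm ((v - u) *\<^sub>R \<rho> x - (\<phi> v - \<phi> u))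
             = norm (\<phi> u - \<phi> x - (u - x) *\<^sub>R \<rho> x - (\<phi> v - \<phi> x - (v - x) *\<^sub>R \<rho> x))"
            by (auto simp: algebra_simps)
          also have "\<dots> \<le> norm (\<phi> u - \<phi> x - (u - x) *\<^sub>R \<rho> x) + norm (\<phi> v - \<phi> x - (v - x) *\<^sub>R \<rho> x)"
            by (rule norm_triangle_ineq4)
          also have "\<dots> \<le> e / 2 * norm (u - x) + e / 2 * norm (v - x)"
            by (intro add_mono d(3)) (use False uvK ball in \<open>auto simp: dist_norm norm_minus_commute\<close>)
          also have "\<dots> = e / 2 * (v - u)"
            using \<open>x \<in> K\<close> by (auto simp: k field_simps)
          finally show ?thesis
            using False L0 \<psi>_mono[OF uv] by (simp add: SI \<rho>0_def add_increasing2)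
        qed
      qed
      also have "\<dots> = e / 2 * (b - a) + L * (\<psi> b - \<psi> a)"
        unfolding sums(1)[symmetric] sums(3)[symmetric] sum_distrib_left sum.distrib[symmetric]
        by (simp add: split_def)
      also have "\<dots> \<le> e / 2 * (b - a) + e / 2 * (b - a)"
      proof -
        have "\<psi> b - \<psi> a \<le> measure lebesgue W"
        proof -
          have "\<psi> b \<le> measure lebesgue W" "0 \<le> \<psi> a"
            unfolding \<psi>_def by (auto intro!: measure_mono_fmeasurable Wm fmeasurableD[OF Wt])
          then show ?thesis by simp
        qed
        then have "L * (\<psi> b - \<psi> a) \<le> (L + 1) * measure lebesgue W"
          using L0 \<psi>_mono[OF \<open>a \<le> b\<close>] by (intro mult_mono) auto
        also have "\<dots> \<le> (L + 1) * (e * (b - a) / (2 * (L + 1)))"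
          using Wlt L0 by (intro mult_left_mono) auto
        also have "\<dots> = e / 2 * (b - a)" using L0 by (simp add: field_simps)
        finally show ?thesis by simp
      qed
      finally show "norm ((\<Sum>(x, K)\<in>p. measure lborel K *\<^sub>R \<rho>0 x) - (\<phi> b - \<phi> a)) \<le> e * measure lborel {a..b}"
        using \<open>a \<le> b\<close> by (simp add: sums(2)[symmetric] split_def sum_subtractf[symmetric])
    qed
  qed
  then show ?thesis
    by (rule has_integral_spike[OF N, rotated]) (simp add: \<rho>0_def)
qed

lemma AE_lebesgue_on_iff:
  assumes "S \<in> sets lebesgue"
  shows "(AE s in lebesgue_on S. P s) \<longleftrightarrow> (\<exists>N. negligible N \<and> (\<forall>s\<in>S - N. P s))"
proof -
  have "(AE s in lebesgue_on S. P s) \<longleftrightarrow> (AE s in lebesgue. s \<in> S \<longrightarrow> P s)"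
    by (rule AE_restrict_space_iff) (use assms in auto)
  also have "\<dots> \<longleftrightarrow> (\<exists>N. negligible N \<and> {s. \<not> (s \<in> S \<longrightarrow> P s)} \<subseteq> N)"
    by (rule eventually_ae_filter_negligible)
  finally show ?thesis by blast
qed

lemma has_integral_le_negligible:
  fixes g h :: "'a::euclidean_space \<Rightarrow> real"
  assumes "(g has_integral I) S" "(h has_integral J) S" "negligible N" "\<And>s. s \<in> S - N \<Longrightarrow> g s \<le> h s"
  shows "I \<le> J"
proof -
  have "((\<lambda>s. if s \<in> N then 0 else g s) has_integral I) S" "((\<lambda>s. if s \<in> N then 0 else h s) has_integral J) S"
    by (rule has_integral_spike[OF assms(3) _ assms(1)], force)
       (rule has_integral_spike[OF assms(3) _ assms(2)], force)
  then show ?thesis by (rule has_integral_le) (use assms(4) in auto)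
qed

text \<open>A continuous derivative is bounded on the compact K, and convexity lets the mean value
  inequality turn that bound into a Lipschitz constant. The derivative is taken within S because the
  time slab has boundary.\<close>

lemma lipschitz_on_C1_compact_convex:
  fixes \<Phi> :: "'a::real_normed_vector \<Rightarrow> 'b::real_normed_vector"
  assumes "\<And>p. p \<in> S \<Longrightarrow> (\<Phi> has_derivative blinfun_apply (\<Phi>' p)) (at p within S)"
    and "continuous_on S \<Phi>'" and "compact K" "convex K" "K \<subseteq> S"
  shows "\<exists>B. B-lipschitz_on K \<Phi>"
proof -
  have "bounded (\<Phi>' ` K)"
    using assms by (meson compact_continuous_image compact_imp_bounded continuous_on_subset)
  then obtain B where B: "B > 0" "\<And>p. p \<in> K \<Longrightarrow> norm (\<Phi>' p) \<le> B"
    unfolding bounded_pos by auto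
  have "norm (\<Phi> p - \<Phi> q) \<le> B * norm (p - q)" if "p \<in> K" "q \<in> K" for p q
    by (rule differentiable_bound[OF \<open>convex K\<close> _ _ that, where f' = "\<lambda>p. blinfun_apply (\<Phi>' p)"])
       (use assms B in \<open>auto simp: norm_blinfun.rep_eq[symmetric] intro: has_derivative_subset\<close>)
  then show ?thesis using B(1) by (auto simp: lipschitz_on_def dist_norm intro!: exI[of _ B])
qed

text \<open>The curve stays in a compact convex box on which \<Phi> is Lipschitz, so the composite
  is Lipschitz and the fundamental theorem applies off N. The vector \<open>(1, \<xi> s)\<close> is
  the velocity of the curve in space-time.\<close>

lemma C1_chain_has_integral:
  fixes \<Phi> :: "real \<times> 'a::euclidean_space \<Rightarrow> real"
  assumes der: "\<And>p. p \<in> {c..d} \<times> UNIV \<Longrightarrow> (\<Phi> has_derivative blinfun_apply (\<Phi>' p)) (at p within {c..d} \<times> UNIV)"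
    and cont: "continuous_on ({c..d} \<times> UNIV) \<Phi>'"
    and ab: "a \<le> b" "c \<le> a" "b \<le> d"
    and lip: "L-lipschitz_on {a..b} x" and N: "negligible N"
    and xder: "\<And>s. s \<in> {a..b} - N \<Longrightarrow> (x has_vector_derivative \<xi> s) (at s within {a..b})"
  shows "((\<lambda>s. \<Phi>' (s, x s) (1, \<xi> s)) has_integral (\<Phi> (b, x b) - \<Phi> (a, x a))) {a..b}"
proof -
  have "continuous_on {a..b} x" using lip by (rule lipschitz_on_continuous_on)
  then have "bounded (x ` {a..b})" by (simp add: compact_continuous_image compact_imp_bounded)
  then obtain R where R: "\<And>s. s \<in> {a..b} \<Longrightarrow> norm (x s) \<le> R" unfolding bounded_iff by blast
  define K where "K = {a..b} \<times> cball (0::'a) R"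
  have K: "compact K" "convex K" "K \<subseteq> {c..d} \<times> UNIV"
    using ab unfolding K_def by (auto intro!: compact_Times convex_Times)
  obtain B where B: "B-lipschitz_on K \<Phi>"
    using lipschitz_on_C1_compact_convex[OF der cont K] by blast
  have "(sqrt (1\<^sup>2 + L\<^sup>2))-lipschitz_on {a..b} (\<lambda>s. (s, x s))"
    by (intro lipschitz_on_Pair lipschitz_on_id lip)
  moreover have "(\<lambda>s. (s, x s)) ` {a..b} \<subseteq> K" using R by (auto simp: K_def)
  ultimately have lipc: "(B * sqrt (1\<^sup>2 + L\<^sup>2))-lipschitz_on {a..b} (\<lambda>s. \<Phi> (s, x s))"
    using lipschitz_on_compose2[of _ "{a..b}" "\<lambda>s. (s, x s)" B \<Phi>] lipschitz_on_subset[OF B]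
    by auto
  show ?thesis
  proof (rule fundamental_theorem_of_calculus_lipschitz[OF ab(1) lipc N])
    fix s assume s: "s \<in> {a..b} - N"
    have "((\<lambda>s. (s, x s)) has_derivative (\<lambda>h. (h, h *\<^sub>R \<xi> s))) (at s within {a..b})"
      using xder[OF s] unfolding has_vector_derivative_def
      by (intro has_derivative_Pair has_derivative_ident)
    moreover have "(\<Phi> has_derivative blinfun_apply (\<Phi>' (s, x s))) (at (s, x s) within (\<lambda>s. (s, x s)) ` {a..b})"
      using ab s by (intro has_derivative_subset[OF der]) auto
    ultimately have "((\<lambda>s. \<Phi> (s, x s)) has_derivative (\<lambda>h. \<Phi>' (s, x s) (h, h *\<^sub>R \<xi> s))) (at s within {a..b})"
      using has_derivative_in_compose[of "\<lambda>s. (s, x s)" "\<lambda>h. (h, h *\<^sub>R \<xi> s)" s "{a..b}" \<Phi>] by blast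
    moreover have "\<Phi>' (s, x s) (h, h *\<^sub>R \<xi> s) = h *\<^sub>R \<Phi>' (s, x s) (1, \<xi> s)" for h
      by (metis blinfun.scaleR_right mult.right_neutral real_scaleR_def scaleR_Pair)
    ultimately show "((\<lambda>s. \<Phi> (s, x s)) has_vector_derivative \<Phi>' (s, x s) (1, \<xi> s)) (at s within {a..b})"
      by (simp add: has_vector_derivative_def)
  qed
qed

text \<open>A Gronwall estimate in the form of a Lyapunov function. The square of the norm is used
  because it is smooth; with n the norm of the position, 2 c (n + n^2) is at most 4 c (1 + n^2),
  which is where the rate 4 c comes from. Since a decreasing quantity survives concatenation of
  motions, this form is easier to iterate than an exponential bound.\<close>

lemma linear_growth_decreasing:
  fixes x :: "real \<Rightarrow> 'a::euclidean_space"
  assumes "a \<le> b" and lip: "L-lipschitz_on {a..b} x" and N: "negligible N"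
    and xder: "\<And>s. s \<in> {a..b} - N \<Longrightarrow> (x has_vector_derivative \<xi> s) (at s within {a..b})"
    and growth: "\<And>s. s \<in> {a..b} - N \<Longrightarrow> norm (\<xi> s) \<le> c * (1 + norm (x s))"
    and c: "0 \<le> c"
  shows "(1 + (norm (x b))\<^sup>2) * exp (-4 * c * b) \<le> (1 + (norm (x a))\<^sup>2) * exp (-4 * c * a)"
proof -
  define \<Phi> where "\<Phi> = (\<lambda>p::real \<times> 'a. (1 + snd p \<bullet> snd p) * exp (-4 * c * fst p))"
  define D where "D = (\<lambda>(p::real \<times> 'a) (h::real \<times> 'a).
      2 * (snd p \<bullet> snd h) * exp (-4 * c * fst p) - 4 * c * fst h * (1 + snd p \<bullet> snd p) * exp (-4 * c * fst p))"
  define \<Phi>' where "\<Phi>' p = Blinfun (D p)" for p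
  have der: "(\<Phi> has_derivative D p) (at p within S)" for p S
    unfolding \<Phi>_def D_def
    by (auto intro!: derivative_eq_intros simp: fun_eq_iff algebra_simps inner_commute)
  have \<Phi>': "blinfun_apply (\<Phi>' p) = D p" for p
    unfolding \<Phi>'_def using has_derivative_bounded_linear[OF der]
    by (rule bounded_linear_Blinfun_apply)
  have cont: "continuous_on S \<Phi>'" for S
    by (rule continuous_on_blinfun_componentwise) (auto simp: \<Phi>' D_def intro!: continuous_intros)
  have "((\<lambda>s. \<Phi>' (s, x s) (1, \<xi> s)) has_integral (\<Phi> (b, x b) - \<Phi> (a, x a))) {a..b}"
    by (rule C1_chain_has_integral[of a b \<Phi> \<Phi>' a b L x N]) (use assms der cont \<Phi>' in auto)
  moreover have "((\<lambda>s. 0::real) has_integral 0) {a..b}" by simp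
  ultimately have "\<Phi> (b, x b) - \<Phi> (a, x a) \<le> 0"
  proof (rule has_integral_le_negligible[OF _ _ N])
    fix s assume s: "s \<in> {a..b} - N"
    let ?n = "norm (x s)"
    have "x s \<bullet> \<xi> s \<le> ?n * (c * (1 + ?n))"
      using growth[OF s] norm_cauchy_schwarz[of "x s" "\<xi> s"]
      by (meson mult_left_mono norm_ge_zero order_trans)
    also have "\<dots> = c * (?n + ?n\<^sup>2)" by (simp add: algebra_simps power2_eq_square)
    also have "\<dots> \<le> c * (2 * (1 + ?n\<^sup>2))"
    proof (rule mult_left_mono[OF _ c])
      have "?n \<le> 1 + ?n\<^sup>2" using zero_le_power2[of "?n - 1"] norm_ge_zero[of "x s"]
        unfolding power2_diff by (simp, linarith)
      then show "?n + ?n\<^sup>2 \<le> 2 * (1 + ?n\<^sup>2)" by simp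
    qed
    finally have "2 * (x s \<bullet> \<xi> s) \<le> 4 * c * (1 + ?n\<^sup>2)" by (simp add: algebra_simps)
    then have "2 * (x s \<bullet> \<xi> s) * exp (-4 * c * s) \<le> 4 * c * (1 + ?n\<^sup>2) * exp (-4 * c * s)"
      by (rule mult_right_mono) simp
    then show "blinfun_apply (\<Phi>' (s, x s)) (1, \<xi> s) \<le> 0"
      by (simp add: \<Phi>' D_def power2_norm_eq_inner)
  qed
  then show ?thesis by (simp add: \<Phi>_def power2_norm_eq_inner)
qed

section \<open>Short-time solutions of differential equations\<close>

text \<open>Picard iteration: the condition on the length of the interval makes the integral
  operator a contraction with factor 1/2 in the sup norm.\<close>

lemma ode_short_time_existence:
  fixes F :: "real \<Rightarrow> 'a::euclidean_space \<Rightarrow> 'a"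
  assumes "a \<le> b" and cont: "continuous_on ({a..b} \<times> UNIV) (\<lambda>(s, y). F s y)"
    and lip: "\<And>s y z. s \<in> {a..b} \<Longrightarrow> norm (F s y - F s z) \<le> L * norm (y - z)"
    and L: "0 \<le> L" "L * (b - a) \<le> 1/2"
  shows "\<exists>x. x a = w \<and> (\<forall>s\<in>{a..b}. (x has_vector_derivative F s (x s)) (at s within {a..b}))"
proof -
  \<comment> \<open>The fixed point is sought in the complete space of bounded continuous functions
    on the whole line. Clipping the time freezes the integral outside the interval and thereby keeps
    it bounded there.\<close>
  define clip where "clip t = max a (min b t)" for t
  have clip: "clip t \<in> {a..b}" "t \<in> {a..b} \<Longrightarrow> clip t = t" for t
    using \<open>a \<le> b\<close> by (auto simp: clip_def)
  have contF: "continuous_on {a..b} (\<lambda>s. F s (\<phi> s))" if "continuous_on {a..b} \<phi>" for \<phi>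
  proof -
    have "continuous_on {a..b} (\<lambda>s. (s, \<phi> s))" using that by (intro continuous_intros)
    from continuous_on_compose2[OF cont this] show ?thesis by auto
  qed
  have intF: "(\<lambda>s. F s (\<phi> s)) integrable_on {a..t}" if "continuous_on {a..b} \<phi>" "t \<in> {a..b}" for \<phi> t
    by (rule integrable_continuous_real, rule continuous_on_subset[OF contF[OF that(1)]]) (use that in auto)
  define Op where "Op \<phi> = Bcontfun (\<lambda>t. w + integral {a..clip t} (\<lambda>s. F s (apply_bcontfun \<phi> s)))"
    for \<phi> :: "real \<Rightarrow>\<^sub>C 'a"
  have Op: "apply_bcontfun (Op \<phi>) t = w + integral {a..clip t} (\<lambda>s. F s (apply_bcontfun \<phi> s))" for \<phi> t
  proof -
    let ?I = "\<lambda>t. w + integral {a..t} (\<lambda>s. F s (apply_bcontfun \<phi> s))"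
    have cI: "continuous_on {a..b} ?I"
      by (intro continuous_intros indefinite_integral_continuous_1 intF) (use \<open>a \<le> b\<close> in auto)
    have "continuous_on UNIV clip" unfolding clip_def by (intro continuous_intros)
    then have "continuous_on UNIV (\<lambda>t. ?I (clip t))"
      using clip by (intro continuous_on_compose2[OF cI]) auto
    moreover have "bounded (range (\<lambda>t. ?I (clip t)))"
      by (rule bounded_subset[OF compact_imp_bounded[OF compact_continuous_image[OF cI]]])
         (use clip in auto)
    ultimately have "(\<lambda>t. ?I (clip t)) \<in> bcontfun" by (simp add: bcontfun_def)
    then show ?thesis unfolding Op_def by (simp add: Bcontfun_inverse)
  qed
  have "dist (Op \<phi>) (Op \<theta>) \<le> 1/2 * dist \<phi> \<theta>" for \<phi> \<theta>
  proof (rule dist_bound)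
    fix t
    have "norm (integral {a..clip t} (\<lambda>s. F s (apply_bcontfun \<phi> s) - F s (apply_bcontfun \<theta> s)))
          \<le> integral {a..clip t} (\<lambda>s. L * dist \<phi> \<theta>)"
    proof (rule integral_norm_bound_integral)
      show "(\<lambda>s. F s (apply_bcontfun \<phi> s) - F s (apply_bcontfun \<theta> s)) integrable_on {a..clip t}"
        by (intro integrable_diff intF) (use clip in auto)
      fix s assume "s \<in> {a..clip t}"
      then have s: "s \<in> {a..b}" using clip(1)[of t] by auto
      have "norm (apply_bcontfun \<phi> s - apply_bcontfun \<theta> s) \<le> dist \<phi> \<theta>"
        using dist_bounded[of \<phi> s \<theta>] by (simp add: dist_norm)
      then show "norm (F s (apply_bcontfun \<phi> s) - F s (apply_bcontfun \<theta> s)) \<le> L * dist \<phi> \<theta>"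
        using lip[OF s] L(1) by (meson mult_left_mono order_trans)
    qed auto
    also have "\<dots> = (clip t - a) * (L * dist \<phi> \<theta>)" using clip[of t] by simp
    also have "\<dots> \<le> (b - a) * (L * dist \<phi> \<theta>)"
      using clip[of t] L(1) by (intro mult_right_mono) auto
    also have "\<dots> \<le> 1/2 * dist \<phi> \<theta>"
      using mult_right_mono[OF L(2), of "dist \<phi> \<theta>"] by (simp add: mult_ac)
    finally show "dist (apply_bcontfun (Op \<phi>) t) (apply_bcontfun (Op \<theta>) t) \<le> 1/2 * dist \<phi> \<theta>"
      using clip(1)[of t] by (simp add: Op dist_norm integral_diff[OF intF intF])
  qed
  then obtain \<phi> where \<phi>: "Op \<phi> = \<phi>"
    using banach_fix_type[of "1/2" Op] by auto
  have eq: "apply_bcontfun \<phi> t = w + integral {a..t} (\<lambda>s. F s (apply_bcontfun \<phi> s))" if "t \<in> {a..b}" for t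
    using Op[of \<phi> t] clip(2)[OF that] \<phi> by simp
  have "(apply_bcontfun \<phi> has_vector_derivative F s (apply_bcontfun \<phi> s)) (at s within {a..b})"
    if s: "s \<in> {a..b}" for s
  proof -
    have "((\<lambda>t. w + integral {a..t} (\<lambda>s. F s (apply_bcontfun \<phi> s))) has_vector_derivative
           0 + F s (apply_bcontfun \<phi> s)) (at s within {a..b})"
      by (intro has_vector_derivative_add has_vector_derivative_const integral_has_vector_derivative contF s) auto
    then have "((\<lambda>t. w + integral {a..t} (\<lambda>s. F s (apply_bcontfun \<phi> s))) has_vector_derivative
           F s (apply_bcontfun \<phi> s)) (at s within {a..b})" by simp
    then show ?thesis
      by (rule has_vector_derivative_transform[OF s, rotated]) (rule eq)
  qed
  then show ?thesis using eq[of a] \<open>a \<le> b\<close> by (intro exI[of _ "apply_bcontfun \<phi>"]) auto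
qed

lemma lipschitz_on_vector_derivative_bound:
  fixes x :: "real \<Rightarrow> 'a::real_normed_vector"
  assumes "0 \<le> B" and der: "\<And>s. s \<in> {a..b} \<Longrightarrow> (x has_vector_derivative \<xi> s) (at s within {a..b})"
    and bd: "\<And>s. s \<in> {a..b} \<Longrightarrow> norm (\<xi> s) \<le> B"
  shows "B-lipschitz_on {a..b} x"
proof (rule lipschitz_onI)
  fix s t assume "s \<in> {a..b}" "t \<in> {a..b}"
  have "onorm (\<lambda>h. h *\<^sub>R \<xi> s) \<le> B" if "s \<in> {a..b}" for s
    using bd[OF that] by (intro onorm_le) (simp add: mult.commute[of B] mult_left_mono)
  then have "norm (x s - x t) \<le> B * norm (s - t)"
    using \<open>s \<in> _\<close> \<open>t \<in> _\<close> der unfolding has_vector_derivative_def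
    by (intro differentiable_bound[of "{a..b}" x "\<lambda>s h. h *\<^sub>R \<xi> s"]) auto
  then show "dist (x s) (x t) \<le> B * dist s t" by (simp add: dist_norm)
qed fact

text \<open>The derivative is controlled only off N, so the estimate passes through the integral of
  \<xi> instead of a mean value theorem.\<close>

lemma lipschitz_negligible_derivative_bound:
  fixes x :: "real \<Rightarrow> 'a::euclidean_space"
  assumes "a \<le> b" "L-lipschitz_on {a..b} x" and N: "negligible N"
    and xder: "\<And>s. s \<in> {a..b} - N \<Longrightarrow> (x has_vector_derivative \<xi> s) (at s within {a..b})"
    and bound: "\<And>s. s \<in> {a..b} - N \<Longrightarrow> norm (\<xi> s) \<le> B" and "0 \<le> B"
  shows "norm (x b - x a) \<le> B * (b - a)"
proof -
  have "(\<xi> has_integral (x b - x a)) {a..b}"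
    by (rule fundamental_theorem_of_calculus_lipschitz[OF assms(1-4)])
  then have "((\<lambda>s. if s \<in> N then 0 else \<xi> s) has_integral (x b - x a)) (cbox a b)"
    unfolding box_real by (rule has_integral_spike[OF N, rotated]) auto
  then have "norm (x b - x a) \<le> B * measure lborel (cbox a b)"
    by (rule has_integral_bound[OF \<open>0 \<le> B\<close>]) (use bound \<open>0 \<le> B\<close> in auto)
  then show ?thesis using \<open>a \<le> b\<close> by simp
qed

section \<open>Motions under a policy\<close>

lemma mesh_le_iff: "mesh m t \<le> \<delta> \<longleftrightarrow> (\<forall>i\<le>m. step t i \<le> \<delta>)"
  unfolding mesh_def by (subst Max_le_iff) auto

lemma time_partition_mono:
  assumes "time_partition a b m t" "i \<le> j" "j \<le> Suc m"
  shows "t i \<le> t j"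
  using assms(2,3)
proof (induction j rule: dec_induct)
  case (step n)
  then show ?case using assms(1) unfolding time_partition_def
    by (smt (verit) Suc_leD Suc_le_mono)
qed simp

lemma time_partition_strict_mono:
  assumes "time_partition a b m t" "i < j" "j \<le> Suc m"
  shows "t i < t j"
  using time_partition_mono[OF assms(1), of "Suc i" j] assms unfolding time_partition_def
  by (smt (verit) Suc_leI le_trans less_Suc_eq_le not_less_eq_eq)

lemma time_partition_range:
  assumes "time_partition a b m t" "i \<le> Suc m"
  shows "t i \<in> {a..b}"
  using time_partition_mono[OF assms(1), of 0 i] time_partition_mono[OF assms(1), of i "Suc m"] assms
  by (auto simp: time_partition_def)

lemma time_partition_range_less:
  assumes "time_partition a b m t" "i \<le> m"
  shows "t i \<in> {a..<b}"
  using time_partition_range[OF assms(1), of i] time_partition_strict_mono[OF assms(1), of i "Suc m"] assms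
  by (auto simp: time_partition_def)

lemma time_partition_less:
  assumes "time_partition a b m t"
  shows "a < b"
  using time_partition_range_less[OF assms, of 0] by auto

lemma time_partition_cover:
  assumes "time_partition a b m t" "s \<in> {a..<b}"
  shows "\<exists>i\<le>m. s \<in> {t i..<t (Suc i)}"
proof -
  define i where "i = (LEAST i. s < t (Suc i))"
  have ex: "s < t (Suc m)" using assms by (auto simp: time_partition_def)
  then have i: "s < t (Suc i)" "i \<le> m" unfolding i_def by (auto intro: LeastI Least_le)
  moreover have "t i \<le> s"
  proof (cases i)
    case 0
    then show ?thesis using assms by (auto simp: time_partition_def)
  next
    case (Suc j)
    then show ?thesis using not_less_Least[of j "\<lambda>i. s < t (Suc i)"] by (auto simp: i_def)
  qed
  ultimately show ?thesis by auto
qed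

section \<open>The game data and a priori bounds on motions under a policy\<close>

locale differential_game =
  fixes T c :: real
    and \<U> :: "(real^'k) set"
    and \<V> :: "(real^'l) set"
    and f :: "real \<Rightarrow> real^'n \<Rightarrow> real^'k \<Rightarrow> real^'l \<Rightarrow> real^'n"
    and f0 :: "real \<Rightarrow> real^'n \<Rightarrow> real^'k \<Rightarrow> real^'l \<Rightarrow> real"
    and \<sigma> :: "real^'n \<Rightarrow> real"
  assumes T_pos: "T > 0"
    and U: "compact \<U>" "\<U> \<noteq> {}"
    and V: "compact \<V>" "\<V> \<noteq> {}"
    and cont_\<sigma>: "continuous_on UNIV \<sigma>"
    and cont_f: "continuous_on ({0..T} \<times> UNIV \<times> \<U> \<times> \<V>) (\<lambda>(t, x, u, v). f t x u v)"
    and cont_f0: "continuous_on ({0..T} \<times> UNIV \<times> \<U> \<times> \<V>) (\<lambda>(t, x, u, v). f0 t x u v)"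
    and c_pos: "c > 0"
    and growth: "\<And>t x u v. t \<in> {0..T} \<Longrightarrow> u \<in> \<U> \<Longrightarrow> v \<in> \<V> \<Longrightarrow>
         norm (f t x u v) + \<bar>f0 t x u v\<bar> \<le> c * (1 + norm x)"
    and local_Lipschitz:
      "\<forall>\<alpha>>0. \<exists>L>0. \<forall>t\<in>{0..T}. \<forall>u\<in>\<U>. \<forall>v\<in>\<V>. \<forall>x y. max (norm x) (norm y) \<le> \<alpha> \<longrightarrow>
         norm (f t x u v - f t y u v) + \<bar>f0 t x u v - f0 t y u v\<bar> \<le> L * norm (x - y)"
begin

lemma growth_f: "t \<in> {0..T} \<Longrightarrow> u \<in> \<U> \<Longrightarrow> v \<in> \<V> \<Longrightarrow> norm (f t x u v) \<le> c * (1 + norm x)"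
  using growth[of t u v x] by simp

lemma growth_f0: "t \<in> {0..T} \<Longrightarrow> u \<in> \<U> \<Longrightarrow> v \<in> \<V> \<Longrightarrow> \<bar>f0 t x u v\<bar> \<le> c * (1 + norm x)"
  using growth[of t u v x] norm_ge_zero[of "f t x u v"] by linarith

text \<open>The end time b is a parameter, so that initial pieces of a motion and its continuations
  are objects of the same kind and can be glued. The starting point is left out and stated
  separately. The policy determines u on half-open cells only, so u is unconstrained at time
  b.\<close>

definition guided where
  "guided \<pi> a b m t u v x \<longleftrightarrow>
     time_partition a b m t \<and> control \<V> a b v \<and> (\<exists>L. L-lipschitz_on {a..b} x) \<and>
     (\<exists>N. negligible N \<and>
        (\<forall>s\<in>{a..b} - N. (x has_vector_derivative f s (x s) (u s) (v s)) (at s within {a..b}))) \<and>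
     (\<forall>i\<le>m. \<forall>s\<in>{t i..<t (Suc i)}. u s = \<pi> (t i) (x (t i)))"

lemma policy_costs_eq:
  "policy_costs T \<V> f f0 \<sigma> \<pi> \<tau> w \<delta> =
     {cost f0 \<sigma> \<tau> T u v x | m t u v x. guided \<pi> \<tau> T m t u v x \<and> mesh m t \<le> \<delta> \<and> x \<tau> = w}"
  unfolding policy_costs_def guided_def motion_def
  by (intro Collect_cong ex_cong1) (simp add: AE_lebesgue_on_iff conj_ac)

text \<open>The bound on positions obtained by undoing the exponential weight of the Lyapunov
  function over the whole horizon. It depends on the starting point alone, not on policy, partition
  or controls.\<close>

definition radius :: "real^'n \<Rightarrow> real" where
  "radius w = sqrt ((1 + (norm w)\<^sup>2) * exp (4 * c * T))"

lemma norm_le_radiusI: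
  assumes "(1 + (norm y)\<^sup>2) * exp (-4 * c * s) \<le> (1 + (norm w)\<^sup>2) * exp (-4 * c * a)"
    and "0 \<le> a" "s \<le> T"
  shows "norm y \<le> radius w"
proof -
  have "1 + (norm y)\<^sup>2 = (1 + (norm y)\<^sup>2) * exp (-4 * c * s) * exp (4 * c * s)"
    by (simp add: exp_minus)
  also have "\<dots> \<le> (1 + (norm w)\<^sup>2) * exp (-4 * c * a) * exp (4 * c * T)"
    by (rule mult_mono[OF assms(1)]) (use assms(3) c_pos in auto)
  also have "\<dots> \<le> (1 + (norm w)\<^sup>2) * 1 * exp (4 * c * T)"
    using assms(2) c_pos by (intro mult_right_mono mult_left_mono) auto
  finally have "(norm y)\<^sup>2 \<le> (1 + (norm w)\<^sup>2) * exp (4 * c * T)" by simp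
  then show ?thesis unfolding radius_def by (rule real_le_rsqrt)
qed

lemma radius_nonneg: "0 \<le> radius w"
  by (simp add: radius_def)

lemma guided_u:
  assumes "guided \<pi> a b m t u v x" "\<pi> \<in> policies T \<U>" "0 \<le> a" "b \<le> T" "s \<in> {a..<b}"
  shows "u s \<in> \<U>"
proof -
  have tp: "time_partition a b m t" using assms by (simp add: guided_def)
  obtain i where i: "i \<le> m" "s \<in> {t i..<t (Suc i)}" using time_partition_cover[OF tp assms(5)] by blast
  then have "u s = \<pi> (t i) (x (t i))" using assms(1) by (auto simp: guided_def)
  moreover have "t i \<in> {0..T}" using time_partition_range[OF tp, of i] i assms by auto
  ultimately show ?thesis using assms(2) by (auto simp: policies_def)
qed

text \<open>Packages the almost-everywhere information on an initial piece. The point b is added to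
  the null set because the policy does not determine u there, so that u b may lie outside
  \<open>\<U>\<close>.\<close>

lemma guided_derivative:
  assumes "guided \<pi> a b m t u v x" "\<pi> \<in> policies T \<U>" "0 \<le> a" "b \<le> T" "s \<in> {a..b}"
  obtains L N where "L-lipschitz_on {a..s} x" "negligible N" "b \<in> N"
    "\<And>r. r \<in> {a..s} - N \<Longrightarrow> (x has_vector_derivative f r (x r) (u r) (v r)) (at r within {a..s})"
    "\<And>r. r \<in> {a..s} - N \<Longrightarrow> u r \<in> \<U>"
    "\<And>r. r \<in> {a..s} - N \<Longrightarrow> v r \<in> \<V>"
proof -
  obtain L N where L: "L-lipschitz_on {a..b} x" "negligible N"
     "\<forall>s\<in>{a..b} - N. (x has_vector_derivative f s (x s) (u s) (v s)) (at s within {a..b})"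
    using assms(1) unfolding guided_def by blast
  show ?thesis
  proof (rule that[of L "insert b N"])
    show "L-lipschitz_on {a..s} x" using lipschitz_on_subset[OF L(1)] assms(5) by auto
    show "negligible (insert b N)" using L(2) by simp
    fix r assume r: "r \<in> {a..s} - insert b N"
    show "(x has_vector_derivative f r (x r) (u r) (v r)) (at r within {a..s})"
      by (rule has_vector_derivative_within_subset[of _ _ _ "{a..b}"]) (use r assms(5) L(3) in auto)
    show "u r \<in> \<U>" by (rule guided_u[OF assms(1-4)]) (use r assms(5) in auto)
    show "v r \<in> \<V>" using assms(1,5) r by (auto simp: guided_def control_def)
  qed auto
qed

lemma guided_decreasing:
  assumes "guided \<pi> a b m t u v x" "\<pi> \<in> policies T \<U>" "0 \<le> a" "b \<le> T" "s \<in> {a..b}"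
  shows "(1 + (norm (x s))\<^sup>2) * exp (-4 * c * s) \<le> (1 + (norm (x a))\<^sup>2) * exp (-4 * c * a)"
proof -
  obtain L N where L: "L-lipschitz_on {a..s} x" "negligible N" "b \<in> N"
    "\<And>r. r \<in> {a..s} - N \<Longrightarrow> (x has_vector_derivative f r (x r) (u r) (v r)) (at r within {a..s})"
    "\<And>r. r \<in> {a..s} - N \<Longrightarrow> u r \<in> \<U>" "\<And>r. r \<in> {a..s} - N \<Longrightarrow> v r \<in> \<V>"
    using guided_derivative[OF assms] by metis
  show ?thesis
    by (rule linear_growth_decreasing[OF _ L(1,2,4)])
       (use L(5,6) assms c_pos in \<open>auto intro!: growth_f\<close>)
qed

lemma guided_bounded:
  assumes "guided \<pi> a b m t u v x" "\<pi> \<in> policies T \<U>" "0 \<le> a" "b \<le> T" "s \<in> {a..b}"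
  shows "norm (x s) \<le> radius (x a)"
  using norm_le_radiusI[OF guided_decreasing[OF assms]] assms by auto

text \<open>Linear growth of f and the bound on positions limit the speed by a constant determined
  by the starting point. It is stated for an arbitrary intermediate time r since it is needed
  between a partition point and a later time of the same cell.\<close>

lemma guided_tail_speed:
  assumes "guided \<pi> a b m t u v x" "\<pi> \<in> policies T \<U>" "0 \<le> a" "b \<le> T" "r \<in> {a..b}" "s \<in> {r..b}"
  shows "norm (x s - x r) \<le> c * (1 + radius (x a)) * (s - r)"
proof -
  have s: "s \<in> {a..b}" using assms by auto
  obtain L N where L: "L-lipschitz_on {a..s} x" "negligible N" "b \<in> N"
    "\<And>r. r \<in> {a..s} - N \<Longrightarrow> (x has_vector_derivative f r (x r) (u r) (v r)) (at r within {a..s})"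
    "\<And>r. r \<in> {a..s} - N \<Longrightarrow> u r \<in> \<U>" "\<And>r. r \<in> {a..s} - N \<Longrightarrow> v r \<in> \<V>"
    using guided_derivative[OF assms(1-4) s] by metis
  show ?thesis
  proof (rule lipschitz_negligible_derivative_bound[OF _ lipschitz_on_subset[OF L(1)] L(2)])
    fix q assume q: "q \<in> {r..s} - N"
    show "(x has_vector_derivative f q (x q) (u q) (v q)) (at q within {r..s})"
      by (rule has_vector_derivative_within_subset[OF L(4)]) (use q assms in auto)
    have "norm (f q (x q) (u q) (v q)) \<le> c * (1 + norm (x q))"
      using L(5,6) q assms by (intro growth_f) auto
    also have "\<dots> \<le> c * (1 + radius (x a))"
      using guided_bounded[OF assms(1-4), of q] q assms c_pos by (intro mult_left_mono) auto
    finally show "norm (f q (x q) (u q) (v q)) \<le> c * (1 + radius (x a))" .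
  qed (use assms c_pos radius_nonneg in auto)
qed

lemma guided_speed:
  assumes "guided \<pi> a b m t u v x" "\<pi> \<in> policies T \<U>" "0 \<le> a" "b \<le> T" "s \<in> {a..b}"
  shows "norm (x s - x a) \<le> c * (1 + radius (x a)) * (s - a)"
  using guided_tail_speed[OF assms(1-4), of a s] assms(5) by auto

text \<open>Measurability of u is not assumed but obtained cell by cell: there u is constant, and
  the running cost becomes a continuous function of the measurable triple of time, position and v.
  The end point b forms a piece of its own. Boundedness then follows from linear growth and the
  bound on positions.\<close>

lemma guided_integrable:
  assumes g: "guided \<pi> a b m t u v x" and "\<pi> \<in> policies T \<U>" "0 \<le> a" "b \<le> T"
  shows "integrable (lebesgue_on {a..b}) (\<lambda>s. f0 s (x s) (u s) (v s))"
    and "\<bar>LINT s|lebesgue_on {a..b}. f0 s (x s) (u s) (v s)\<bar> \<le> c * (1 + radius (x a)) * (b - a)"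
proof -
  have tp: "time_partition a b m t" using g by (simp add: guided_def)
  have ab: "a < b" using time_partition_less[OF tp] .
  interpret finite_measure "lebesgue_on {a..b}" by (rule finite_measure_lebesgue_on) simp
  obtain L N where L: "L-lipschitz_on {a..b} x" "negligible N" "b \<in> N"
    "\<And>r. r \<in> {a..b} - N \<Longrightarrow> u r \<in> \<U>" "\<And>r. r \<in> {a..b} - N \<Longrightarrow> v r \<in> \<V>"
    using guided_derivative[OF assms, of b] ab by (metis atLeastAtMost_iff less_eq_real_def)
  have meas: "(\<lambda>s. f0 s (x s) (u s) (v s)) \<in> borel_measurable (lebesgue_on {a..b})"
  proof (rule measurable_piecewise_restrict[of "insert {b} ((\<lambda>i. {t i..<t (Suc i)}) ` {..m})"])
    fix \<Omega> assume "\<Omega> \<in> insert {b} ((\<lambda>i. {t i..<t (Suc i)}) ` {..m})"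
    then consider "\<Omega> = {b}" | i where "i \<le> m" "\<Omega> = {t i..<t (Suc i)}" by auto
    note cases = this
    show "\<Omega> \<inter> space (lebesgue_on {a..b}) \<in> sets (lebesgue_on {a..b})"
      using cases by cases (auto simp: sets_restrict_space_iff)
    show "(\<lambda>s. f0 s (x s) (u s) (v s)) \<in> borel_measurable (restrict_space (lebesgue_on {a..b}) \<Omega>)"
      using cases
    proof cases
      case 1
      have "(\<lambda>s. f0 b (x b) (u b) (v b)) \<in> borel_measurable (restrict_space (lebesgue_on {a..b}) \<Omega>)"
        by simp
      then show ?thesis
        by (rule measurable_cong[THEN iffD2, rotated]) (use 1 in \<open>auto simp: space_restrict_space\<close>)
    next
      case (2 i)
      let ?M = "restrict_space (lebesgue_on {a..b}) \<Omega>"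
      let ?ui = "\<pi> (t i) (x (t i))"
      let ?K = "{0..T} \<times> UNIV \<times> \<U> \<times> \<V>"
      have ti: "t i \<in> {a..b}" "t (Suc i) \<in> {a..b}" "t i < t (Suc i)"
        using time_partition_range[OF tp] 2 tp by (auto simp: time_partition_def)
      have ui: "?ui \<in> \<U>" "\<And>s. s \<in> \<Omega> \<Longrightarrow> u s = ?ui"
        using assms(2-4) ti g 2 by (auto simp: guided_def policies_def)
      have m1: "(\<lambda>s. s) \<in> borel_measurable ?M" "x \<in> borel_measurable ?M"
        by (intro measurable_restrict_space1 continuous_imp_measurable_on_sets_lebesgue continuous_intros
            lipschitz_on_continuous_on[OF L(1)]; simp)+
      have "v \<in> borel_measurable (lebesgue_on {a..b})" using g by (simp add: guided_def control_def)
      then have m2: "v \<in> borel_measurable ?M" by (rule measurable_restrict_space1)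
      have "(\<lambda>s. (s, x s, ?ui, v s)) \<in> borel_measurable ?M"
        by (intro borel_measurable_Pair m1 m2 measurable_const) auto
      moreover have "(\<lambda>s. (s, x s, ?ui, v s)) \<in> space ?M \<rightarrow> ?K"
        using ui(1) ti assms(3,4) 2 g by (auto simp: space_restrict_space guided_def control_def)
      ultimately have "(\<lambda>s. (s, x s, ?ui, v s)) \<in> measurable ?M (restrict_space borel ?K)"
        by (intro measurable_restrict_space2)
      from measurable_compose[OF this borel_measurable_continuous_on_restrict[OF cont_f0]]
      have "(\<lambda>s. f0 s (x s) ?ui (v s)) \<in> borel_measurable ?M" by simp
      then show ?thesis
        by (rule measurable_cong[THEN iffD2, rotated]) (use ui(2) in \<open>auto simp: space_restrict_space\<close>)
    qed
  next
    show "space (lebesgue_on {a..b}) \<subseteq> \<Union> (insert {b} ((\<lambda>i. {t i..<t (Suc i)}) ` {..m}))"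
    proof
      fix s assume "s \<in> space (lebesgue_on {a..b})"
      then have "s = b \<or> s \<in> {a..<b}" by auto
      then show "s \<in> \<Union> (insert {b} ((\<lambda>i. {t i..<t (Suc i)}) ` {..m}))"
        using time_partition_cover[OF tp] by blast
    qed
  qed simp
  have bound: "\<bar>f0 r (x r) (u r) (v r)\<bar> \<le> c * (1 + radius (x a))" if r: "r \<in> {a..b} - N" for r
  proof -
    have "\<bar>f0 r (x r) (u r) (v r)\<bar> \<le> c * (1 + norm (x r))"
      using L(4,5) r assms by (intro growth_f0) auto
    also have "\<dots> \<le> c * (1 + radius (x a))"
      using guided_bounded[OF assms, of r] r c_pos by (intro mult_left_mono) auto
    finally show ?thesis .
  qed
  have AE: "AE s in lebesgue_on {a..b}. norm (f0 s (x s) (u s) (v s)) \<le> c * (1 + radius (x a))"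
    using L(2) bound by (subst AE_lebesgue_on_iff) auto
  show int: "integrable (lebesgue_on {a..b}) (\<lambda>s. f0 s (x s) (u s) (v s))"
    by (rule integrable_const_bound[OF AE meas])
  have hi: "((\<lambda>s. f0 s (x s) (u s) (v s)) has_integral (LINT s|lebesgue_on {a..b}. f0 s (x s) (u s) (v s))) {a..b}"
    by (rule has_integral_integral_lebesgue_on[OF int]) simp
  have ci: "((\<lambda>s. k) has_integral (k * (b - a))) {a..b}" for k :: real
    using has_integral_const_real[of k a b] ab by (simp add: mult.commute)
  let ?B = "c * (1 + radius (x a))"
  have "(LINT s|lebesgue_on {a..b}. f0 s (x s) (u s) (v s)) \<le> ?B * (b - a)"
    by (rule has_integral_le_negligible[OF hi ci L(2)]) (use bound in fastforce)
  moreover have "- ?B * (b - a) \<le> (LINT s|lebesgue_on {a..b}. f0 s (x s) (u s) (v s))"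
    by (rule has_integral_le_negligible[OF ci hi L(2)]) (use bound in fastforce)
  ultimately show "\<bar>LINT s|lebesgue_on {a..b}. f0 s (x s) (u s) (v s)\<bar> \<le> ?B * (b - a)"
    by simp
qed

text \<open>The derivative of \<Phi> along the dynamics plus the running cost. With the derivative
  of the value for \<open>\<Phi>'\<close>, it is the expression under the minimax in the
  Hamilton--Jacobi--Isaacs equation, the time derivative included.\<close>

definition game_rate where
  "game_rate \<Phi>' t x u v = blinfun_apply (\<Phi>' (t, x)) (1, f t x u v) + f0 t x u v"

text \<open>The verification identity: a bound on the rate along a motion becomes, after
  integration, a bound on the running cost plus the increment of \<Phi>.\<close>

lemma guided_rate_has_integral:
  assumes g: "guided \<pi> a b m t u v x" and "\<pi> \<in> policies T \<U>" "0 \<le> a" "b \<le> T"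
    and der: "\<And>p. p \<in> {0..T} \<times> UNIV \<Longrightarrow> (\<Phi> has_derivative blinfun_apply (\<Phi>' p)) (at p within {0..T} \<times> UNIV)"
    and cont: "continuous_on ({0..T} \<times> UNIV) \<Phi>'"
  shows "((\<lambda>s. game_rate \<Phi>' s (x s) (u s) (v s)) has_integral
     (\<Phi> (b, x b) - \<Phi> (a, x a) + (LINT s|lebesgue_on {a..b}. f0 s (x s) (u s) (v s)))) {a..b}"
proof -
  have tp: "time_partition a b m t" using g by (simp add: guided_def)
  have ab: "a < b" using time_partition_less[OF tp] .
  obtain L N where L: "L-lipschitz_on {a..b} x" "negligible N"
     "\<And>s. s\<in>{a..b} - N \<Longrightarrow> (x has_vector_derivative f s (x s) (u s) (v s)) (at s within {a..b})"
    using g unfolding guided_def by blast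
  show ?thesis unfolding game_rate_def
    by (intro has_integral_add has_integral_integral_lebesgue_on guided_integrable[OF assms(1-4)]
        C1_chain_has_integral[OF der cont _ _ _ L]) (use ab assms in auto)
qed

end

section \<open>Concatenation of motions\<close>

text \<open>Away from the junction b a small neighbourhood sees only one of the two pieces. At b
  itself the one-sided derivatives may differ, hence the exclusion.\<close>

lemma has_vector_derivative_concat:
  fixes x y :: "real \<Rightarrow> 'a::real_normed_vector"
  assumes "s \<in> {a..c}" "s \<noteq> b"
    and "s < b \<Longrightarrow> (x has_vector_derivative d) (at s within {a..b})"
    and "b < s \<Longrightarrow> (y has_vector_derivative d) (at s within {b..c})"
    and "x b = y b" "a \<le> b" "b \<le> c"
  shows "((\<lambda>s. if s < b then x s else y s) has_vector_derivative d) (at s within {a..c})"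
proof (cases "s < b")
  case True
  have "at s within {a..c} = at s within {a..b}"
    by (rule at_within_nhd[of s "{..<b}"]) (use True assms in auto)
  moreover have "((\<lambda>s. if s < b then x s else y s) has_vector_derivative d) (at s within {a..b})"
    by (rule has_vector_derivative_transform[OF _ _ assms(3)]) (use True assms in auto)
  ultimately show ?thesis by simp
next
  case False
  have "at s within {a..c} = at s within {b..c}"
    by (rule at_within_nhd[of s "{b<..}"]) (use False assms in auto)
  moreover have "((\<lambda>s. if s < b then x s else y s) has_vector_derivative d) (at s within {b..c})"
    by (rule has_vector_derivative_transform[OF _ _ assms(4)]) (use False assms in auto)
  ultimately show ?thesis by simp
qed

context differential_game
begin

text \<open>The last point of the first partition is dropped, since it coincides with the first
  point of the second. The m1 + 1 and m2 + 1 cells together give m1 + m2 + 2 cells, so the last cell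
  has index \<open>m1 + Suc m2\<close>.\<close>

definition concat_partition :: "nat \<Rightarrow> (nat \<Rightarrow> real) \<Rightarrow> (nat \<Rightarrow> real) \<Rightarrow> nat \<Rightarrow> real" where
  "concat_partition m s t i = (if i \<le> m then s i else t (i - Suc m))"

definition concat_at :: "real \<Rightarrow> (real \<Rightarrow> 'a) \<Rightarrow> (real \<Rightarrow> 'a) \<Rightarrow> real \<Rightarrow> 'a" where
  "concat_at b x y s = (if s < b then x s else y s)"

lemma concat_partition_cases:
  assumes "i \<le> m1 + Suc m2" "t1 (Suc m1) = t2 0"
  obtains (left) "i \<le> m1" "concat_partition m1 t1 t2 i = t1 i" "concat_partition m1 t1 t2 (Suc i) = t1 (Suc i)"
  | (right) j where "j \<le> m2" "i = Suc m1 + j" "concat_partition m1 t1 t2 i = t2 j"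
      "concat_partition m1 t1 t2 (Suc i) = t2 (Suc j)"
proof (cases "i \<le> m1")
  case True
  show ?thesis
    by (rule left; cases "i = m1") (use True assms(2) in \<open>auto simp: concat_partition_def\<close>)
next
  case False
  then obtain j where "i = Suc m1 + j" by (metis le_Suc_ex not_less_eq_eq)
  then show ?thesis
    by (intro right[of j]) (use assms in \<open>auto simp: concat_partition_def\<close>)
qed

text \<open>A policy sees only the current time and position, so restarting it at b from the
  position reached is the same as continuing it. The junction joins the exceptional null set; the
  pieces of v are measurable on complementary measurable sets.\<close>

lemma guided_concat:
  assumes g1: "guided \<pi> a b m1 t1 u1 v1 x1" and g2: "guided \<pi> b d m2 t2 u2 v2 x2"
    and eq: "x1 b = x2 b"
  shows "guided \<pi> a d (m1 + Suc m2) (concat_partition m1 t1 t2)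
    (concat_at b u1 u2) (concat_at b v1 v2) (concat_at b x1 x2)"
proof -
  have tp1: "time_partition a b m1 t1" and tp2: "time_partition b d m2 t2"
    using g1 g2 by (auto simp: guided_def)
  have ab: "a < b" "b < d" using time_partition_less tp1 tp2 by blast+
  have t12: "t1 (Suc m1) = t2 0" "t1 0 = a" "t2 (Suc m2) = d" "t2 0 = b"
    using tp1 tp2 by (auto simp: time_partition_def)
  let ?t = "concat_partition m1 t1 t2"
  have tp: "time_partition a d (m1 + Suc m2) ?t"
    unfolding time_partition_def
  proof (intro conjI allI impI)
    fix i assume "i \<le> m1 + Suc m2"
    from this t12(1) show "?t i < ?t (Suc i)"
      by (cases rule: concat_partition_cases)
         (use tp1 tp2 in \<open>auto simp: time_partition_def\<close>)
  qed (use t12 in \<open>auto simp: concat_partition_def\<close>)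
  have ctrl: "control \<V> a d (concat_at b v1 v2)"
    unfolding control_def
  proof
    have "v1 \<in> borel_measurable (lebesgue_on {a..b})" "v2 \<in> borel_measurable (lebesgue_on {b..d})"
      using g1 g2 by (auto simp: guided_def control_def)
    then have "v1 \<in> borel_measurable (lebesgue_on ({a..d} \<inter> {..<b}))"
      "v2 \<in> borel_measurable (lebesgue_on ({a..d} \<inter> {b..}))"
      using ab by (auto elim!: measurable_restrict_mono)
    moreover have "lebesgue_on ({a..d} \<inter> {..<b}) = restrict_space (lebesgue_on {a..d}) {s. s < b}"
      "lebesgue_on ({a..d} \<inter> {b..}) = restrict_space (lebesgue_on {a..d}) {s. \<not> s < b}"
      by (subst restrict_restrict_space; force simp: lessThan_def atLeast_def not_less)+
    moreover have left: "{x. a \<le> x \<and> x \<le> d \<and> x < b} = {a..<b}" using ab by auto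
    ultimately show "concat_at b v1 v2 \<in> borel_measurable (lebesgue_on {a..d})"
      unfolding concat_at_def
      by (subst measurable_If_restrict_space_iff) (use ab in \<open>auto simp: sets_restrict_space_iff left\<close>)
    show "\<forall>s\<in>{a..d}. concat_at b v1 v2 s \<in> \<V>"
      using g1 g2 by (auto simp: guided_def control_def concat_at_def)
  qed
  obtain L1 L2 where L: "L1-lipschitz_on {a..b} x1" "L2-lipschitz_on {b..d} x2"
    using g1 g2 by (auto simp: guided_def)
  have "concat_at b x1 x2 = (\<lambda>s. if s \<le> b then x1 s else x2 s)"
    using eq by (auto simp: concat_at_def fun_eq_iff)
  then have lip: "\<exists>L. L-lipschitz_on {a..d} (concat_at b x1 x2)"
    using lipschitz_on_concat_max[OF L eq] by auto
  obtain N1 N2 where N: "negligible N1" "negligible N2"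
    "\<And>s. s\<in>{a..b} - N1 \<Longrightarrow> (x1 has_vector_derivative f s (x1 s) (u1 s) (v1 s)) (at s within {a..b})"
    "\<And>s. s\<in>{b..d} - N2 \<Longrightarrow> (x2 has_vector_derivative f s (x2 s) (u2 s) (v2 s)) (at s within {b..d})"
    using g1 g2 unfolding guided_def by blast
  have der: "(concat_at b x1 x2 has_vector_derivative
      f s (concat_at b x1 x2 s) (concat_at b u1 u2 s) (concat_at b v1 v2 s)) (at s within {a..d})"
    if "s \<in> {a..d} - insert b (N1 \<union> N2)" for s
    unfolding concat_at_def
    by (rule has_vector_derivative_concat) (use that N(3,4)[of s] ab eq in auto)
  have neg: "negligible (insert b (N1 \<union> N2))" using N by auto
  have pol: "concat_at b u1 u2 s = \<pi> (?t i) (concat_at b x1 x2 (?t i))"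
    if "i \<le> m1 + Suc m2" "s \<in> {?t i..<?t (Suc i)}" for i s
    using that(1) t12(1)
  proof (cases rule: concat_partition_cases)
    case left
    have "t1 i < b" "t1 (Suc i) \<le> b"
      using time_partition_range_less[OF tp1 left(1)] time_partition_range[OF tp1, of "Suc i"] left(1) by auto
    then show ?thesis using left that(2) g1 by (auto simp: concat_at_def guided_def)
  next
    case (right j)
    have "t2 j \<ge> b"
      using time_partition_range[OF tp2, of j] right(1) by auto
    then show ?thesis using right that(2) g2 by (auto simp: concat_at_def guided_def)
  qed
  show ?thesis
    unfolding guided_def using tp ctrl lip neg der pol by blast
qed

lemma mesh_concat_partition:
  assumes "t1 (Suc m1) = t2 0" "mesh m1 t1 \<le> \<delta>" "mesh m2 t2 \<le> \<delta>"
  shows "mesh (m1 + Suc m2) (concat_partition m1 t1 t2) \<le> \<delta>"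
  unfolding mesh_le_iff
proof (intro allI impI)
  fix i assume "i \<le> m1 + Suc m2"
  from this assms(1) show "step (concat_partition m1 t1 t2) i \<le> \<delta>"
    by (cases rule: concat_partition_cases)
       (use assms(2,3) in \<open>auto simp: mesh_le_iff step_def\<close>)
qed

lemma integral_concat:
  assumes g1: "guided \<pi> a b m1 t1 u1 v1 x1" and g2: "guided \<pi> b d m2 t2 u2 v2 x2"
    and eq: "x1 b = x2 b" and \<pi>: "\<pi> \<in> policies T \<U>" and "0 \<le> a" "d \<le> T"
  shows "(LINT s|lebesgue_on {a..d}. f0 s (concat_at b x1 x2 s) (concat_at b u1 u2 s) (concat_at b v1 v2 s)) =
    (LINT s|lebesgue_on {a..b}. f0 s (x1 s) (u1 s) (v1 s)) + (LINT s|lebesgue_on {b..d}. f0 s (x2 s) (u2 s) (v2 s))"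
    (is "(LINT s|_. ?F s) = (LINT s|_. ?F1 s) + (LINT s|_. ?F2 s)")
proof -
  have ab: "a < b" "b < d" using time_partition_less g1 g2 by (auto simp: guided_def)
  have "((?F1) has_integral (LINT s|lebesgue_on {a..b}. ?F1 s)) {a..b}"
    by (intro has_integral_integral_lebesgue_on guided_integrable[OF g1 \<pi>]) (use ab assms in auto)
  then have 1: "(?F has_integral (LINT s|lebesgue_on {a..b}. ?F1 s)) {a..b}"
    by (rule has_integral_spike[of "{b}", rotated 2]) (auto simp: concat_at_def)
  have "((?F2) has_integral (LINT s|lebesgue_on {b..d}. ?F2 s)) {b..d}"
    by (intro has_integral_integral_lebesgue_on guided_integrable[OF g2 \<pi>]) (use ab assms in auto)
  then have 2: "(?F has_integral (LINT s|lebesgue_on {b..d}. ?F2 s)) {b..d}"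
    by (rule has_integral_eq[rotated]) (auto simp: concat_at_def)
  have "(?F has_integral (LINT s|lebesgue_on {a..d}. ?F s)) {a..d}"
    by (intro has_integral_integral_lebesgue_on guided_integrable[OF guided_concat[OF g1 g2 eq] \<pi>])
       (use assms in auto)
  moreover have "(?F has_integral (LINT s|lebesgue_on {a..b}. ?F1 s) + (LINT s|lebesgue_on {b..d}. ?F2 s)) {a..d}"
    by (rule has_integral_combine[OF _ _ 1 2]) (use ab in auto)
  ultimately show ?thesis by (rule has_integral_unique)
qed

section \<open>Existence of motions under a policy\<close>

text \<open>Local Lipschitz continuity is made global by composing f with the projection to a large
  ball; the growth bound survives this, so the solution of the modified equation never leaves the
  ball and solves the original one. The step h depends on M only, and the bound by M is reproduced
  at time b, so the lemma can be iterated.\<close>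

lemma short_time_motion_exists:
  fixes M :: real
  obtains h where "h > 0"
    "\<And>a b w u0 v0. \<lbrakk>0 \<le> a; a < b; b \<le> T; b - a \<le> h; u0 \<in> \<U>; v0 \<in> \<V>;
        (1 + (norm w)\<^sup>2) * exp (-4 * c * a) \<le> M\<rbrakk> \<Longrightarrow>
       \<exists>x L. x a = w \<and> L-lipschitz_on {a..b} x \<and>
         (\<forall>s\<in>{a..b}. (x has_vector_derivative f s (x s) u0 v0) (at s within {a..b})) \<and>
         (1 + (norm (x b))\<^sup>2) * exp (-4 * c * b) \<le> M"
proof -
  \<comment> \<open>The largest norm compatible with the weighted bound M at times up to T; the
    summand 1 makes R positive.\<close>
  define R where "R = sqrt (\<bar>M\<bar> * exp (4 * c * T)) + 1"
  have R: "R > 0" by (simp add: R_def add_nonneg_pos)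
  have norm_le_R: "norm y \<le> R" if "(1 + (norm y)\<^sup>2) * exp (-4 * c * s) \<le> M" "s \<le> T" for y :: "real^'n" and s
  proof -
    have "(norm y)\<^sup>2 \<le> 1 + (norm y)\<^sup>2" by simp
    also have "\<dots> = (1 + (norm y)\<^sup>2) * exp (-4 * c * s) * exp (4 * c * s)"
      by (simp add: exp_minus)
    also have "\<dots> \<le> \<bar>M\<bar> * exp (4 * c * T)"
      by (rule mult_mono) (use that c_pos in auto)
    finally have "norm y \<le> sqrt (\<bar>M\<bar> * exp (4 * c * T))" by (rule real_le_rsqrt)
    then show ?thesis by (simp add: R_def)
  qed
  obtain L where L: "L > 0" "\<And>t u v x y. \<lbrakk>t \<in> {0..T}; u \<in> \<U>; v \<in> \<V>; norm x \<le> R; norm y \<le> R\<rbrakk> \<Longrightarrow>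
        norm (f t x u v - f t y u v) + \<bar>f0 t x u v - f0 t y u v\<bar> \<le> L * norm (x - y)"
    using local_Lipschitz[rule_format, OF R] by auto
  define P where "P = closest_point (cball (0::real^'n) R)"
  have P_in: "norm (P y) \<le> R" for y
    using closest_point_in_set[of "cball (0::real^'n) R" y] R by (simp add: P_def)
  have P_self: "P y = y" if "norm y \<le> R" for y
    using closest_point_self[of y "cball 0 R"] that by (simp add: P_def)
  have P_lip: "norm (P y - P z) \<le> norm (y - z)" for y z
    using closest_point_lipschitz[of "cball (0::real^'n) R" y z] R by (simp add: P_def dist_norm)
  \<comment> \<open>The projection fixes 0 and is nonexpansive, so it does not increase norms and
    the modified field has the same linear growth constant.\<close>
  have P_norm: "norm (P y) \<le> norm y" for y
    using P_lip[of y 0] P_self[of 0] R by simp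
  have P_cont: "continuous_on S P" for S
    unfolding P_def by (rule continuous_on_closest_point) (use R in auto)
  show ?thesis
  proof (rule that[of "1 / (2 * L)"])
    show "1 / (2 * L) > 0" using L by simp
    fix a b :: real and w :: "real^'n" and u0 v0
    assume ab: "0 \<le> a" "a < b" "b \<le> T" "b - a \<le> 1 / (2 * L)" and uv: "u0 \<in> \<U>" "v0 \<in> \<V>"
      and w: "(1 + (norm w)\<^sup>2) * exp (-4 * c * a) \<le> M"
    have "continuous_on ({a..b} \<times> UNIV) (\<lambda>p. (fst p, P (snd p), u0, v0))"
      by (intro continuous_intros continuous_on_compose2[OF P_cont[of UNIV]]) auto
    moreover have "(\<lambda>p. (fst p, P (snd p), u0, v0)) ` ({a..b} \<times> UNIV) \<subseteq> {0..T} \<times> UNIV \<times> \<U> \<times> \<V>"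
      using ab uv by auto
    ultimately have cF: "continuous_on ({a..b} \<times> UNIV) (\<lambda>(s, y). f s (P y) u0 v0)"
      using continuous_on_compose2[OF cont_f, of "{a..b} \<times> UNIV" "\<lambda>p. (fst p, P (snd p), u0, v0)"]
      by (simp add: case_prod_unfold)
    have lipF: "norm (f s (P y) u0 v0 - f s (P z) u0 v0) \<le> L * norm (y - z)" if "s \<in> {a..b}" for s y z
    proof -
      have "norm (f s (P y) u0 v0 - f s (P z) u0 v0) \<le> L * norm (P y - P z)"
        using L(2)[of s u0 v0 "P y" "P z"] uv that ab P_in by (smt (verit) atLeastAtMost_iff)
      also have "\<dots> \<le> L * norm (y - z)" using L(1) P_lip by (intro mult_left_mono) auto
      finally show ?thesis .
    qed
    have "L * (b - a) \<le> 1/2" using ab(4) L(1) by (simp add: field_simps)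
    with ode_short_time_existence[OF _ cF lipF, of w] ab L(1)
    obtain x where x: "x a = w"
      "\<And>s. s\<in>{a..b} \<Longrightarrow> (x has_vector_derivative f s (P (x s)) u0 v0) (at s within {a..b})"
      by auto
    have bd: "norm (f s (P y) u0 v0) \<le> c * (1 + R)" "norm (f s (P y) u0 v0) \<le> c * (1 + norm y)"
      if "s \<in> {a..b}" for s y
    proof -
      have s: "norm (f s (P y) u0 v0) \<le> c * (1 + norm (P y))"
        using that ab uv by (intro growth_f) auto
      show "norm (f s (P y) u0 v0) \<le> c * (1 + R)" "norm (f s (P y) u0 v0) \<le> c * (1 + norm y)"
        by (rule order_trans[OF s], rule mult_left_mono, use P_in P_norm c_pos in auto)+
    qed
    have lip: "(c * (1 + R))-lipschitz_on {a..b} x"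
      by (rule lipschitz_on_vector_derivative_bound[OF _ x(2)]) (use bd c_pos R in auto)
    have dec: "(1 + (norm (x s))\<^sup>2) * exp (-4 * c * s) \<le> M" if s: "s \<in> {a..b}" for s
    proof -
      have "(1 + (norm (x s))\<^sup>2) * exp (-4 * c * s) \<le> (1 + (norm (x a))\<^sup>2) * exp (-4 * c * a)"
      proof (rule linear_growth_decreasing[OF _ lipschitz_on_subset[OF lip] negligible_empty])
        fix r assume "r \<in> {a..s} - {}"
        then show "(x has_vector_derivative f r (P (x r)) u0 v0) (at r within {a..s})"
          by (intro has_vector_derivative_within_subset[OF x(2)]) (use s in auto)
      qed (use s bd c_pos in auto)
      then show ?thesis using w x(1) by simp
    qed
    then have "P (x s) = x s" if "s \<in> {a..b}" for s
      using that ab by (intro P_self norm_le_R[of _ s]) auto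
    then show "\<exists>x L. x a = w \<and> L-lipschitz_on {a..b} x \<and>
         (\<forall>s\<in>{a..b}. (x has_vector_derivative f s (x s) u0 v0) (at s within {a..b})) \<and>
         (1 + (norm (x b))\<^sup>2) * exp (-4 * c * b) \<le> M"
      using x lip dec[of b] ab by (intro exI[of _ x] exI[of _ "c * (1 + R)"]) auto
  qed
qed

text \<open>Cells of length at most \<open>min h \<delta>\<close> are solved one after another, the
  policy being evaluated at the start of each. A constant v keeps the field continuous in time on
  each cell, so Picard iteration suffices. Constant controls are enough to show that the sets of
  costs are nonempty and to test a policy against a fixed control.\<close>

lemma guided_exists:
  assumes \<pi>: "\<pi> \<in> policies T \<U>" and v0: "v0 \<in> \<V>" and \<delta>: "\<delta> > 0" and ab: "0 \<le> a" "a < b" "b \<le> T"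
  shows "\<exists>m t u x. guided \<pi> a b m t u (\<lambda>_. v0) x \<and> mesh m t \<le> \<delta> \<and> x a = w"
proof -
  define M where "M = (1 + (norm w)\<^sup>2) * exp (-4 * c * a)"
  obtain h where h: "h > 0"
    "\<And>a b w u0 v0. \<lbrakk>0 \<le> a; a < b; b \<le> T; b - a \<le> h; u0 \<in> \<U>; v0 \<in> \<V>;
        (1 + (norm w)\<^sup>2) * exp (-4 * c * a) \<le> M\<rbrakk> \<Longrightarrow>
       \<exists>x L. x a = w \<and> L-lipschitz_on {a..b} x \<and>
         (\<forall>s\<in>{a..b}. (x has_vector_derivative f s (x s) u0 v0) (at s within {a..b})) \<and>
         (1 + (norm (x b))\<^sup>2) * exp (-4 * c * b) \<le> M"
    using short_time_motion_exists[of M] by blast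
  define k where "k = min h \<delta>"
  have k: "k > 0" "k \<le> h" "k \<le> \<delta>" using h \<delta> by (auto simp: k_def)
  have single: "\<exists>t u x. guided \<pi> a b 0 t u (\<lambda>_. v0) x \<and> mesh 0 t \<le> \<delta> \<and> x a = w \<and>
       (1 + (norm (x b))\<^sup>2) * exp (-4 * c * b) \<le> M"
    if ab: "0 \<le> a" "a < b" "b \<le> T" "b - a \<le> k" and w: "(1 + (norm w)\<^sup>2) * exp (-4 * c * a) \<le> M" for a b w
  proof -
    have "\<pi> a w \<in> \<U>" using \<pi> ab by (auto simp: policies_def)
    then obtain x L where x: "x a = w" "L-lipschitz_on {a..b} x"
      "\<forall>s\<in>{a..b}. (x has_vector_derivative f s (x s) (\<pi> a w) v0) (at s within {a..b})"
      "(1 + (norm (x b))\<^sup>2) * exp (-4 * c * b) \<le> M"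
      using h(2)[of a b "\<pi> a w" v0 w] ab k v0 w by auto
    define t where "t = (\<lambda>i::nat. if i = 0 then a else b)"
    have "guided \<pi> a b 0 t (\<lambda>_. \<pi> a w) (\<lambda>_. v0) x"
      unfolding guided_def using ab x v0
      by (auto simp: t_def time_partition_def control_def intro!: exI[of _ L] exI[of _ "{}"])
    moreover have "mesh 0 t \<le> \<delta>" using ab k by (simp add: mesh_le_iff step_def t_def)
    ultimately show ?thesis using x by blast
  qed
  have "\<exists>m t u x. guided \<pi> a b m t u (\<lambda>_. v0) x \<and> mesh m t \<le> \<delta> \<and> x a = w"
    if "0 \<le> a" "a < b" "b \<le> T" "b - a \<le> real (Suc n) * k" "(1 + (norm w)\<^sup>2) * exp (-4 * c * a) \<le> M" for n a w
    using that
  proof (induction n arbitrary: a w)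
    case 0
    then show ?case using single[of a b w] by auto
  next
    case (Suc n)
    show ?case
    proof (cases "b - a \<le> k")
      case True
      then show ?thesis using single[of a b w] Suc.prems by auto
    next
      case False
      have "0 \<le> a" "a < a + k" "a + k \<le> T" "a + k - a \<le> k" using Suc.prems False k by auto
      from single[OF this Suc.prems(5)] obtain t1 u1 x1 where
        1: "guided \<pi> a (a + k) 0 t1 u1 (\<lambda>_. v0) x1" "mesh 0 t1 \<le> \<delta>" "x1 a = w"
          "(1 + (norm (x1 (a + k)))\<^sup>2) * exp (-4 * c * (a + k)) \<le> M" by blast
      have "b - (a + k) \<le> real (Suc n) * k"
        using Suc.prems(4) by (simp add: algebra_simps)
      then obtain m t2 u2 x2 where
        2: "guided \<pi> (a + k) b m t2 u2 (\<lambda>_. v0) x2" "mesh m t2 \<le> \<delta>" "x2 (a + k) = x1 (a + k)"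
        using Suc.IH[of "a + k" "x1 (a + k)"] Suc.prems False k 1(4) by auto
      have g: "guided \<pi> a b (0 + Suc m) (concat_partition 0 t1 t2) (concat_at (a+k) u1 u2)
          (concat_at (a+k) (\<lambda>_. v0) (\<lambda>_. v0)) (concat_at (a+k) x1 x2)"
        by (rule guided_concat[OF 1(1) 2(1)]) (use 2 in simp)
      have "mesh (0 + Suc m) (concat_partition 0 t1 t2) \<le> \<delta>"
        by (rule mesh_concat_partition) (use 1 2 in \<open>auto simp: guided_def time_partition_def\<close>)
      moreover have "concat_at (a+k) (\<lambda>_. v0) (\<lambda>_. v0) = (\<lambda>_. v0)" by (auto simp: concat_at_def)
      moreover have "concat_at (a+k) x1 x2 a = w" using 1(3) k by (simp add: concat_at_def)
      ultimately show ?thesis using g by metis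
    qed
  qed
  moreover obtain n where "(b - a) / k \<le> real n" using real_arch_simple by blast
  then have "b - a \<le> real (Suc n) * k" using k by (simp add: field_simps)
  ultimately show ?thesis using ab M_def by blast
qed

end

section \<open>The value function\<close>

lemma SUP_affine:
  fixes g :: "'a \<Rightarrow> real"
  assumes "A \<noteq> {}" "bdd_above (g ` A)" "0 \<le> h"
  shows "(SUP a\<in>A. k + h * g a) = k + h * (SUP a\<in>A. g a)"
proof -
  have "mono (\<lambda>y::real. k + h * y)" using assms(3) by (intro monoI) (simp add: mult_left_mono)
  then have "k + h * Sup (g ` A) = (SUP s\<in>g ` A. k + h * s)"
    by (rule continuous_at_Sup_mono) (use assms in \<open>auto intro!: continuous_intros\<close>)
  then show ?thesis by (simp add: image_image)
qed

lemma INF_affine: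
  fixes g :: "'a \<Rightarrow> real"
  assumes "A \<noteq> {}" "bdd_below (g ` A)" "0 \<le> h"
  shows "(INF a\<in>A. k + h * g a) = k + h * (INF a\<in>A. g a)"
proof -
  have "mono (\<lambda>y::real. k + h * y)" using assms(3) by (intro monoI) (simp add: mult_left_mono)
  then have "k + h * Inf (g ` A) = (INF s\<in>g ` A. k + h * s)"
    by (rule continuous_at_Inf_mono) (use assms in \<open>auto intro!: continuous_intros\<close>)
  then show ?thesis by (simp add: image_image)
qed

text \<open>Nonnegative scaling and translation preserve order. The uniform bound M makes the inner
  suprema and infima bounded in the outer variable as well, which the real-valued operators
  require.\<close>

lemma
  fixes g :: "'a \<Rightarrow> 'b \<Rightarrow> real"
  assumes ne: "A \<noteq> {}" "B \<noteq> {}" and bd: "\<And>a b. a \<in> A \<Longrightarrow> b \<in> B \<Longrightarrow> \<bar>g a b\<bar> \<le> M" and "0 \<le> h"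
  shows INF_SUP_affine: "(INF a\<in>A. SUP b\<in>B. k + h * g a b) = k + h * (INF a\<in>A. SUP b\<in>B. g a b)"
    and SUP_INF_affine: "(SUP b\<in>B. INF a\<in>A. k + h * g a b) = k + h * (SUP b\<in>B. INF a\<in>A. g a b)"
proof -
  have above: "bdd_above (g a ` B)" if "a \<in> A" for a
    using bd[OF that] by (auto intro!: bdd_aboveI[of _ M] dest: abs_le_D1)
  have below: "bdd_below ((\<lambda>a. g a b) ` A)" if "b \<in> B" for b
    using bd[OF _ that] by (auto intro!: bdd_belowI[of _ "-M"] simp: abs_le_iff minus_le_iff)
  have "bdd_below ((\<lambda>a. SUP b\<in>B. g a b) ` A)"
  proof (rule bdd_belowI2)
    fix a assume a: "a \<in> A"
    obtain b where b: "b \<in> B" using ne by auto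
    have "- M \<le> g a b" using bd[OF a b] by simp
    also have "\<dots> \<le> (SUP b\<in>B. g a b)" using b above[OF a] by (rule cSUP_upper)
    finally show "- M \<le> (SUP b\<in>B. g a b)" .
  qed
  then show "(INF a\<in>A. SUP b\<in>B. k + h * g a b) = k + h * (INF a\<in>A. SUP b\<in>B. g a b)"
    using above assms by (simp add: SUP_affine INF_affine)
  have "bdd_above ((\<lambda>b. INF a\<in>A. g a b) ` B)"
  proof (rule bdd_aboveI2)
    fix b assume b: "b \<in> B"
    obtain a where a: "a \<in> A" using ne by auto
    have "(INF a\<in>A. g a b) \<le> g a b" using below[OF b] a by (rule cINF_lower)
    also have "\<dots> \<le> M" using bd[OF a b] by simp
    finally show "(INF a\<in>A. g a b) \<le> M" .
  qed
  then show "(SUP b\<in>B. INF a\<in>A. k + h * g a b) = k + h * (SUP b\<in>B. INF a\<in>A. g a b)"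
    using below assms by (simp add: SUP_affine INF_affine)
qed

section \<open>Boundedness of the costs and the value as an infimum\<close>

context differential_game
begin

abbreviation "costs \<pi> \<tau> w \<delta> \<equiv> policy_costs T \<V> f f0 \<sigma> \<pi> \<tau> w \<delta>"
abbreviation "policy_val \<equiv> policy_value T \<V> f f0 \<sigma>"
abbreviation "val \<equiv> game_value T \<U> \<V> f f0 \<sigma>"

lemma policies_nonempty: "policies T \<U> \<noteq> {}"
proof -
  obtain u0 where "u0 \<in> \<U>" using U by auto
  then have "(\<lambda>_ _. u0) \<in> policies T \<U>" by (auto simp: policies_def)
  then show ?thesis by blast
qed

text \<open>The terminal position lies in a fixed ball and the running cost along the motion is
  bounded. The bound is uniform in the policy, which also bounds the infimum over policies from
  below.\<close>

lemma costs_bounded: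
  assumes "0 \<le> \<tau>"
  obtains B where "\<And>\<pi> \<delta> j. \<pi> \<in> policies T \<U> \<Longrightarrow> j \<in> costs \<pi> \<tau> w \<delta> \<Longrightarrow> \<bar>j\<bar> \<le> B"
proof -
  have "bounded (\<sigma> ` cball 0 (radius w))"
    by (rule compact_imp_bounded[OF compact_continuous_image[OF continuous_on_subset[OF cont_\<sigma>]]]) auto
  then obtain B where B: "\<And>y. norm y \<le> radius w \<Longrightarrow> \<bar>\<sigma> y\<bar> \<le> B"
    unfolding bounded_iff by fastforce
  show ?thesis
  proof (rule that[of "B + c * (1 + radius w) * (T - \<tau>)"])
    fix \<pi> \<delta> j assume \<pi>: "\<pi> \<in> policies T \<U>" and "j \<in> costs \<pi> \<tau> w \<delta>"
    then obtain m t u v x where j: "j = cost f0 \<sigma> \<tau> T u v x" and g: "guided \<pi> \<tau> T m t u v x" and x: "x \<tau> = w"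
      unfolding policy_costs_eq by auto
    have "\<tau> < T" using g time_partition_less by (auto simp: guided_def)
    then have "norm (x T) \<le> radius w" using guided_bounded[OF g \<pi> assms, of T] x by auto
    then have "\<bar>\<sigma> (x T)\<bar> \<le> B" by (rule B)
    moreover have "\<bar>LINT s|lebesgue_on {\<tau>..T}. f0 s (x s) (u s) (v s)\<bar> \<le> c * (1 + radius w) * (T - \<tau>)"
      using guided_integrable(2)[OF g \<pi> assms] x by auto
    ultimately show "\<bar>j\<bar> \<le> B + c * (1 + radius w) * (T - \<tau>)" unfolding j cost_def by linarith
  qed
qed

lemma costs_bdd_above:
  assumes "0 \<le> \<tau>" "\<pi> \<in> policies T \<U>"
  shows "bdd_above (costs \<pi> \<tau> w \<delta>)"
  using costs_bounded[OF assms(1), of w] assms(2) by (metis abs_le_D1 bdd_aboveI)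

lemma costs_nonempty:
  assumes "\<tau> \<in> {0..<T}" "\<pi> \<in> policies T \<U>" "\<delta> > 0"
  shows "costs \<pi> \<tau> w \<delta> \<noteq> {}"
proof -
  obtain v0 where "v0 \<in> \<V>" using V by auto
  with assms have "\<exists>m t u x. guided \<pi> \<tau> T m t u (\<lambda>_. v0) x \<and> mesh m t \<le> \<delta> \<and> x \<tau> = w"
    by (intro guided_exists) auto
  then
  show ?thesis unfolding policy_costs_eq by blast
qed

lemma Sup_costs_ge:
  assumes \<tau>: "\<tau> \<in> {0..<T}"
  obtains B where "\<And>\<pi> \<delta>. \<pi> \<in> policies T \<U> \<Longrightarrow> \<delta> > 0 \<Longrightarrow> B \<le> Sup (costs \<pi> \<tau> w \<delta>)"
proof -
  obtain B where B: "\<And>\<pi> \<delta> j. \<pi> \<in> policies T \<U> \<Longrightarrow> j \<in> costs \<pi> \<tau> w \<delta> \<Longrightarrow> \<bar>j\<bar> \<le> B"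
    using costs_bounded \<tau> by (metis atLeastLessThan_iff)
  show ?thesis
  proof (rule that[of "- B"])
    fix \<pi> :: "real \<Rightarrow> real^'n \<Rightarrow> real^'k" and \<delta> :: real assume \<pi>: "\<pi> \<in> policies T \<U>" and \<delta>: "\<delta> > 0"
    obtain j where j: "j \<in> costs \<pi> \<tau> w \<delta>" using costs_nonempty[OF \<tau> \<pi> \<delta>] by auto
    then have "- B \<le> j" using B[OF \<pi> j] by simp
    also have "j \<le> Sup (costs \<pi> \<tau> w \<delta>)" by (rule cSup_upper[OF j costs_bdd_above]) (use \<tau> \<pi> in auto)
    finally show "- B \<le> Sup (costs \<pi> \<tau> w \<delta>)" .
  qed
qed

text \<open>A smaller \<delta> admits fewer partitions, so the supremum is monotone in \<delta> and
  its limit at 0 from the right is the infimum. Afterwards only the infimum is used.\<close>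

lemma policy_value_eq_INF:
  assumes \<tau>: "\<tau> \<in> {0..<T}" and \<pi>: "\<pi> \<in> policies T \<U>"
  shows "policy_val \<pi> \<tau> w = (INF \<delta>\<in>{0<..}. Sup (costs \<pi> \<tau> w \<delta>))"
    and "bdd_below ((\<lambda>\<delta>. Sup (costs \<pi> \<tau> w \<delta>)) ` {0<..})"
proof -
  let ?S = "\<lambda>\<delta>. Sup (costs \<pi> \<tau> w \<delta>)"
  obtain B where B: "\<And>\<pi> \<delta>. \<pi> \<in> policies T \<U> \<Longrightarrow> \<delta> > 0 \<Longrightarrow> B \<le> Sup (costs \<pi> \<tau> w \<delta>)"
    using Sup_costs_ge[OF \<tau>] by blast
  show bb: "bdd_below (?S ` {0<..})" by (rule bdd_belowI2[of _ B]) (use B[OF \<pi>] in auto)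
  have mono: "?S \<delta>1 \<le> ?S \<delta>2" if "0 < \<delta>1" "\<delta>1 \<le> \<delta>2" for \<delta>1 \<delta>2
  proof (rule cSup_subset_mono[OF costs_nonempty[OF \<tau> \<pi> that(1)] costs_bdd_above])
    show "costs \<pi> \<tau> w \<delta>1 \<subseteq> costs \<pi> \<tau> w \<delta>2"
      unfolding policy_costs_eq using that by fastforce
  qed (use \<tau> \<pi> in auto)
  have "(?S \<longlongrightarrow> (INF \<delta>\<in>{0<..}. ?S \<delta>)) (at_right 0)"
  proof (rule order_tendstoI)
    fix k assume "k < (INF \<delta>\<in>{0<..}. ?S \<delta>)"
    then have "k < ?S \<delta>" if "\<delta> > 0" for \<delta>
      using cINF_lower[OF bb, of \<delta>] that by auto
    then show "\<forall>\<^sub>F \<delta> in at_right 0. k < ?S \<delta>"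
      by (auto simp: eventually_at_right_field intro!: exI[of _ 1])
  next
    fix k assume "(INF \<delta>\<in>{0<..}. ?S \<delta>) < k"
    then obtain \<delta>0 where "\<delta>0 > 0" "?S \<delta>0 < k"
      using cInf_lessD[of "?S ` {0<..}" k] by auto
    then show "\<forall>\<^sub>F \<delta> in at_right 0. ?S \<delta> < k"
      using mono by (auto simp: eventually_at_right_field intro!: exI[of _ \<delta>0] le_less_trans[of _ "?S \<delta>0"])
  qed
  then have "Lim (at_right 0) ?S = (INF \<delta>\<in>{0<..}. ?S \<delta>)"
    by (rule tendsto_Lim[rotated]) simp
  then show "policy_val \<pi> \<tau> w = (INF \<delta>\<in>{0<..}. ?S \<delta>)"
    using \<tau> by (simp add: policy_value_def)
qed

lemma policy_value_le_Sup:
  assumes "\<tau> \<in> {0..<T}" "\<pi> \<in> policies T \<U>" "\<delta> > 0"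
  shows "policy_val \<pi> \<tau> w \<le> Sup (costs \<pi> \<tau> w \<delta>)"
  unfolding policy_value_eq_INF(1)[OF assms(1,2)]
  by (rule cINF_lower[OF policy_value_eq_INF(2)[OF assms(1,2)]]) (use assms in auto)

lemma le_policy_value:
  assumes "\<tau> \<in> {0..<T}" "\<pi> \<in> policies T \<U>" "\<And>\<delta>. \<delta> > 0 \<Longrightarrow> k \<le> Sup (costs \<pi> \<tau> w \<delta>)"
  shows "k \<le> policy_val \<pi> \<tau> w"
  unfolding policy_value_eq_INF(1)[OF assms(1,2)]
  by (rule cINF_greatest) (use assms(3) in \<open>auto intro: gt_ex\<close>)

lemma game_value_le:
  assumes \<tau>: "\<tau> \<in> {0..<T}" and \<pi>: "\<pi> \<in> policies T \<U>"
  shows "val \<tau> w \<le> policy_val \<pi> \<tau> w"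
  unfolding game_value_def
proof (rule cINF_lower[OF _ \<pi>])
  obtain B where B: "\<And>\<pi> \<delta>. \<pi> \<in> policies T \<U> \<Longrightarrow> \<delta> > 0 \<Longrightarrow> B \<le> Sup (costs \<pi> \<tau> w \<delta>)"
    using Sup_costs_ge[OF \<tau>] by blast
  show "bdd_below ((\<lambda>\<pi>. policy_val \<pi> \<tau> w) ` policies T \<U>)"
    by (rule bdd_belowI2[of _ B], rule le_policy_value[OF \<tau>]) (use B in auto)
qed

lemma game_value_terminal: "val T w = \<sigma> w"
  by (simp add: game_value_def policy_value_def cINF_const[OF policies_nonempty])

text \<open>
  Half of the dynamic programming principle. The other half would need a single policy that is
  nearly optimal from all positions reachable at time \<open>b\<close>.
\<close>

lemma le_game_value_by_constant_control:
  assumes \<tau>: "0 \<le> \<tau>" "\<tau> < b" "b < T" and v0: "v0 \<in> \<V>"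
    and k: "\<And>\<pi> m t u x. \<lbrakk>\<pi> \<in> policies T \<U>; guided \<pi> \<tau> b m t u (\<lambda>_. v0) x; x \<tau> = w\<rbrakk> \<Longrightarrow>
      k \<le> val b (x b) + (LINT s|lebesgue_on {\<tau>..b}. f0 s (x s) (u s) v0)"
  shows "k \<le> val \<tau> w"
  unfolding game_value_def
proof (rule cINF_greatest[OF policies_nonempty])
  fix \<pi> :: "real \<Rightarrow> real^'n \<Rightarrow> real^'k" assume \<pi>: "\<pi> \<in> policies T \<U>"
  show "k \<le> policy_val \<pi> \<tau> w"
  proof (rule le_policy_value[OF _ \<pi>])
    show "\<tau> \<in> {0..<T}" using \<tau> by auto
    have b: "b \<in> {0..<T}" "0 \<le> b" using \<tau> by auto
    fix \<delta> :: real assume \<delta>: "\<delta> > 0"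
    obtain m t u x where g: "guided \<pi> \<tau> b m t u (\<lambda>_. v0) x" "mesh m t \<le> \<delta>" "x \<tau> = w"
      using guided_exists[OF \<pi> v0 \<delta> \<tau>(1,2)] \<tau> by fastforce
    let ?I = "LINT s|lebesgue_on {\<tau>..b}. f0 s (x s) (u s) v0"
    \<comment> \<open>Every motion from the position reached at b extends the fixed initial piece to
      a motion from the starting point with the same policy and mesh bound; its cost exceeds that of
      the continuation by exactly the integral over the initial piece.\<close>
    have "Sup (costs \<pi> b (x b) \<delta>) \<le> Sup (costs \<pi> \<tau> w \<delta>) - ?I"
    proof (rule cSup_least[OF costs_nonempty[OF b(1) \<pi> \<delta>]])
      fix j assume "j \<in> costs \<pi> b (x b) \<delta>"
      then obtain m2 t2 u2 v2 x2 where j: "j = cost f0 \<sigma> b T u2 v2 x2"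
        and g2: "guided \<pi> b T m2 t2 u2 v2 x2" "mesh m2 t2 \<le> \<delta>" "x2 b = x b"
        unfolding policy_costs_eq by auto
      let ?u = "concat_at b u u2" and ?v = "concat_at b (\<lambda>_. v0) v2" and ?x = "concat_at b x x2"
      have gc: "guided \<pi> \<tau> T (m + Suc m2) (concat_partition m t t2) ?u ?v ?x"
        by (rule guided_concat[OF g(1) g2(1)]) (use g2 in simp)
      have mesh: "mesh (m + Suc m2) (concat_partition m t t2) \<le> \<delta>"
        by (rule mesh_concat_partition) (use g g2 in \<open>auto simp: guided_def time_partition_def\<close>)
      have x0: "?x \<tau> = w" using g \<tau> by (simp add: concat_at_def)
      have "cost f0 \<sigma> \<tau> T ?u ?v ?x \<in> costs \<pi> \<tau> w \<delta>"
        unfolding policy_costs_eq using gc mesh x0 by blast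
      then have "cost f0 \<sigma> \<tau> T ?u ?v ?x \<le> Sup (costs \<pi> \<tau> w \<delta>)"
        by (rule cSup_upper[OF _ costs_bdd_above[OF \<tau>(1) \<pi>]])
      moreover have "cost f0 \<sigma> \<tau> T ?u ?v ?x = j + ?I"
        unfolding cost_def j
        by (subst integral_concat[OF g(1) g2(1)]) (use g2 \<pi> \<tau> in \<open>auto simp: concat_at_def\<close>)
      ultimately show "j \<le> Sup (costs \<pi> \<tau> w \<delta>) - ?I" by simp
    qed
    moreover have "val b (x b) \<le> Sup (costs \<pi> b (x b) \<delta>)"
      using game_value_le[OF b(1) \<pi>] policy_value_le_Sup[OF b(1) \<pi> \<delta>] by (rule order_trans)
    ultimately show "k \<le> Sup (costs \<pi> \<tau> w \<delta>)" using k[OF \<pi> g(1,3)] by simp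
  qed
qed

section \<open>Continuity of the rate\<close>

lemma continuous_on_game_rate:
  assumes "continuous_on ({0..T} \<times> UNIV) \<Phi>'"
  shows "continuous_on ({0..T} \<times> UNIV \<times> \<U> \<times> \<V>) (\<lambda>(t, x, u, v). game_rate \<Phi>' t x u v)"
proof -
  let ?K = "{0..T} \<times> (UNIV :: (real^'n) set) \<times> \<U> \<times> \<V>"
  have "continuous_on ?K (\<lambda>p. \<Phi>' (fst p, fst (snd p)))"
    by (rule continuous_on_compose2[OF assms]) (auto intro!: continuous_intros)
  then show ?thesis
    using cont_f cont_f0 unfolding game_rate_def case_prod_unfold
    by (auto intro!: continuous_intros)
qed

text \<open>Compactness of \<open>\<U>\<close> and \<open>\<V>\<close> makes the modulus of
  continuity independent of the controls. This allows time and position to be frozen while the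
  controls vary arbitrarily.\<close>

lemma game_rate_uniform:
  assumes "continuous_on ({0..T} \<times> UNIV) \<Phi>'" "e > 0"
  obtains \<rho> where "\<rho> > 0" "\<And>t t' x x' u v. \<lbrakk>t \<in> {0..T}; t' \<in> {0..T}; norm x \<le> R; norm x' \<le> R;
     \<bar>t - t'\<bar> + norm (x - x') < \<rho>; u \<in> \<U>; v \<in> \<V>\<rbrakk> \<Longrightarrow>
     \<bar>game_rate \<Phi>' t x u v - game_rate \<Phi>' t' x' u v\<bar> < e"
proof -
  let ?K = "{0..T} \<times> cball (0::real^'n) R \<times> \<U> \<times> \<V>"
  let ?g = "\<lambda>(t, x, u, v). game_rate \<Phi>' t x u v"
  have "uniformly_continuous_on ?K ?g"
    using U V by (intro compact_uniformly_continuous compact_Times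
        continuous_on_subset[OF continuous_on_game_rate[OF assms(1)]]) auto
  then obtain \<rho> where \<rho>: "\<rho> > 0" "\<And>p q. \<lbrakk>p \<in> ?K; q \<in> ?K; dist q p < \<rho>\<rbrakk> \<Longrightarrow> dist (?g q) (?g p) < e"
    using assms(2) unfolding uniformly_continuous_on_def by metis
  show ?thesis
  proof (rule that[OF \<rho>(1)])
    fix t t' :: real and x x' :: "real^'n" and u :: "real^'k" and v :: "real^'l"
    assume *: "t \<in> {0..T}" "t' \<in> {0..T}" "norm x \<le> R" "norm x' \<le> R"
     "\<bar>t - t'\<bar> + norm (x - x') < \<rho>" "u \<in> \<U>" "v \<in> \<V>"
    have "dist (t, x, u, v) (t', x', u, v) \<le> \<bar>t - t'\<bar> + norm (x - x')"
      using norm_Pair_le[of "t - t'" "(x - x', 0::real^'k, 0::real^'l)"]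
      by (simp add: dist_norm norm_Pair)
    then show "\<bar>game_rate \<Phi>' t x u v - game_rate \<Phi>' t' x' u v\<bar> < e"
      using \<rho>(2)[of "(t', x', u, v)" "(t, x, u, v)"] * by (auto simp: dist_real_def)
  qed
qed

lemma game_rate_bounded:
  assumes "continuous_on ({0..T} \<times> UNIV) \<Phi>'" "t \<in> {0..T}"
  obtains B where "\<And>u v. u \<in> \<U> \<Longrightarrow> v \<in> \<V> \<Longrightarrow> \<bar>game_rate \<Phi>' t x u v\<bar> \<le> B"
proof -
  have "compact ({t} \<times> {x} \<times> \<U> \<times> \<V>)" using U V by (intro compact_Times) auto
  moreover have "continuous_on ({t} \<times> {x} \<times> \<U> \<times> \<V>) (\<lambda>(t, x, u, v). game_rate \<Phi>' t x u v)"
    by (rule continuous_on_subset[OF continuous_on_game_rate[OF assms(1)]]) (use assms in auto)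
  ultimately have "bounded ((\<lambda>(t, x, u, v). game_rate \<Phi>' t x u v) ` ({t} \<times> {x} \<times> \<U> \<times> \<V>))"
    using compact_continuous_image compact_imp_bounded by blast
  then show ?thesis using that unfolding bounded_iff by fastforce
qed

end

section \<open>The Hamilton--Jacobi--Isaacs equation\<close>

locale smooth_differential_game = differential_game T c \<U> \<V> f f0 \<sigma>
  for T c :: real
    and \<U> :: "(real^'k) set"
    and \<V> :: "(real^'l) set"
    and f :: "real \<Rightarrow> real^'n \<Rightarrow> real^'k \<Rightarrow> real^'l \<Rightarrow> real^'n"
    and f0 :: "real \<Rightarrow> real^'n \<Rightarrow> real^'k \<Rightarrow> real^'l \<Rightarrow> real"
    and \<sigma> :: "real^'n \<Rightarrow> real" +
  fixes W' :: "real \<times> (real^'n) \<Rightarrow> (real \<times> (real^'n)) \<Rightarrow>\<^sub>L real"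
  assumes Isaacs:
      "\<And>t x s. t \<in> {0..T} \<Longrightarrow>
         (INF u\<in>\<U>. SUP v\<in>\<V>. f t x u v \<bullet> s + f0 t x u v) =
         (SUP v\<in>\<V>. INF u\<in>\<U>. f t x u v \<bullet> s + f0 t x u v)"
    and W'_cont: "continuous_on ({0..T} \<times> UNIV) W'"
    and W'_deriv: "\<And>p. p \<in> {0..T} \<times> UNIV \<Longrightarrow>
      ((\<lambda>(\<tau>, w). game_value T \<U> \<V> f f0 \<sigma> \<tau> w) has_derivative blinfun_apply (W' p)) (at p within {0..T} \<times> UNIV)"
begin

abbreviation "G \<equiv> game_rate W'"

lemma guided_G_has_integral:
  assumes "guided \<pi> a b m t u v x" "\<pi> \<in> policies T \<U>" "0 \<le> a" "b \<le> T"
  shows "((\<lambda>s. G s (x s) (u s) (v s)) has_integral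
     (val b (x b) - val a (x a) + (LINT s|lebesgue_on {a..b}. f0 s (x s) (u s) (v s)))) {a..b}"
  using guided_rate_has_integral[OF assms W'_deriv W'_cont] by simp

text \<open>Isaacs's condition concerns inner products with a vector s. Here s is the spatial
  gradient of the value, read off from its derivative on the basis vectors; the time derivative k
  does not depend on the controls and passes through both minimaxes.\<close>

lemma G_Isaacs:
  assumes "t \<in> {0..T}"
  shows "(INF u\<in>\<U>. SUP v\<in>\<V>. G t x u v) = (SUP v\<in>\<V>. INF u\<in>\<U>. G t x u v)"
proof -
  define s where "s = (\<Sum>b\<in>Basis. W' (t, x) (0, b) *\<^sub>R b)"
  define k where "k = W' (t, x) (1, 0)"
  have "W' (t, x) (0, y) = y \<bullet> s" for y
  proof -
    have "linear (\<lambda>y. W' (t, x) (0, y))"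
    proof (rule linearI)
      fix y z :: "real^'n" and r :: real
      show "W' (t, x) (0, y + z) = W' (t, x) (0, y) + W' (t, x) (0, z)"
        by (simp add: blinfun.add_right[symmetric])
      show "W' (t, x) (0, r *\<^sub>R y) = r *\<^sub>R W' (t, x) (0, y)"
        by (metis blinfun.scaleR_right scaleR_Pair scaleR_zero_right)
    qed
    have "W' (t, x) (0, y) = (\<lambda>y. W' (t, x) (0, y)) (\<Sum>b\<in>Basis. (y \<bullet> b) *\<^sub>R b)"
      by (simp add: euclidean_representation)
    also have "\<dots> = (\<Sum>b\<in>Basis. (y \<bullet> b) *\<^sub>R W' (t, x) (0, b))"
      unfolding linear_sum[OF \<open>linear _\<close>] by (simp add: linear_scale[OF \<open>linear _\<close>])
    also have "\<dots> = y \<bullet> s"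
      by (simp add: s_def inner_sum_right mult.commute)
    finally show ?thesis .
  qed
  then have "W' (t, x) (1, y) = k + y \<bullet> s" for y
    using blinfun.add_right[of "W' (t, x)" "(1, 0)" "(0, y)"] by (simp add: k_def)
  then have G: "G t x u v = k + 1 * (f t x u v \<bullet> s + f0 t x u v)" for u v
    by (simp add: game_rate_def)
  obtain B where B: "\<And>u v. u \<in> \<U> \<Longrightarrow> v \<in> \<V> \<Longrightarrow> \<bar>G t x u v\<bar> \<le> B"
    using game_rate_bounded[OF W'_cont assms] by blast
  have bd: "\<bar>f t x u v \<bullet> s + f0 t x u v\<bar> \<le> B + \<bar>k\<bar>" if "u \<in> \<U>" "v \<in> \<V>" for u v
    using B[OF that] by (simp add: G)
  show ?thesis unfolding G
    by (simp only: INF_SUP_affine[OF U(2) V(2) bd zero_le_one] SUP_INF_affine[OF U(2) V(2) bd zero_le_one]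
        Isaacs[OF assms])
qed

text \<open>If the rate at this position were at least \<eta> for all u, it would stay at least
  \<eta>/2 for a time h that does not depend on the policy. Under the constant control
  \<open>v0\<close>, every policy would then lead to a running cost plus value at time \<tau> + h
  exceeding the value at \<tau> by a fixed amount, contrary to the half of dynamic programming
  proved above.\<close>

lemma G_less_for_constant_v:
  assumes \<tau>: "\<tau> \<in> {0..<T}" and v0: "v0 \<in> \<V>" and \<eta>: "\<eta> > 0"
  shows "\<exists>u\<in>\<U>. G \<tau> w u v0 < \<eta>"
proof (rule ccontr)
  assume "\<not> ?thesis"
  then have ge: "\<eta> \<le> G \<tau> w u v0" if "u \<in> \<U>" for u using that by force
  define C where "C = c * (1 + radius w)"
  have C: "C \<ge> 0" using c_pos radius_nonneg[of w] by (simp add: C_def)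
  define R where "R = norm w + radius w"
  obtain \<rho> where \<rho>: "\<rho> > 0" "\<And>t t' x x' u v. \<lbrakk>t \<in> {0..T}; t' \<in> {0..T}; norm x \<le> R; norm x' \<le> R;
     \<bar>t - t'\<bar> + norm (x - x') < \<rho>; u \<in> \<U>; v \<in> \<V>\<rbrakk> \<Longrightarrow> \<bar>G t x u v - G t' x' u v\<bar> < \<eta> / 2"
    using game_rate_uniform[OF W'_cont, of "\<eta> / 2" R] \<eta> by (metis half_gt_zero)
  \<comment> \<open>The first term keeps \<tau> + h strictly before T. The second makes
    \<open>h * (1 + C)\<close>, a bound on the displacement in time plus space, smaller than
    \<rho>.\<close>
  define h where "h = min ((T - \<tau>) / 2) (\<rho> / (2 * (1 + C)))"
  have h: "h > 0" "\<tau> + h < T" using \<tau> \<rho>(1) C by (auto simp: h_def min_def field_simps)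
  have "h * (1 + C) \<le> \<rho> / (2 * (1 + C)) * (1 + C)" using C by (intro mult_right_mono) (auto simp: h_def)
  also have "\<dots> < \<rho>" using \<rho>(1) C by (simp add: field_simps add_pos_nonneg)
  finally have h\<rho>: "h * (1 + C) < \<rho>" .
  have "val \<tau> w + \<eta> / 2 * h \<le> val \<tau> w"
  proof (rule le_game_value_by_constant_control[OF _ _ h(2) v0])
    fix \<pi> m t u x
    assume \<pi>: "\<pi> \<in> policies T \<U>" and g: "guided \<pi> \<tau> (\<tau> + h) m t u (\<lambda>_. v0) x" and x: "x \<tau> = w"
    have \<tau>h: "0 \<le> \<tau>" "\<tau> + h \<le> T" using \<tau> h by auto
    have "((\<lambda>s. \<eta> / 2) has_integral (\<eta> / 2 * h)) {\<tau>..\<tau> + h}"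
      using has_integral_const_real[of "\<eta> / 2" \<tau> "\<tau> + h"] h by (simp add: mult.commute)
    from this guided_G_has_integral[OF g \<pi> \<tau>h]
    have "\<eta> / 2 * h \<le> val (\<tau> + h) (x (\<tau> + h)) - val \<tau> (x \<tau>) + (LINT s|lebesgue_on {\<tau>..\<tau> + h}. f0 s (x s) (u s) v0)"
    proof (rule has_integral_le_negligible)
      show "negligible {\<tau> + h}" by simp
      fix s assume s: "s \<in> {\<tau>..\<tau> + h} - {\<tau> + h}"
      have us: "u s \<in> \<U>" by (rule guided_u[OF g \<pi> \<tau>h]) (use s in auto)
      have sp: "norm (x s - w) \<le> C * (s - \<tau>)"
        using guided_speed[OF g \<pi> \<tau>h, of s] s x by (simp add: C_def)
      have "\<bar>s - \<tau>\<bar> + norm (x s - w) \<le> (s - \<tau>) * (1 + C)" using sp s by (simp add: algebra_simps)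
      also have "\<dots> \<le> h * (1 + C)" using s C by (intro mult_right_mono) auto
      also note h\<rho>
      finally have d: "\<bar>s - \<tau>\<bar> + norm (x s - w) < \<rho>" .
      have "norm (x s) \<le> R" using guided_bounded[OF g \<pi> \<tau>h, of s] s x by (simp add: R_def add_increasing)
      moreover have "norm w \<le> R" using radius_nonneg[of w] by (simp add: R_def)
      ultimately have "\<bar>G s (x s) (u s) v0 - G \<tau> w (u s) v0\<bar> < \<eta> / 2"
        using s \<tau> h by (intro \<rho>(2) d us v0) auto
      then show "\<eta> / 2 \<le> G s (x s) (u s) v0" using ge[OF us] by linarith
    qed
    then show "val \<tau> w + \<eta> / 2 * h \<le>
        val (\<tau> + h) (x (\<tau> + h)) + (LINT s|lebesgue_on {\<tau>..\<tau> + h}. f0 s (x s) (u s) v0)"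
      using x by simp
  qed (use \<tau> h in auto)
  then show False using \<eta> h by (simp add: mult_le_0_iff)
qed

lemma G_bdd_below: "t \<in> {0..T} \<Longrightarrow> v \<in> \<V> \<Longrightarrow> bdd_below ((\<lambda>u. G t x u v) ` \<U>)"
  using game_rate_bounded[OF W'_cont, of t x] by (metis abs_le_D2 bdd_belowI2 minus_le_iff)

lemma G_bdd_above: "t \<in> {0..T} \<Longrightarrow> u \<in> \<U> \<Longrightarrow> bdd_above (G t x u ` \<V>)"
  using game_rate_bounded[OF W'_cont, of t x] by (metis abs_le_D1 bdd_aboveI2)

text \<open>Testing against constant controls of the second agent bounds max-min; Isaacs's condition
  carries the bound over to min-max.\<close>

lemma INF_SUP_G_nonpos:
  assumes \<tau>: "\<tau> \<in> {0..<T}"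
  shows "(INF u\<in>\<U>. SUP v\<in>\<V>. G \<tau> w u v) \<le> 0"
proof -
  have "(SUP v\<in>\<V>. INF u\<in>\<U>. G \<tau> w u v) \<le> 0"
  proof (rule cSUP_least[OF V(2)])
    fix v0 assume v0: "v0 \<in> \<V>"
    show "(INF u\<in>\<U>. G \<tau> w u v0) \<le> 0"
    proof (rule field_le_epsilon)
      fix \<eta> :: real assume "\<eta> > 0"
      from G_less_for_constant_v[OF \<tau> v0 this] obtain u where u: "u \<in> \<U>" "G \<tau> w u v0 < \<eta>" by blast
      have "(INF u\<in>\<U>. G \<tau> w u v0) \<le> G \<tau> w u v0"
        by (rule cINF_lower[OF G_bdd_below u(1)]) (use \<tau> v0 in auto)
      then show "(INF u\<in>\<U>. G \<tau> w u v0) \<le> 0 + \<eta>" using u by simp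
    qed
  qed
  then show ?thesis using G_Isaacs[of \<tau> w] \<tau> by auto
qed

lemma ex_control_G_le:
  assumes t: "t \<in> {0..<T}" and "(INF u\<in>\<U>. SUP v\<in>\<V>. G t x u v) < k"
  shows "\<exists>u\<in>\<U>. \<forall>v\<in>\<V>. G t x u v < k"
proof -
  obtain u where u: "u \<in> \<U>" "(SUP v\<in>\<V>. G t x u v) < k"
    using cInf_lessD[of "(\<lambda>u. SUP v\<in>\<V>. G t x u v) ` \<U>" k] U assms(2) by auto
  have "G t x u v < k" if "v \<in> \<V>" for v
    using cSUP_upper[OF that G_bdd_above[of t u x]] u t by auto
  then show ?thesis using u by blast
qed

text \<open>The policy plays \<open>u0\<close> close to the position where the rate is supposed
  negative and a pointwise near-minimizer elsewhere. The first gains at least \<eta> per unit time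
  during a time h, up to an error of 2 \<omega>; the second loses at most 2 \<omega> per unit time.
  No information about where the motion goes after time \<tau> + h is needed.\<close>

lemma INF_SUP_G_nonneg:
  assumes \<tau>: "\<tau> \<in> {0..<T}"
  shows "(INF u\<in>\<U>. SUP v\<in>\<V>. G \<tau> w u v) \<ge> 0"
proof (rule ccontr)
  assume "\<not> ?thesis"
  then have neg: "(INF u\<in>\<U>. SUP v\<in>\<V>. G \<tau> w u v) < 0" by simp
  \<comment> \<open>A quarter of the gap: \<open>u0\<close> keeps the rate below - 2 \<eta> at the
    position itself, and one further \<eta> is spent on moving to nearby positions.\<close>
  define \<eta> where "\<eta> = - (INF u\<in>\<U>. SUP v\<in>\<V>. G \<tau> w u v) / 4"
  have \<eta>: "\<eta> > 0" using neg by (simp add: \<eta>_def)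
  have "(INF u\<in>\<U>. SUP v\<in>\<V>. G \<tau> w u v) < - 2 * \<eta>" using neg by (simp add: \<eta>_def)
  then obtain u0 where u0: "u0 \<in> \<U>" "\<And>v. v \<in> \<V> \<Longrightarrow> G \<tau> w u0 v < - 2 * \<eta>"
    using ex_control_G_le[OF \<tau>] by blast
  define C where "C = c * (1 + radius w)"
  have C: "C \<ge> 0" using c_pos radius_nonneg[of w] by (simp add: C_def)
  define R where "R = norm w + radius w"
  have wR: "norm w \<le> R" using radius_nonneg[of w] by (simp add: R_def)
  obtain \<rho>1 where \<rho>1: "\<rho>1 > 0" "\<And>t t' x x' u v. \<lbrakk>t \<in> {0..T}; t' \<in> {0..T}; norm x \<le> R; norm x' \<le> R;
     \<bar>t - t'\<bar> + norm (x - x') < \<rho>1; u \<in> \<U>; v \<in> \<V>\<rbrakk> \<Longrightarrow> \<bar>G t x u v - G t' x' u v\<bar> < \<eta>"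
    using game_rate_uniform[OF W'_cont \<eta>, of R] by metis
  define h where "h = min (T - \<tau>) (\<rho>1 / (2 * (1 + C)))"
  have h: "h > 0" "\<tau> + h \<le> T" using \<tau> \<rho>1(1) C by (auto simp: h_def min_def)
  have "h * (1 + C) \<le> \<rho>1 / (2 * (1 + C)) * (1 + C)" using C by (intro mult_right_mono) (auto simp: h_def)
  also have "\<dots> < \<rho>1" using \<rho>1(1) C by (simp add: field_simps add_pos_nonneg)
  finally have h\<rho>: "h * (1 + C) < \<rho>1" .
  \<comment> \<open>Chosen so that the loss \<open>2 * \<omega>\<close> per unit time over the whole
    horizon is at most half of the gain \<open>\<eta> * h\<close>.\<close>
  define \<omega> where "\<omega> = \<eta> * h / (4 * T)"
  have \<omega>: "\<omega> > 0" using \<eta> h T_pos by (simp add: \<omega>_def)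
  obtain \<rho>2 where \<rho>2: "\<rho>2 > 0" "\<And>t t' x x' u v. \<lbrakk>t \<in> {0..T}; t' \<in> {0..T}; norm x \<le> R; norm x' \<le> R;
     \<bar>t - t'\<bar> + norm (x - x') < \<rho>2; u \<in> \<U>; v \<in> \<V>\<rbrakk> \<Longrightarrow> \<bar>G t x u v - G t' x' u v\<bar> < \<omega>"
    using game_rate_uniform[OF W'_cont \<omega>, of R] by metis
  \<comment> \<open>Within a cell of this length, time and position move by less than \<rho>2 in
    total, so the rate differs by less than \<omega> from its value at the partition point where the
    control was chosen.\<close>
  define \<delta> where "\<delta> = \<rho>2 / (2 * (1 + C))"
  have \<delta>: "\<delta> > 0" "\<delta> * (1 + C) < \<rho>2" using \<rho>2(1) C by (auto simp: \<delta>_def field_simps add_pos_nonneg)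
  have "\<exists>u\<in>\<U>. \<forall>v\<in>\<V>. G t x u v < \<omega>" if "t \<in> {0..<T}" for t x
    by (rule ex_control_G_le[OF that]) (use INF_SUP_G_nonpos[OF that, of x] \<omega> in linarith)
  then obtain p where p: "\<And>t x. t \<in> {0..<T} \<Longrightarrow> p t x \<in> \<U>"
     "\<And>t x v. t \<in> {0..<T} \<Longrightarrow> v \<in> \<V> \<Longrightarrow> G t x (p t x) v < \<omega>"
    by metis
  define \<pi> where "\<pi> t x = (if \<bar>t - \<tau>\<bar> + norm (x - w) < \<rho>1 \<or> t \<notin> {0..<T} then u0 else p t x)" for t x
  have \<pi>: "\<pi> \<in> policies T \<U>" using p(1) u0(1) by (auto simp: policies_def \<pi>_def)
  have "Sup (costs \<pi> \<tau> w \<delta>) \<le> val \<tau> w - \<eta> * h / 2"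
  proof (rule cSup_least[OF costs_nonempty[OF \<tau> \<pi> \<delta>(1)]])
    fix j assume "j \<in> costs \<pi> \<tau> w \<delta>"
    then obtain m t u v x where j: "j = cost f0 \<sigma> \<tau> T u v x" and g: "guided \<pi> \<tau> T m t u v x"
      and mesh: "mesh m t \<le> \<delta>" and x: "x \<tau> = w"
      unfolding policy_costs_eq by auto
    have tp: "time_partition \<tau> T m t" using g by (simp add: guided_def)
    have \<tau>T: "0 \<le> \<tau>" "T \<le> T" using \<tau> by auto
    \<comment> \<open>Of the two \<omega>, one pays for freezing the position at the partition point
      and the other for the inexact minimization by p.\<close>
    let ?K = "\<lambda>s. 2 * \<omega> + (if s \<le> \<tau> + h then - \<eta> else 0)"
    have K: "(?K has_integral (2 * \<omega> * (T - \<tau>) - \<eta> * h)) {\<tau>..T}"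
    proof -
      have "((\<lambda>s. if s \<le> \<tau> + h then - \<eta> else 0) has_integral (- \<eta> * h)) {\<tau>..\<tau> + h}"
        using has_integral_const_real[of "- \<eta>" \<tau> "\<tau> + h"] h
        by (subst has_integral_cong[where g = "\<lambda>_. - \<eta>"]) (auto simp: mult.commute)
      moreover have "((\<lambda>s. if s \<le> \<tau> + h then - \<eta> else 0) has_integral 0) {\<tau> + h..T}"
        by (rule has_integral_spike[of "{\<tau> + h}" _ _ "\<lambda>_. 0"]) auto
      ultimately have "((\<lambda>s. if s \<le> \<tau> + h then - \<eta> else 0) has_integral (- \<eta> * h + 0)) {\<tau>..T}"
        by (rule has_integral_combine[rotated 2]) (use h in auto)
      then have "((\<lambda>s. if s \<le> \<tau> + h then - \<eta> else 0) has_integral (- \<eta> * h)) {\<tau>..T}" by simp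
      moreover have "((\<lambda>s. 2 * \<omega>) has_integral (2 * \<omega> * (T - \<tau>))) {\<tau>..T}"
        using has_integral_const_real[of "2 * \<omega>" \<tau> T] \<tau> by (simp add: mult.commute)
      ultimately have "(?K has_integral (2 * \<omega> * (T - \<tau>) + - \<eta> * h)) {\<tau>..T}"
        by (intro has_integral_add)
      then show ?thesis by simp
    qed
    have "val T (x T) - val \<tau> (x \<tau>) + (LINT s|lebesgue_on {\<tau>..T}. f0 s (x s) (u s) (v s))
        \<le> 2 * \<omega> * (T - \<tau>) - \<eta> * h"
    proof (rule has_integral_le_negligible[OF guided_G_has_integral[OF g \<pi> \<tau>T] K])
      show "negligible {T}" by simp
      fix s assume s: "s \<in> {\<tau>..T} - {T}"
      then obtain i where i: "i \<le> m" "s \<in> {t i..<t (Suc i)}"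
        using time_partition_cover[OF tp, of s] by auto
      have ti: "t i \<in> {\<tau>..<T}" by (rule time_partition_range_less[OF tp i(1)])
      have us: "u s = \<pi> (t i) (x (t i))" "u s \<in> \<U>"
        using g i guided_u[OF g \<pi> \<tau>T, of s] s by (auto simp: guided_def)
      have vs: "v s \<in> \<V>" using g s by (auto simp: guided_def control_def)
      have xR: "norm (x r) \<le> R" if "r \<in> {\<tau>..T}" for r
        using guided_bounded[OF g \<pi> \<tau>T that] x by (simp add: R_def add_increasing)
      have "norm (x s - x (t i)) \<le> C * (s - t i)"
        using guided_tail_speed[OF g \<pi> \<tau>T, of "t i" s] ti i s x by (auto simp: C_def)
      then have "\<bar>s - t i\<bar> + norm (x s - x (t i)) \<le> (s - t i) * (1 + C)"
        using i by (simp add: algebra_simps)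
      also have "\<dots> \<le> \<delta> * (1 + C)"
        using i mesh C by (intro mult_right_mono) (auto simp: mesh_le_iff step_def intro: order_trans)
      also note \<delta>(2)
      finally have "\<bar>G s (x s) (u s) (v s) - G (t i) (x (t i)) (u s) (v s)\<bar> < \<omega>"
        using s ti \<tau> by (intro \<rho>2(2) xR us vs) auto
      then have 1: "G s (x s) (u s) (v s) < G (t i) (x (t i)) (u s) (v s) + \<omega>" by linarith
      have near: "G (t i) (x (t i)) (u s) (v s) < - \<eta>" if "\<bar>t i - \<tau>\<bar> + norm (x (t i) - w) < \<rho>1"
      proof -
        have eq: "u s = u0" using that us by (simp add: \<pi>_def)
        have "\<bar>G (t i) (x (t i)) u0 (v s) - G \<tau> w u0 (v s)\<bar> < \<eta>"
          using that ti \<tau> by (intro \<rho>1(2) xR wR u0(1) vs) auto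
        then show ?thesis unfolding eq using u0(2)[OF vs] by argo
      qed
      \<comment> \<open>This holds whether or not the position is close to w: near it the rate is
        even negative, elsewhere p keeps it below \<omega>. Hence it serves for all times after
        \<tau> + h.\<close>
      have far: "G (t i) (x (t i)) (u s) (v s) < \<omega>"
      proof (cases "\<bar>t i - \<tau>\<bar> + norm (x (t i) - w) < \<rho>1")
        case True
        then show ?thesis using near \<omega> \<eta> by linarith
      next
        case False
        then have "u s = p (t i) (x (t i))" using us ti \<tau> by (simp add: \<pi>_def)
        then show ?thesis using p(2)[of "t i" "v s" "x (t i)"] ti \<tau> vs by auto
      qed
      \<comment> \<open>The partition point \<open>t i\<close> precedes s, so it also lies within
        time h of \<tau>, and the speed bound places the position there in the region where the
        policy plays \<open>u0\<close>.\<close>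
      have early: "G (t i) (x (t i)) (u s) (v s) < - \<eta>" if "s \<le> \<tau> + h"
      proof (rule near)
        have "norm (x (t i) - w) \<le> C * (t i - \<tau>)"
          using guided_speed[OF g \<pi> \<tau>T, of "t i"] ti x by (simp add: C_def)
        then have "\<bar>t i - \<tau>\<bar> + norm (x (t i) - w) \<le> (t i - \<tau>) * (1 + C)"
          using ti by (simp add: algebra_simps)
        also have "\<dots> \<le> h * (1 + C)" using that i C by (intro mult_right_mono) auto
        also note h\<rho>
        finally show "\<bar>t i - \<tau>\<bar> + norm (x (t i) - w) < \<rho>1" .
      qed
      show "G s (x s) (u s) (v s) \<le> ?K s"
        using 1 far early \<omega> by (cases "s \<le> \<tau> + h") auto
    qed
    also have "\<dots> \<le> - \<eta> * h / 2"
    proof -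
      have "2 * \<omega> * (T - \<tau>) \<le> 2 * \<omega> * T" using \<omega> \<tau> by (intro mult_left_mono) auto
      also have "\<dots> = \<eta> * h / 2" using T_pos by (simp add: \<omega>_def)
      finally show ?thesis by simp
    qed
    finally show "j \<le> val \<tau> w - \<eta> * h / 2"
      unfolding j cost_def using x by (simp add: game_value_terminal)
  qed
  then have "val \<tau> w \<le> val \<tau> w - \<eta> * h / 2"
    using game_value_le[OF \<tau> \<pi>, of w] policy_value_le_Sup[OF \<tau> \<pi> \<delta>(1), of w] by linarith
  moreover have "\<eta> * h > 0" using \<eta> h by simp
  ultimately show False by linarith
qed

lemma Hamilton_Jacobi_Isaacs:
  assumes "t \<in> {0..<T}"
  shows "(INF u\<in>\<U>. SUP v\<in>\<V>. G t x u v) = 0" "(SUP v\<in>\<V>. INF u\<in>\<U>. G t x u v) = 0"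
proof -
  show "(INF u\<in>\<U>. SUP v\<in>\<V>. G t x u v) = 0"
    by (rule order_antisym[OF INF_SUP_G_nonpos[OF assms] INF_SUP_G_nonneg[OF assms]])
  then show "(SUP v\<in>\<V>. INF u\<in>\<U>. G t x u v) = 0"
    using G_Isaacs[of t x] assms by auto
qed

end

section \<open>The discrete-time game\<close>

context differential_game
begin

text \<open>Discrete Gronwall estimate: each step multiplies 1 plus the norm by at most 1 + c h,
  hence by at most exp (c h), and the exponents add up to the elapsed time. The bound is the same
  for all partitions and determines the compact set D in the second claim.\<close>

lemma discrete_motion_bounded:
  assumes tp: "time_partition \<tau> T m t" and \<tau>: "0 \<le> \<tau>" and xs: "discrete_motion f m t 0 w u v xs"
    and uv: "\<And>j. j \<le> m \<Longrightarrow> u j \<in> \<U> \<and> v j \<in> \<V>" and "k \<le> Suc m"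
  shows "norm (xs k) \<le> (1 + norm w) * exp (c * T)"
proof -
  have "1 + norm (xs k) \<le> (1 + norm w) * exp (c * (t k - \<tau>))"
    using \<open>k \<le> Suc m\<close>
  proof (induction k)
    case 0
    then show ?case using xs tp by (simp add: discrete_motion_def time_partition_def)
  next
    case (Suc k)
    have tk: "t k \<in> {0..T}" "0 < step t k"
      using time_partition_range[OF tp, of k] Suc.prems \<tau> tp by (auto simp: time_partition_def step_def)
    have "xs (Suc k) = xs k + step t k *\<^sub>R f (t k) (xs k) (u k) (v k)"
      using xs Suc.prems by (simp add: discrete_motion_def)
    then have "norm (xs (Suc k)) \<le> norm (xs k) + step t k * norm (f (t k) (xs k) (u k) (v k))"
      using tk(2) norm_triangle_ineq[of "xs k" "step t k *\<^sub>R f (t k) (xs k) (u k) (v k)"] by simp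
    also have "\<dots> \<le> norm (xs k) + step t k * (c * (1 + norm (xs k)))"
      using tk uv[of k] Suc.prems by (intro add_left_mono mult_left_mono growth_f) auto
    finally have "1 + norm (xs (Suc k)) \<le> (1 + norm (xs k)) * (1 + c * step t k)"
      by (simp add: algebra_simps)
    also have "\<dots> \<le> (1 + norm (xs k)) * exp (c * step t k)"
      by (intro mult_left_mono exp_ge_add_one_self) auto
    also have "\<dots> \<le> ((1 + norm w) * exp (c * (t k - \<tau>))) * exp (c * step t k)"
      using Suc by (intro mult_right_mono) auto
    also have "\<dots> = (1 + norm w) * exp (c * (t (Suc k) - \<tau>))"
      by (simp add: mult.assoc flip: exp_add) (simp add: step_def algebra_simps)
    finally show ?case .
  qed
  also have "\<dots> \<le> (1 + norm w) * exp (c * T)"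
    using time_partition_range[OF tp \<open>k \<le> Suc m\<close>] \<tau> c_pos by (intro mult_left_mono) auto
  finally show ?thesis by simp
qed

text \<open>Splits the deviation of the discrete cost from the value into one-step errors, using
  that the value at time T is the terminal cost.\<close>

lemma discrete_cost_telescope:
  assumes "time_partition \<tau> T m t" "xs 0 = w"
  shows "discrete_cost f0 \<sigma> m t 0 u v xs - val \<tau> w =
    (\<Sum>j=0..m. step t j * f0 (t j) (xs j) (u j) (v j) + val (t (Suc j)) (xs (Suc j)) - val (t j) (xs j))"
proof -
  have "(\<Sum>j=0..m. val (t (Suc j)) (xs (Suc j)) - val (t j) (xs j)) = val T (xs (Suc m)) - val \<tau> w"
    using assms sum_Suc_diff[of 0 m "\<lambda>j. val (t j) (xs j)"] by (simp add: time_partition_def)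
  then show ?thesis
    by (simp add: discrete_cost_def game_value_terminal sum.distrib sum_subtractf)
qed

lemma sum_steps:
  assumes "time_partition \<tau> T m t"
  shows "(\<Sum>j=0..m. step t j * \<epsilon>) = (T - \<tau>) * \<epsilon>"
  using assms sum_Suc_diff[of 0 m t]
  by (simp add: time_partition_def step_def sum_distrib_right[symmetric])

end

section \<open>The action-value function built from the value and its rate\<close>

context smooth_differential_game
begin

text \<open>The argument s is a time, whereas the step length belongs to an index;
  \<open>inv_into\<close> recovers the index, which is unique as partitions are strictly increasing.
  The terminal case comes first because no step follows T.\<close>

definition Q_function :: "nat \<Rightarrow> (nat \<Rightarrow> real) \<Rightarrow> real \<Rightarrow> real^'n \<Rightarrow> real^'k \<Rightarrow> real^'l \<Rightarrow> real" where
  "Q_function m t s x u v =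
     (if s = t (Suc m) then \<sigma> x else val s x + step t (inv_into {..Suc m} t s) * G s x u v)"

lemma Q_function_last: "Q_function m t (t (Suc m)) x u v = \<sigma> x"
  by (simp add: Q_function_def)

lemma Q_function_at:
  assumes tp: "time_partition \<tau> T m t" and "i \<le> m"
  shows "Q_function m t (t i) x u v = val (t i) x + step t i * G (t i) x u v"
proof -
  have "inj_on t {..Suc m}"
    using time_partition_strict_mono[OF tp] by (intro linorder_inj_onI) (auto simp: less_imp_neq)
  then have "inv_into {..Suc m} t (t i) = i" using \<open>i \<le> m\<close> by (intro inv_into_f_f) auto
  moreover have "t i \<noteq> t (Suc m)" using time_partition_strict_mono[OF tp, of i "Suc m"] \<open>i \<le> m\<close> by auto
  ultimately show ?thesis by (simp add: Q_function_def)
qed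

text \<open>The Hamilton--Jacobi--Isaacs equation makes the minimax of the rate vanish in both
  orders, leaving the value. At the terminal time both sides are the terminal cost, so T itself
  never enters the equation.\<close>

lemma Q_function_minmax:
  assumes tp: "time_partition \<tau> T m t" and \<tau>: "0 \<le> \<tau>" and "i \<le> Suc m"
  shows "(INF u\<in>\<U>. SUP v\<in>\<V>. Q_function m t (t i) x u v) = val (t i) x"
    and "(SUP v\<in>\<V>. INF u\<in>\<U>. Q_function m t (t i) x u v) = val (t i) x"
proof -
  have "(INF u\<in>\<U>. SUP v\<in>\<V>. Q_function m t (t i) x u v) = val (t i) x \<and>
    (SUP v\<in>\<V>. INF u\<in>\<U>. Q_function m t (t i) x u v) = val (t i) x"
  proof (cases "i = Suc m")
    case True
    then have "Q_function m t (t i) x u v = \<sigma> x" "val (t i) x = \<sigma> x" for u v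
      using tp Q_function_last[of m t] by (auto simp: game_value_terminal time_partition_def)
    then show ?thesis using U V by simp
  next
    case False
    then have i: "i \<le> m" using assms by auto
    have ti: "t i \<in> {0..<T}" "t i \<in> {0..T}" using time_partition_range_less[OF tp i] \<tau> by auto
    have h: "0 \<le> step t i" using tp i by (simp add: time_partition_def step_def less_imp_le)
    obtain B where B: "\<And>u v. u \<in> \<U> \<Longrightarrow> v \<in> \<V> \<Longrightarrow> \<bar>G (t i) x u v\<bar> \<le> B"
      using game_rate_bounded[OF W'_cont ti(2)] by blast
    show ?thesis
      by (simp only: Q_function_at[OF tp i] INF_SUP_affine[OF U(2) V(2) B h]
          SUP_INF_affine[OF U(2) V(2) B h] Hamilton_Jacobi_Isaacs[OF ti(1)]) simp
  qed
  then show "(INF u\<in>\<U>. SUP v\<in>\<V>. Q_function m t (t i) x u v) = val (t i) x"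
    "(SUP v\<in>\<V>. INF u\<in>\<U>. Q_function m t (t i) x u v) = val (t i) x" by auto
qed

lemma continuous_on_val: "continuous_on ({0..T} \<times> UNIV) (\<lambda>(\<tau>, w). val \<tau> w)"
  by (rule has_derivative_continuous_on[OF W'_deriv])

lemma Q_function_continuous:
  assumes tp: "time_partition \<tau> T m t" and \<tau>: "0 \<le> \<tau>" and i: "i \<le> Suc m"
  shows "continuous_on (UNIV \<times> \<U> \<times> \<V>) (\<lambda>(x, u, v). Q_function m t (t i) x u v)"
proof (cases "i = Suc m")
  case True
  have "continuous_on (UNIV \<times> \<U> \<times> \<V>) (\<lambda>p. \<sigma> (fst p))"
    by (rule continuous_on_compose2[OF cont_\<sigma>]) (auto intro!: continuous_intros)
  then show ?thesis using True by (simp add: Q_function_last case_prod_unfold)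
next
  case False
  then have i': "i \<le> m" using i by auto
  have ti: "t i \<in> {0..T}" using time_partition_range[OF tp i] \<tau> by auto
  have "continuous_on (UNIV \<times> \<U> \<times> \<V>) (\<lambda>p. (\<lambda>(\<tau>, w). val \<tau> w) (t i, fst p))"
    by (rule continuous_on_compose2[OF continuous_on_val]) (use ti in \<open>auto intro!: continuous_intros\<close>)
  moreover have "continuous_on (UNIV \<times> \<U> \<times> \<V>) (\<lambda>p. (\<lambda>(t, x, u, v). G t x u v) (t i, p))"
    by (rule continuous_on_compose2[OF continuous_on_game_rate[OF W'_cont]])
       (use ti in \<open>auto intro!: continuous_intros\<close>)
  ultimately have "continuous_on (UNIV \<times> \<U> \<times> \<V>)
     (\<lambda>p. val (t i) (fst p) + step t i * G (t i) (fst p) (fst (snd p)) (snd (snd p)))"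
    by (auto simp: case_prod_unfold intro!: continuous_intros)
  then show ?thesis by (simp add: Q_function_at[OF tp i'] case_prod_unfold)
qed

text \<open>The time set is finite, so the domain is a finite union of closed slices with fixed
  time, and continuity on each slice is enough.\<close>

lemma admissible_Q_function:
  assumes tp: "time_partition \<tau> T m t" and \<tau>: "0 \<le> \<tau>"
  shows "admissible_Q \<U> \<V> \<sigma> m t (Q_function m t)"
  unfolding admissible_Q_def
proof
  have "points m t \<times> (UNIV :: (real^'n) set) \<times> \<U> \<times> \<V> = (\<Union>i\<in>{..Suc m}. {t i} \<times> UNIV \<times> \<U> \<times> \<V>)"
    by (auto simp: points_def)
  moreover have "continuous_on (\<Union>i\<in>{..Suc m}. {t i} \<times> (UNIV :: (real^'n) set) \<times> \<U> \<times> \<V>) (\<lambda>(s, x, u, v). Q_function m t s x u v)"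
  proof (rule continuous_on_closed_Union)
    fix i assume i: "i \<in> {..Suc m}"
    show "closed ({t i} \<times> (UNIV :: (real^'n) set) \<times> \<U> \<times> \<V>)"
      using U V by (intro closed_Times) (auto intro: compact_imp_closed)
    have "continuous_on ({t i} \<times> UNIV \<times> \<U> \<times> \<V>) (\<lambda>p. (\<lambda>(x, u, v). Q_function m t (t i) x u v) (snd p))"
      by (rule continuous_on_compose2[OF Q_function_continuous[OF tp \<tau>]])
         (use i in \<open>auto intro!: continuous_intros\<close>)
    then show "continuous_on ({t i} \<times> UNIV \<times> \<U> \<times> \<V>) (\<lambda>(s, x, u, v). Q_function m t s x u v)"
      by (rule continuous_on_eq) auto
  qed auto
  ultimately show "continuous_on (points m t \<times> UNIV \<times> \<U> \<times> \<V>) (\<lambda>(s, x, u, v). Q_function m t s x u v)"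
    by simp
qed (simp add: Q_function_last)

text \<open>A first-order expansion of the value in the direction (1, f) with an error that is
  uniform on bounded sets: on a compact set the derivative is uniformly continuous, and the
  increment has length at most h (1 + C). The derivative term combines with the running cost to the
  rate.\<close>

lemma val_one_step:
  assumes "\<epsilon> > 0" "0 \<le> R"
  obtains \<delta> where "\<delta> > 0" "\<And>s h x u v. \<lbrakk>0 \<le> s; 0 \<le> h; s + h \<le> T; h \<le> \<delta>; norm x \<le> R; u \<in> \<U>; v \<in> \<V>\<rbrakk> \<Longrightarrow>
     \<bar>val s x + h * G s x u v - h * f0 s x u v - val (s + h) (x + h *\<^sub>R f s x u v)\<bar> \<le> h * \<epsilon>"
proof -
  define C where "C = c * (1 + R)"
  have C: "C \<ge> 0" using c_pos assms by (simp add: C_def)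
  \<comment> \<open>The ball is enlarged by the maximal displacement in time T, so that the Euler
    step from a point of norm at most R also lies in K.\<close>
  define K where "K = {0..T} \<times> cball (0::real^'n) (R + C * T)"
  have K: "compact K" "convex K" "K \<subseteq> {0..T} \<times> UNIV"
    unfolding K_def by (auto intro!: compact_Times convex_Times)
  have "uniformly_continuous_on K W'"
    by (intro compact_uniformly_continuous continuous_on_subset[OF W'_cont] K)
  moreover have e: "\<epsilon> / (1 + C) > 0" using assms C by simp
  ultimately obtain \<rho> where \<rho>: "\<rho> > 0" "\<And>p q. \<lbrakk>p \<in> K; q \<in> K; dist q p < \<rho>\<rbrakk> \<Longrightarrow> dist (W' q) (W' p) < \<epsilon> / (1 + C)"
    unfolding uniformly_continuous_on_def by metis
  show ?thesis
  proof (rule that[of "\<rho> / (2 * (1 + C))"])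
    show "\<rho> / (2 * (1 + C)) > 0" using \<rho>(1) C by simp
    fix s h :: real and x :: "real^'n" and u v
    assume *: "0 \<le> s" "0 \<le> h" "s + h \<le> T" "h \<le> \<rho> / (2 * (1 + C))" "norm x \<le> R" "u \<in> \<U>" "v \<in> \<V>"
    define k where "k = f s x u v"
    have "norm k \<le> c * (1 + norm x)" unfolding k_def using * by (intro growth_f) auto
    also have "\<dots> \<le> C" unfolding C_def using * c_pos by (intro mult_left_mono) auto
    finally have k: "norm k \<le> C" .
    define p q where "p = (s, x)" and "q = (s + h, x + h *\<^sub>R k)"
    have qp: "q - p = h *\<^sub>R (1, k)" by (simp add: p_def q_def)
    have "norm (1::real, k) \<le> 1 + C" using norm_Pair_le[of "1::real" k] k by simp
    then have nqp: "norm (q - p) \<le> h * (1 + C)"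
      unfolding qp norm_scaleR using *(2) by (simp add: mult_left_mono)
    also have "\<dots> \<le> \<rho> / (2 * (1 + C)) * (1 + C)" using *(4) C by (intro mult_right_mono) auto
    also have "\<dots> < \<rho>" using \<rho>(1) C by (simp add: field_simps add_pos_nonneg)
    finally have near: "norm (q - p) < \<rho>" .
    \<comment> \<open>A convex set containing both end points, on which the derivative differs from
      that at p by at most \<epsilon> / (1 + C).\<close>
    define S where "S = K \<inter> ball p \<rho>"
    have "norm x \<le> R + C * T" using * C T_pos by (simp add: add_increasing2)
    then have pS: "p \<in> S" using * \<rho>(1) by (auto simp: S_def K_def p_def)
    have "norm (x + h *\<^sub>R k) \<le> R + C * T"
    proof -
      have "norm (x + h *\<^sub>R k) \<le> norm x + norm (h *\<^sub>R k)" by (rule norm_triangle_ineq)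
      moreover have "norm (h *\<^sub>R k) \<le> T * C" using * k by (simp add: mult_mono)
      ultimately show ?thesis using *(5) by (simp add: mult.commute)
    qed
    moreover have "dist p q < \<rho>" using near by (simp add: dist_norm norm_minus_commute)
    ultimately have qS: "q \<in> S" using * by (auto simp: S_def K_def q_def)
    have cS: "convex S" unfolding S_def by (intro convex_Int K convex_ball)
    let ?W = "\<lambda>(\<tau>, w). val \<tau> w"
    have "norm (?W q - ?W p - W' p (q - p)) \<le> norm (q - p) * (\<epsilon> / (1 + C))"
    proof (rule differentiable_bound_linearization[OF _ _ _ pS])
      fix r :: real assume "r \<in> {0..1}"
      then show "p + r *\<^sub>R (q - p) \<in> S"
        using convexD_alt[OF cS pS qS, of r] by (simp add: algebra_simps)
    next
      fix y assume y: "y \<in> S"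
      then show "(?W has_derivative blinfun_apply (W' y)) (at y within S)"
        by (intro has_derivative_subset[OF W'_deriv]) (use K in \<open>auto simp: S_def\<close>)
      have "onorm (blinfun_apply (W' y) - blinfun_apply (W' p)) = norm (W' y - W' p)"
        by (simp add: norm_blinfun.rep_eq minus_blinfun.rep_eq fun_diff_def)
      also have "\<dots> \<le> \<epsilon> / (1 + C)"
        using \<rho>(2)[of p y] y pS by (simp add: S_def dist_norm dist_commute less_imp_le norm_minus_commute)
      finally show "onorm (blinfun_apply (W' y) - blinfun_apply (W' p)) \<le> \<epsilon> / (1 + C)" .
    qed
    also have "\<dots> \<le> h * (1 + C) * (\<epsilon> / (1 + C))"
      using nqp e by (intro mult_right_mono) auto
    also have "\<dots> = h * \<epsilon>" using C by (simp add: add_nonneg_eq_0_iff)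
    finally have "\<bar>val (s + h) (x + h *\<^sub>R k) - val s x - W' p (q - p)\<bar> \<le> h * \<epsilon>"
      by (simp add: p_def q_def)
    moreover have "W' p (q - p) = h * G s x u v - h * f0 s x u v"
      unfolding qp blinfun.scaleR_right by (simp add: game_rate_def p_def k_def algebra_simps)
    ultimately show "\<bar>val s x + h * G s x u v - h * f0 s x u v - val (s + h) (x + h *\<^sub>R f s x u v)\<bar> \<le> h * \<epsilon>"
      unfolding k_def by (simp add: abs_le_iff)
  qed
qed

lemma Q_function_one_step:
  assumes "\<epsilon> > 0" "0 \<le> R"
  obtains \<delta> where "\<delta> > 0" "\<And>\<tau> m t i x u v. \<lbrakk>0 \<le> \<tau>; time_partition \<tau> T m t; mesh m t \<le> \<delta>; i \<le> m;
      norm x \<le> R; u \<in> \<U>; v \<in> \<V>\<rbrakk> \<Longrightarrow>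
     \<bar>Q_function m t (t i) x u v - step t i * f0 (t i) x u v
        - val (t (Suc i)) (x + step t i *\<^sub>R f (t i) x u v)\<bar> \<le> step t i * \<epsilon>"
proof -
  obtain \<delta> where \<delta>: "\<delta> > 0" "\<And>s h x u v. \<lbrakk>0 \<le> s; 0 \<le> h; s + h \<le> T; h \<le> \<delta>; norm x \<le> R; u \<in> \<U>; v \<in> \<V>\<rbrakk> \<Longrightarrow>
     \<bar>val s x + h * G s x u v - h * f0 s x u v - val (s + h) (x + h *\<^sub>R f s x u v)\<bar> \<le> h * \<epsilon>"
    using val_one_step[OF assms] by blast
  show ?thesis
  proof (rule that[OF \<delta>(1)])
    fix \<tau> :: real and m t i and x :: "real^'n" and u v
    assume *: "0 \<le> \<tau>" "time_partition \<tau> T m t" "mesh m t \<le> \<delta>" "i \<le> m" "norm x \<le> R" "u \<in> \<U>" "v \<in> \<V>"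
    have "0 \<le> t i" "t (Suc i) \<le> T" "t i < t (Suc i)" "step t i \<le> \<delta>"
      using time_partition_range[OF *(2), of i] time_partition_range[OF *(2), of "Suc i"] * 
      by (auto simp: time_partition_def mesh_le_iff)
    then show "\<bar>Q_function m t (t i) x u v - step t i * f0 (t i) x u v
        - val (t (Suc i)) (x + step t i *\<^sub>R f (t i) x u v)\<bar> \<le> step t i * \<epsilon>"
      using \<delta>(2)[of "t i" "step t i" x u v] * by (simp add: Q_function_at[OF *(2,4)] step_def)
  qed
qed

lemma Q_function_bounded:
  assumes tp: "time_partition \<tau> T m t" and \<tau>: "0 \<le> \<tau>" and i: "i \<le> Suc m"
  obtains B where "\<And>u v. u \<in> \<U> \<Longrightarrow> v \<in> \<V> \<Longrightarrow> \<bar>Q_function m t (t i) x u v\<bar> \<le> B"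
proof -
  have "compact ({x} \<times> \<U> \<times> \<V>)" using U V by (intro compact_Times) auto
  moreover have "continuous_on ({x} \<times> \<U> \<times> \<V>) (\<lambda>(x, u, v). Q_function m t (t i) x u v)"
    by (rule continuous_on_subset[OF Q_function_continuous[OF assms]]) auto
  ultimately have "bounded ((\<lambda>(x, u, v). Q_function m t (t i) x u v) ` ({x} \<times> \<U> \<times> \<V>))"
    using compact_continuous_image compact_imp_bounded by blast
  then show ?thesis using that unfolding bounded_iff by fastforce
qed

text \<open>A minimizer of the maximum attains the min-max, which equals the value; so the bound
  holds against every v of the opponent.\<close>

lemma Q_function_arg_min_le:
  assumes tp: "time_partition \<tau> T m t" and \<tau>: "0 \<le> \<tau>" and i: "i \<le> m" and v: "v \<in> \<V>"
    and min: "is_arg_min (\<lambda>u. SUP v\<in>\<V>. Q_function m t (t i) x u v) (\<lambda>u. u \<in> \<U>) u"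
  shows "Q_function m t (t i) x u v \<le> val (t i) x"
proof -
  have i': "i \<le> Suc m" using i by simp
  obtain B where B: "\<And>u v. u \<in> \<U> \<Longrightarrow> v \<in> \<V> \<Longrightarrow> \<bar>Q_function m t (t i) x u v\<bar> \<le> B"
    using Q_function_bounded[OF tp \<tau> i'] by blast
  have u: "u \<in> \<U>" using min by (simp add: is_arg_min_def)
  have "Q_function m t (t i) x u v \<le> (SUP v\<in>\<V>. Q_function m t (t i) x u v)"
    by (rule cSUP_upper[OF v]) (use B[OF u] in \<open>auto intro!: bdd_aboveI[of _ B] simp: abs_le_iff\<close>)
  also have "\<dots> \<le> (INF u\<in>\<U>. SUP v\<in>\<V>. Q_function m t (t i) x u v)"
    by (rule cINF_greatest[OF U(2)]) (use min in \<open>auto simp: is_arg_min_def not_less\<close>)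
  also have "\<dots> = val (t i) x" by (rule Q_function_minmax(1)[OF tp \<tau> i'])
  finally show ?thesis .
qed

lemma Q_function_arg_max_ge:
  assumes tp: "time_partition \<tau> T m t" and \<tau>: "0 \<le> \<tau>" and i: "i \<le> m" and u: "u \<in> \<U>"
    and max: "is_arg_max (\<lambda>v. INF u\<in>\<U>. Q_function m t (t i) x u v) (\<lambda>v. v \<in> \<V>) v"
  shows "val (t i) x \<le> Q_function m t (t i) x u v"
proof -
  have i': "i \<le> Suc m" using i by simp
  obtain B where B: "\<And>u v. u \<in> \<U> \<Longrightarrow> v \<in> \<V> \<Longrightarrow> \<bar>Q_function m t (t i) x u v\<bar> \<le> B"
    using Q_function_bounded[OF tp \<tau> i'] by blast
  have v: "v \<in> \<V>" using max by (simp add: is_arg_max_def)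
  have "val (t i) x = (SUP v\<in>\<V>. INF u\<in>\<U>. Q_function m t (t i) x u v)"
    by (rule Q_function_minmax(2)[OF tp \<tau> i', symmetric])
  also have "\<dots> \<le> (INF u\<in>\<U>. Q_function m t (t i) x u v)"
    by (rule cSUP_least[OF V(2)]) (use max in \<open>auto simp: is_arg_max_def not_less\<close>)
  also have "\<dots> \<le> Q_function m t (t i) x u v"
    by (rule cINF_lower[OF _ u])
       (use B[OF _ v] in \<open>auto intro!: bdd_belowI[of _ "-B"] simp: abs_le_iff minus_le_iff\<close>)
  finally show ?thesis .
qed

text \<open>A single \<delta> serves the equations and both guarantees. Since the next minimax is
  the value, the approximate equations are the one-step estimate. Along a discrete motion, which
  stays in the ball of radius R, the optimal choice of one agent turns that estimate into a
  one-sided bound, and the errors sum to at most \<open>(T - \<tau>) * \<epsilon>\<close>.\<close>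

lemma Q_function_guarantees:
  assumes "\<epsilon> > 0" "0 \<le> R"
  obtains \<delta> where "\<delta> > 0" 
     "\<And>\<tau> m t D. \<lbrakk>0 \<le> \<tau>; time_partition \<tau> T m t; mesh m t \<le> \<delta>; D \<subseteq> cball 0 R\<rbrakk> \<Longrightarrow>
        approx_Isaacs_Bellman \<U> \<V> f f0 m t D \<epsilon> (Q_function m t)"
     "\<And>\<tau> m t \<pi> w. \<lbrakk>0 \<le> \<tau>; time_partition \<tau> T m t; mesh m t \<le> \<delta>; (1 + norm w) * exp (c * T) \<le> R;
         \<pi> \<in> discrete_policies m t \<U>;
         \<forall>s\<in>points m t. \<forall>x. is_arg_min (\<lambda>u. SUP v\<in>\<V>. Q_function m t s x u v) (\<lambda>u. u \<in> \<U>) (\<pi> s x)\<rbrakk> \<Longrightarrow>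
        discrete_result_u \<V> f f0 \<sigma> m t \<pi> 0 w \<le> val \<tau> w + \<epsilon> * T"
     "\<And>\<tau> m t \<pi> w. \<lbrakk>0 \<le> \<tau>; time_partition \<tau> T m t; mesh m t \<le> \<delta>; (1 + norm w) * exp (c * T) \<le> R;
         \<pi> \<in> discrete_policies m t \<V>;
         \<forall>s\<in>points m t. \<forall>x. is_arg_max (\<lambda>v. INF u\<in>\<U>. Q_function m t s x u v) (\<lambda>v. v \<in> \<V>) (\<pi> s x)\<rbrakk> \<Longrightarrow>
        discrete_result_v \<U> f f0 \<sigma> m t \<pi> 0 w \<ge> val \<tau> w - \<epsilon> * T"
proof -
  obtain \<delta> where \<delta>: "\<delta> > 0" and one_step: "\<And>\<tau> m t i x u v. \<lbrakk>0 \<le> \<tau>; time_partition \<tau> T m t; mesh m t \<le> \<delta>; i \<le> m;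
      norm x \<le> R; u \<in> \<U>; v \<in> \<V>\<rbrakk> \<Longrightarrow>
     \<bar>Q_function m t (t i) x u v - step t i * f0 (t i) x u v
        - val (t (Suc i)) (x + step t i *\<^sub>R f (t i) x u v)\<bar> \<le> step t i * \<epsilon>"
    using Q_function_one_step[OF assms] by blast
  show ?thesis
  proof (rule that[OF \<delta>])
    fix \<tau> m t and D :: "(real^'n) set"
    assume *: "0 \<le> \<tau>" "time_partition \<tau> T m t" "mesh m t \<le> \<delta>" "D \<subseteq> cball 0 R"
    show "approx_Isaacs_Bellman \<U> \<V> f f0 m t D \<epsilon> (Q_function m t)"
      unfolding approx_Isaacs_Bellman_def Let_def
    proof (intro allI impI ballI)
      fix i x u v assume "i \<le> m" "x \<in> D" "u \<in> \<U>" "v \<in> \<V>"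
      moreover from this have "norm x \<le> R" "Suc i \<le> Suc m" using *(4) by auto
      ultimately show "\<bar>Q_function m t (t i) x u v - step t i * f0 (t i) x u v -
          (INF u'\<in>\<U>. SUP v'\<in>\<V>. Q_function m t (t (Suc i)) (x + step t i *\<^sub>R f (t i) x u v) u' v')\<bar>
          \<le> step t i * \<epsilon> \<and>
         \<bar>Q_function m t (t i) x u v - step t i * f0 (t i) x u v -
          (SUP v'\<in>\<V>. INF u'\<in>\<U>. Q_function m t (t (Suc i)) (x + step t i *\<^sub>R f (t i) x u v) u' v')\<bar>
          \<le> step t i * \<epsilon>"
        using one_step[OF *(1-3)] by (simp only: Q_function_minmax[OF *(2,1)] simp_thms)
    qed
  next
    fix \<tau> m t and w :: "real^'n" and \<pi> :: "real \<Rightarrow> real^'n \<Rightarrow> real^'k"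
    assume *: "0 \<le> \<tau>" "time_partition \<tau> T m t" "mesh m t \<le> \<delta>" "(1 + norm w) * exp (c * T) \<le> R"
      and \<pi>: "\<pi> \<in> discrete_policies m t \<U>"
      and min: "\<forall>s\<in>points m t. \<forall>x. is_arg_min (\<lambda>u. SUP v\<in>\<V>. Q_function m t s x u v) (\<lambda>u. u \<in> \<U>) (\<pi> s x)"
    have pts: "t j \<in> points m t" if "j \<le> m" for j using that by (auto simp: points_def)
    show "discrete_result_u \<V> f f0 \<sigma> m t \<pi> 0 w \<le> val \<tau> w + \<epsilon> * T"
      unfolding discrete_result_u_def
    proof (rule cSup_least)
      obtain v0 where "v0 \<in> \<V>" using V by auto
      \<comment> \<open>The motion against a constant \<open>v0\<close>; it shows that the supremum
        is over a nonempty set.\<close>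
      define xs where "xs = rec_nat w (\<lambda>j y. y + step t j *\<^sub>R f (t j) y (\<pi> (t j) y) v0)"
      have "discrete_motion f m t 0 w (\<lambda>j. \<pi> (t j) (xs j)) (\<lambda>_. v0) xs"
        by (simp add: discrete_motion_def xs_def)
      with \<open>v0 \<in> \<V>\<close> have "\<exists>u v xs. (\<forall>j\<in>{0..m}. v j \<in> \<V> \<and> u j = \<pi> (t j) (xs j)) \<and>
          discrete_motion f m t 0 w u v xs"
        by (intro exI[of _ "\<lambda>j. \<pi> (t j) (xs j)"] exI[of _ "\<lambda>_. v0"] exI[of _ xs]) simp
      then show "{discrete_cost f0 \<sigma> m t 0 u v xs |u v xs.
          (\<forall>j\<in>{0..m}. v j \<in> \<V> \<and> u j = \<pi> (t j) (xs j)) \<and> discrete_motion f m t 0 w u v xs} \<noteq> {}"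
        by simp
      fix J assume "J \<in> {discrete_cost f0 \<sigma> m t 0 u v xs |u v xs.
          (\<forall>j\<in>{0..m}. v j \<in> \<V> \<and> u j = \<pi> (t j) (xs j)) \<and> discrete_motion f m t 0 w u v xs}"
      then obtain u v xs where J: "J = discrete_cost f0 \<sigma> m t 0 u v xs"
        and uv: "\<And>j. j \<le> m \<Longrightarrow> v j \<in> \<V> \<and> u j = \<pi> (t j) (xs j)" and xs: "discrete_motion f m t 0 w u v xs"
        by auto
      have xs0: "xs 0 = w" using xs by (simp add: discrete_motion_def)
      have uU: "u j \<in> \<U>" if "j \<le> m" for j
        using uv[OF that] \<pi> pts[OF that] by (simp add: discrete_policies_def)
      have "J - val \<tau> w \<le> (\<Sum>j=0..m. step t j * \<epsilon>)"
        unfolding J discrete_cost_telescope[where xs = xs, OF *(2) xs0]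
      proof (rule sum_mono)
        fix j assume "j \<in> {0..m}"
        then have j: "j \<le> m" by simp
        have "norm (xs j) \<le> R"
          using discrete_motion_bounded[OF *(2,1) xs, of j] uU uv j *(4) by fastforce
        then have "\<bar>Q_function m t (t j) (xs j) (u j) (v j) - step t j * f0 (t j) (xs j) (u j) (v j)
            - val (t (Suc j)) (xs (Suc j))\<bar> \<le> step t j * \<epsilon>"
          using one_step[OF *(1-3) j, of "xs j" "u j" "v j"] uU uv j xs by (simp add: discrete_motion_def)
        moreover have "Q_function m t (t j) (xs j) (u j) (v j) \<le> val (t j) (xs j)"
          using Q_function_arg_min_le[OF *(2,1) j] uv[OF j] min pts[OF j] by metis
        ultimately show "step t j * f0 (t j) (xs j) (u j) (v j) + val (t (Suc j)) (xs (Suc j)) - val (t j) (xs j)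
            \<le> step t j * \<epsilon>" by linarith
      qed
      also have "\<dots> \<le> \<epsilon> * T"
        unfolding sum_steps[OF *(2)] using *(1) assms(1) by (simp add: algebra_simps)
      finally show "J \<le> val \<tau> w + \<epsilon> * T" by simp
    qed
  next
    fix \<tau> m t and w :: "real^'n" and \<pi> :: "real \<Rightarrow> real^'n \<Rightarrow> real^'l"
    assume *: "0 \<le> \<tau>" "time_partition \<tau> T m t" "mesh m t \<le> \<delta>" "(1 + norm w) * exp (c * T) \<le> R"
      and \<pi>: "\<pi> \<in> discrete_policies m t \<V>"
      and max: "\<forall>s\<in>points m t. \<forall>x. is_arg_max (\<lambda>v. INF u\<in>\<U>. Q_function m t s x u v) (\<lambda>v. v \<in> \<V>) (\<pi> s x)"
    have pts: "t j \<in> points m t" if "j \<le> m" for j using that by (auto simp: points_def)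
    show "val \<tau> w - \<epsilon> * T \<le> discrete_result_v \<U> f f0 \<sigma> m t \<pi> 0 w"
      unfolding discrete_result_v_def
    proof (rule cInf_greatest)
      obtain u0 where "u0 \<in> \<U>" using U by auto
      \<comment> \<open>The analogous motion for the second agent's policy against a constant
        \<open>u0\<close>.\<close>
      define xs where "xs = rec_nat w (\<lambda>j y. y + step t j *\<^sub>R f (t j) y u0 (\<pi> (t j) y))"
      have "discrete_motion f m t 0 w (\<lambda>_. u0) (\<lambda>j. \<pi> (t j) (xs j)) xs"
        by (simp add: discrete_motion_def xs_def)
      with \<open>u0 \<in> \<U>\<close> have "\<exists>u v xs. (\<forall>j\<in>{0..m}. u j \<in> \<U> \<and> v j = \<pi> (t j) (xs j)) \<and>
          discrete_motion f m t 0 w u v xs"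
        by (intro exI[of _ "\<lambda>_. u0"] exI[of _ "\<lambda>j. \<pi> (t j) (xs j)"] exI[of _ xs]) simp
      then show "{discrete_cost f0 \<sigma> m t 0 u v xs |u v xs.
          (\<forall>j\<in>{0..m}. u j \<in> \<U> \<and> v j = \<pi> (t j) (xs j)) \<and> discrete_motion f m t 0 w u v xs} \<noteq> {}"
        by simp
      fix J assume "J \<in> {discrete_cost f0 \<sigma> m t 0 u v xs |u v xs.
          (\<forall>j\<in>{0..m}. u j \<in> \<U> \<and> v j = \<pi> (t j) (xs j)) \<and> discrete_motion f m t 0 w u v xs}"
      then obtain u v xs where J: "J = discrete_cost f0 \<sigma> m t 0 u v xs"
        and uv: "\<And>j. j \<le> m \<Longrightarrow> u j \<in> \<U> \<and> v j = \<pi> (t j) (xs j)" and xs: "discrete_motion f m t 0 w u v xs"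
        by auto
      have xs0: "xs 0 = w" using xs by (simp add: discrete_motion_def)
      have vV: "v j \<in> \<V>" if "j \<le> m" for j
        using uv[OF that] \<pi> pts[OF that] by (simp add: discrete_policies_def)
      have "(\<Sum>j=0..m. step t j * (- \<epsilon>)) \<le> J - val \<tau> w"
        unfolding J discrete_cost_telescope[where xs = xs, OF *(2) xs0]
      proof (rule sum_mono)
        fix j assume "j \<in> {0..m}"
        then have j: "j \<le> m" by simp
        have "norm (xs j) \<le> R"
          using discrete_motion_bounded[OF *(2,1) xs, of j] vV uv j *(4) by fastforce
        then have "\<bar>Q_function m t (t j) (xs j) (u j) (v j) - step t j * f0 (t j) (xs j) (u j) (v j)
            - val (t (Suc j)) (xs (Suc j))\<bar> \<le> step t j * \<epsilon>"
          using one_step[OF *(1-3) j, of "xs j" "u j" "v j"] vV uv j xs by (simp add: discrete_motion_def)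
        moreover have "val (t j) (xs j) \<le> Q_function m t (t j) (xs j) (u j) (v j)"
          using Q_function_arg_max_ge[OF *(2,1) j] uv[OF j] max pts[OF j] by metis
        ultimately show "step t j * (- \<epsilon>) \<le>
            step t j * f0 (t j) (xs j) (u j) (v j) + val (t (Suc j)) (xs (Suc j)) - val (t j) (xs j)" by simp
      qed
      moreover have "- (\<epsilon> * T) \<le> (\<Sum>j=0..m. step t j * (- \<epsilon>))"
        unfolding sum_steps[OF *(2)] using *(1) assms(1) by (simp add: algebra_simps)
      ultimately show "val \<tau> w - \<epsilon> * T \<le> J" by simp
    qed
  qed
qed

text \<open>The derivative of the value is linear, so it splits along f. The direction of time, the
  value and the terminal cost do not involve v and are all assigned to the first summand.\<close>

lemma Q_function_separable:
  assumes tp: "time_partition \<tau> T m t" and \<tau>: "0 \<le> \<tau>"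
    and f: "\<And>t x u v. t \<in> {0..T} \<Longrightarrow> u \<in> \<U> \<Longrightarrow> v \<in> \<V> \<Longrightarrow> f t x u v = f1 t x u + f2 t x v"
    and f0: "\<And>t x u v. t \<in> {0..T} \<Longrightarrow> u \<in> \<U> \<Longrightarrow> v \<in> \<V> \<Longrightarrow> f0 t x u v = g1 t x u + g2 t x v"
  shows "\<exists>Q1 Q2. \<forall>s\<in>points m t. \<forall>x. \<forall>u\<in>\<U>. \<forall>v\<in>\<V>. Q_function m t s x u v = Q1 s x u + Q2 s x v"
proof -
  define h where "h s = step t (inv_into {..Suc m} t s)" for s
  define Q1 where "Q1 s x u = (if s = t (Suc m) then \<sigma> x else
    val s x + h s * (W' (s, x) (1, f1 s x u) + g1 s x u))" for s x u
  define Q2 where "Q2 s x v = (if s = t (Suc m) then 0 else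
    h s * (W' (s, x) (0, f2 s x v) + g2 s x v))" for s x v
  have "Q_function m t s x u v = Q1 s x u + Q2 s x v" if "s \<in> points m t" "u \<in> \<U>" "v \<in> \<V>" for s x u v
  proof -
    have "s \<in> {0..T}" using that(1) time_partition_range[OF tp] \<tau> unfolding points_def by fastforce
    moreover have "W' (s, x) (1, f1 s x u + f2 s x v) = W' (s, x) (1, f1 s x u) + W' (s, x) (0, f2 s x v)"
      by (simp add: blinfun.add_right[symmetric])
    ultimately show ?thesis
      using that by (simp add: Q_function_def Q1_def Q2_def h_def game_rate_def f f0 algebra_simps)
  qed
  then show ?thesis by blast
qed

end

section \<open>Choice of the compact sets and step bounds in the two claims\<close>

theorem theorem4p1:
  fixes T :: real
    and \<U> :: "(real^'k) set"
    and \<V> :: "(real^'l) set"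
    and f :: "real \<Rightarrow> real^'n \<Rightarrow> real^'k \<Rightarrow> real^'l \<Rightarrow> real^'n"
    and f0 :: "real \<Rightarrow> real^'n \<Rightarrow> real^'k \<Rightarrow> real^'l \<Rightarrow> real"
    and \<sigma> :: "real^'n \<Rightarrow> real"
  defines "V \<equiv> game_value T \<U> \<V> f f0 \<sigma>"
  assumes "T > 0"
    and "compact \<U>" "\<U> \<noteq> {}"
    and "compact \<V>" "\<V> \<noteq> {}"
    and "continuous_on UNIV \<sigma>"
    and "continuous_on ({0..T} \<times> UNIV \<times> \<U> \<times> \<V>) (\<lambda>(t, x, u, v). f t x u v)"
    and "continuous_on ({0..T} \<times> UNIV \<times> \<U> \<times> \<V>) (\<lambda>(t, x, u, v). f0 t x u v)"
    and linear_growth: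
      "\<exists>c>0. \<forall>t\<in>{0..T}. \<forall>x. \<forall>u\<in>\<U>. \<forall>v\<in>\<V>.
         norm (f t x u v) + \<bar>f0 t x u v\<bar> \<le> c * (1 + norm x)"
    and local_Lipschitz:
      "\<forall>\<alpha>>0. \<exists>L>0. \<forall>t\<in>{0..T}. \<forall>u\<in>\<U>. \<forall>v\<in>\<V>. \<forall>x y. max (norm x) (norm y) \<le> \<alpha> \<longrightarrow>
         norm (f t x u v - f t y u v) + \<bar>f0 t x u v - f0 t y u v\<bar> \<le> L * norm (x - y)"
    and Isaacs:
      "\<forall>t\<in>{0..T}. \<forall>x s.
         (INF u\<in>\<U>. SUP v\<in>\<V>. f t x u v \<bullet> s + f0 t x u v) =
         (SUP v\<in>\<V>. INF u\<in>\<U>. f t x u v \<bullet> s + f0 t x u v)"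
    and "continuously_differentiable_on (\<lambda>(\<tau>, w). V \<tau> w) ({0..T} \<times> UNIV)"
  shows
    "(\<forall>D \<epsilon>. compact D \<and> \<epsilon> > 0 \<longrightarrow>
       (\<exists>\<delta>>0. \<forall>\<tau>\<in>{0..<T}. \<forall>m t. time_partition \<tau> T m t \<and> mesh m t \<le> \<delta> \<longrightarrow>
         (\<exists>Q. admissible_Q \<U> \<V> \<sigma> m t Q \<and>
              approx_Isaacs_Bellman \<U> \<V> f f0 m t D \<epsilon> Q \<and>
              ((\<exists>f\<^sub>1 f\<^sub>2. \<forall>t\<in>{0..T}. \<forall>x. \<forall>u\<in>\<U>. \<forall>v\<in>\<V>. f t x u v = f\<^sub>1 t x u + f\<^sub>2 t x v) \<and>
               (\<exists>g\<^sub>1 g\<^sub>2. \<forall>t\<in>{0..T}. \<forall>x. \<forall>u\<in>\<U>. \<forall>v\<in>\<V>. f0 t x u v = g\<^sub>1 t x u + g\<^sub>2 t x v) \<longrightarrow>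
               (\<exists>Q\<^sub>1 Q\<^sub>2. \<forall>s\<in>points m t. \<forall>x. \<forall>u\<in>\<U>. \<forall>v\<in>\<V>. Q s x u v = Q\<^sub>1 s x u + Q\<^sub>2 s x v))))) \<and>
     (\<forall>\<tau>\<in>{0..<T}. \<forall>w. \<forall>\<epsilon>>0. \<exists>D \<delta>. compact D \<and> \<delta> > 0 \<and>
       (\<forall>m t. time_partition \<tau> T m t \<and> mesh m t < \<delta> \<longrightarrow>
         (\<exists>Q. admissible_Q \<U> \<V> \<sigma> m t Q \<and>
              approx_Isaacs_Bellman \<U> \<V> f f0 m t D \<epsilon> Q \<and>
              (\<forall>\<pi>\<^sub>u\<in>discrete_policies m t \<U>. \<forall>\<pi>\<^sub>v\<in>discrete_policies m t \<V>.
                 (\<forall>s\<in>points m t. \<forall>x.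
                    is_arg_min (\<lambda>u. SUP v\<in>\<V>. Q s x u v) (\<lambda>u. u \<in> \<U>) (\<pi>\<^sub>u s x) \<and>
                    is_arg_max (\<lambda>v. INF u\<in>\<U>. Q s x u v) (\<lambda>v. v \<in> \<V>) (\<pi>\<^sub>v s x)) \<longrightarrow>
                 discrete_result_u \<V> f f0 \<sigma> m t \<pi>\<^sub>u 0 w \<le> V \<tau> w + \<epsilon> * T \<and>
                 discrete_result_v \<U> f f0 \<sigma> m t \<pi>\<^sub>v 0 w \<ge> V \<tau> w - \<epsilon> * T))))"
proof -
  obtain c where c: "c > 0" "\<forall>t\<in>{0..T}. \<forall>x. \<forall>u\<in>\<U>. \<forall>v\<in>\<V>.
         norm (f t x u v) + \<bar>f0 t x u v\<bar> \<le> c * (1 + norm x)"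
    using linear_growth by blast
  obtain W' where W': "continuous_on ({0..T} \<times> UNIV) W'"
    "\<forall>p\<in>{0..T} \<times> UNIV. ((\<lambda>(\<tau>, w). game_value T \<U> \<V> f f0 \<sigma> \<tau> w) has_derivative blinfun_apply (W' p))
       (at p within {0..T} \<times> UNIV)"
    using assms(13) unfolding continuously_differentiable_on_def V_def by blast
  interpret smooth_differential_game T c \<U> \<V> f f0 \<sigma> W'
    by unfold_locales (use assms(2-9) c local_Lipschitz Isaacs W' in auto)
  show ?thesis
    unfolding V_def
  proof (intro conjI allI ballI impI)
    fix D :: "(real^'n) set" and \<epsilon> :: real
    assume D: "compact D \<and> \<epsilon> > 0"
    then have "bounded D" by (simp add: compact_imp_bounded)
    then obtain R where "0 < R" "\<forall>x\<in>D. norm x \<le> R" unfolding bounded_pos by blast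
    then have R: "0 \<le> R" "D \<subseteq> cball 0 R" by auto
    obtain \<delta> where \<delta>: "\<delta> > 0"
     "\<And>\<tau> m t D. \<lbrakk>0 \<le> \<tau>; time_partition \<tau> T m t; mesh m t \<le> \<delta>; D \<subseteq> cball 0 R\<rbrakk> \<Longrightarrow>
        approx_Isaacs_Bellman \<U> \<V> f f0 m t D \<epsilon> (Q_function m t)"
      using Q_function_guarantees[of \<epsilon> R] D R by metis
    show "\<exists>\<delta>>0. \<forall>\<tau>\<in>{0..<T}. \<forall>m t. time_partition \<tau> T m t \<and> mesh m t \<le> \<delta> \<longrightarrow>
         (\<exists>Q. admissible_Q \<U> \<V> \<sigma> m t Q \<and>
              approx_Isaacs_Bellman \<U> \<V> f f0 m t D \<epsilon> Q \<and>
              ((\<exists>f\<^sub>1 f\<^sub>2. \<forall>t\<in>{0..T}. \<forall>x. \<forall>u\<in>\<U>. \<forall>v\<in>\<V>. f t x u v = f\<^sub>1 t x u + f\<^sub>2 t x v) \<and>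
               (\<exists>g\<^sub>1 g\<^sub>2. \<forall>t\<in>{0..T}. \<forall>x. \<forall>u\<in>\<U>. \<forall>v\<in>\<V>. f0 t x u v = g\<^sub>1 t x u + g\<^sub>2 t x v) \<longrightarrow>
               (\<exists>Q\<^sub>1 Q\<^sub>2. \<forall>s\<in>points m t. \<forall>x. \<forall>u\<in>\<U>. \<forall>v\<in>\<V>. Q s x u v = Q\<^sub>1 s x u + Q\<^sub>2 s x v)))"
    proof (intro exI[of _ \<delta>] conjI \<delta>(1) ballI allI impI)
      fix \<tau> m t assume \<tau>: "\<tau> \<in> {0..<T}" and t: "time_partition \<tau> T m t \<and> mesh m t \<le> \<delta>"
      show "\<exists>Q. admissible_Q \<U> \<V> \<sigma> m t Q \<and>
              approx_Isaacs_Bellman \<U> \<V> f f0 m t D \<epsilon> Q \<and>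
              ((\<exists>f\<^sub>1 f\<^sub>2. \<forall>t\<in>{0..T}. \<forall>x. \<forall>u\<in>\<U>. \<forall>v\<in>\<V>. f t x u v = f\<^sub>1 t x u + f\<^sub>2 t x v) \<and>
               (\<exists>g\<^sub>1 g\<^sub>2. \<forall>t\<in>{0..T}. \<forall>x. \<forall>u\<in>\<U>. \<forall>v\<in>\<V>. f0 t x u v = g\<^sub>1 t x u + g\<^sub>2 t x v) \<longrightarrow>
               (\<exists>Q\<^sub>1 Q\<^sub>2. \<forall>s\<in>points m t. \<forall>x. \<forall>u\<in>\<U>. \<forall>v\<in>\<V>. Q s x u v = Q\<^sub>1 s x u + Q\<^sub>2 s x v))"
      proof (intro exI[of _ "Q_function m t"] conjI impI)
        show "admissible_Q \<U> \<V> \<sigma> m t (Q_function m t)"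
          using admissible_Q_function \<tau> t by auto
        show "approx_Isaacs_Bellman \<U> \<V> f f0 m t D \<epsilon> (Q_function m t)"
          using \<delta>(2) R \<tau> t by auto
        assume sep: "(\<exists>f\<^sub>1 f\<^sub>2. \<forall>t\<in>{0..T}. \<forall>x. \<forall>u\<in>\<U>. \<forall>v\<in>\<V>. f t x u v = f\<^sub>1 t x u + f\<^sub>2 t x v) \<and>
               (\<exists>g\<^sub>1 g\<^sub>2. \<forall>t\<in>{0..T}. \<forall>x. \<forall>u\<in>\<U>. \<forall>v\<in>\<V>. f0 t x u v = g\<^sub>1 t x u + g\<^sub>2 t x v)"
        then obtain f1 f2 g1 g2 where
          "\<forall>t\<in>{0..T}. \<forall>x. \<forall>u\<in>\<U>. \<forall>v\<in>\<V>. f t x u v = f1 t x u + f2 t x v"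
          "\<forall>t\<in>{0..T}. \<forall>x. \<forall>u\<in>\<U>. \<forall>v\<in>\<V>. f0 t x u v = g1 t x u + g2 t x v" by auto
        then show "\<exists>Q\<^sub>1 Q\<^sub>2. \<forall>s\<in>points m t. \<forall>x. \<forall>u\<in>\<U>. \<forall>v\<in>\<V>. Q_function m t s x u v = Q\<^sub>1 s x u + Q\<^sub>2 s x v"
          by (intro Q_function_separable[of \<tau> m t f1 f2 g1 g2]) (use \<tau> t in auto)
      qed
    qed
  next
    fix \<tau> :: real and w :: "real^'n" and \<epsilon> :: real
    assume \<tau>: "\<tau> \<in> {0..<T}" and \<epsilon>: "\<epsilon> > 0"
    \<comment> \<open>The radius of the ball that contains all discrete motions from w, whatever the
      partition; this ball is the set D to be exhibited.\<close>
    define R where "R = (1 + norm w) * exp (c * T)"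
    have R: "0 \<le> R" by (simp add: R_def)
    obtain \<delta> where \<delta>: "\<delta> > 0"
     "\<And>\<tau> m t D. \<lbrakk>0 \<le> \<tau>; time_partition \<tau> T m t; mesh m t \<le> \<delta>; D \<subseteq> cball 0 R\<rbrakk> \<Longrightarrow>
        approx_Isaacs_Bellman \<U> \<V> f f0 m t D \<epsilon> (Q_function m t)"
     "\<And>\<tau> m t \<pi> w. \<lbrakk>0 \<le> \<tau>; time_partition \<tau> T m t; mesh m t \<le> \<delta>; (1 + norm w) * exp (c * T) \<le> R;
         \<pi> \<in> discrete_policies m t \<U>;
         \<forall>s\<in>points m t. \<forall>x. is_arg_min (\<lambda>u. SUP v\<in>\<V>. Q_function m t s x u v) (\<lambda>u. u \<in> \<U>) (\<pi> s x)\<rbrakk> \<Longrightarrow>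
        discrete_result_u \<V> f f0 \<sigma> m t \<pi> 0 w \<le> val \<tau> w + \<epsilon> * T"
     "\<And>\<tau> m t \<pi> w. \<lbrakk>0 \<le> \<tau>; time_partition \<tau> T m t; mesh m t \<le> \<delta>; (1 + norm w) * exp (c * T) \<le> R;
         \<pi> \<in> discrete_policies m t \<V>;
         \<forall>s\<in>points m t. \<forall>x. is_arg_max (\<lambda>v. INF u\<in>\<U>. Q_function m t s x u v) (\<lambda>v. v \<in> \<V>) (\<pi> s x)\<rbrakk> \<Longrightarrow>
        discrete_result_v \<U> f f0 \<sigma> m t \<pi> 0 w \<ge> val \<tau> w - \<epsilon> * T"
      using Q_function_guarantees[OF \<epsilon> R] by blast
    show "\<exists>D \<delta>. compact D \<and> \<delta> > 0 \<and>
       (\<forall>m t. time_partition \<tau> T m t \<and> mesh m t < \<delta> \<longrightarrow>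
         (\<exists>Q. admissible_Q \<U> \<V> \<sigma> m t Q \<and>
              approx_Isaacs_Bellman \<U> \<V> f f0 m t D \<epsilon> Q \<and>
              (\<forall>\<pi>\<^sub>u\<in>discrete_policies m t \<U>. \<forall>\<pi>\<^sub>v\<in>discrete_policies m t \<V>.
                 (\<forall>s\<in>points m t. \<forall>x.
                    is_arg_min (\<lambda>u. SUP v\<in>\<V>. Q s x u v) (\<lambda>u. u \<in> \<U>) (\<pi>\<^sub>u s x) \<and>
                    is_arg_max (\<lambda>v. INF u\<in>\<U>. Q s x u v) (\<lambda>v. v \<in> \<V>) (\<pi>\<^sub>v s x)) \<longrightarrow>
                 discrete_result_u \<V> f f0 \<sigma> m t \<pi>\<^sub>u 0 w \<le> val \<tau> w + \<epsilon> * T \<and>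
                 discrete_result_v \<U> f f0 \<sigma> m t \<pi>\<^sub>v 0 w \<ge> val \<tau> w - \<epsilon> * T)))"
    proof (intro exI[of _ "cball 0 R"] exI[of _ \<delta>] conjI compact_cball \<delta>(1) allI impI)
      fix m t assume "time_partition \<tau> T m t \<and> mesh m t < \<delta>"
      then have t: "0 \<le> \<tau>" "time_partition \<tau> T m t" "mesh m t \<le> \<delta>" using \<tau> by auto
      have "admissible_Q \<U> \<V> \<sigma> m t (Q_function m t)"
        by (rule admissible_Q_function[OF t(2,1)])
      moreover have "approx_Isaacs_Bellman \<U> \<V> f f0 m t (cball 0 R) \<epsilon> (Q_function m t)"
        by (rule \<delta>(2)[OF t order_refl])
      ultimately show "\<exists>Q. admissible_Q \<U> \<V> \<sigma> m t Q \<and>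
              approx_Isaacs_Bellman \<U> \<V> f f0 m t (cball 0 R) \<epsilon> Q \<and>
              (\<forall>\<pi>\<^sub>u\<in>discrete_policies m t \<U>. \<forall>\<pi>\<^sub>v\<in>discrete_policies m t \<V>.
                 (\<forall>s\<in>points m t. \<forall>x.
                    is_arg_min (\<lambda>u. SUP v\<in>\<V>. Q s x u v) (\<lambda>u. u \<in> \<U>) (\<pi>\<^sub>u s x) \<and>
                    is_arg_max (\<lambda>v. INF u\<in>\<U>. Q s x u v) (\<lambda>v. v \<in> \<V>) (\<pi>\<^sub>v s x)) \<longrightarrow>
                 discrete_result_u \<V> f f0 \<sigma> m t \<pi>\<^sub>u 0 w \<le> val \<tau> w + \<epsilon> * T \<and>
                 discrete_result_v \<U> f f0 \<sigma> m t \<pi>\<^sub>v 0 w \<ge> val \<tau> w - \<epsilon> * T)"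
        using \<delta>(3,4)[OF t eq_refl[OF R_def[symmetric]]]
        by (intro exI[of _ "Q_function m t"] conjI ballI impI) auto
    qed
  qed
qed

end
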